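(* Let $F$ be a sextic totally imaginary number field, $F_s$ its Galois closure over $\mathbb{Q}$, and $G=\mathrm{Gal}(F_s/\mathbb{Q})$ its Galois group. (1) If $G$ is $S_4$, $S_5$, or $S_6$, then $F$ is of $\mathbf{TR}$-type. (2) If $G$ is $C_6$, $S_3$, $D_6$, $S_3\times C_3$, $A_4\times C_2$, $S_3\times S_3$, or $C_3^2\rtimes D_4$, then $F$ is of $\mathbf{CM}$-type. (3) If $G=S_4\times C_2$, then $F$ can be of either type; one can distinguish between the two types by identifying an order $2$ element of $G$ that represents complex conjugation.
   Context: A number field is a finite extension of $\mathbb{Q}$; sextic means of degree $6$ over $\mathbb{Q}$. A number field is totally imaginary if it has no embedding into $\mathbb{R}$, and totally real if all of its embeddings into $\mathbb{C}$ have image in $\mathbb{R}$. A CM-number field is a totally imaginary quadratic extension of a totally real number field (where $\mathbb{Q}$ counts as totally real). A totally imaginary number field $F$ is of $\mathbf{CM}$-type if it contains a CM-subfield (possibly $F$ itself), and of $\mathbf{TR}$-type if it contains no CM-subfield. The groups are named up to isomorphism. $C_n$ is the cyclic group of order $n$, $D_n$ is the dihedral group of order $2n$, and $S_n$, $A_n$ are the symmetric and alternating groups on $n$ letters. $C_3^2\rtimes D_4$ denotes the following group of order $72$ (the transitive group 6T13): the subgroup of the group of permutations of $\{1,2,3,a,b,c\}$ generated by $C_3^2=\langle(1\,2\,3)\rangle\times\langle(a\,b\,c)\rangle$ and $D_4=\langle (1\,a\,2\,b)(3\,c),\ (a\,b)\rangle$, with $D_4$ acting on $C_3^2$ by conjugation.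 An element of $G$ representing complex conjugation is the order $2$ element obtained by fixing an embedding of $F_s$ into $\mathbb{C}$ and restricting complex conjugation to $F_s$. *)

theory Defs
  imports
    Complex_Main
    "HOL-Algebra.Algebra"
    "HOL-Algebra.Algebraic_Closure_Type"
begin

abbreviation real_field :: "real ring"
  where "real_field \<equiv> ring_of_type_algebra"

abbreviation complex_field :: "complex ring"
  where "complex_field \<equiv> ring_of_type_algebra"


section \<open>Number fields\<close>

text \<open>In characteristic 0 the subfield generated by the empty set is the unique copy of
  the rational numbers.\<close>

definition rat_subfield :: "('a, 'm) ring_scheme \<Rightarrow> 'a set"
  where "rat_subfield F = generate_field F {}"

definition number_field :: "('a, 'm) ring_scheme \<Rightarrow> bool"
  where "number_field F \<longleftrightarrow>
    field F \<and>
    (\<forall>n::nat. n > 0 \<longrightarrow> [n] \<cdot>\<^bsub>F\<^esub> \<one>\<^bsub>F\<^esub> \<noteq> \<zero>\<^bsub>F\<^esub>) \<and>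
    ring.finite_dimension F (rat_subfield F) (carrier F)"

definition sextic :: "('a, 'm) ring_scheme \<Rightarrow> bool"
  where "sextic F \<longleftrightarrow> ring.dimension F 6 (rat_subfield F) (carrier F)"

definition totally_imaginary :: "('a, 'm) ring_scheme \<Rightarrow> bool"
  where "totally_imaginary F \<longleftrightarrow> number_field F \<and> ring_hom F real_field = {}"

definition totally_real :: "('a, 'm) ring_scheme \<Rightarrow> bool"
  where "totally_real F \<longleftrightarrow>
    number_field F \<and> (\<forall>h \<in> ring_hom F complex_field. h ` carrier F \<subseteq> \<real>)"

definition CM_field :: "('a, 'm) ring_scheme \<Rightarrow> bool"
  where "CM_field F \<longleftrightarrow>
    totally_imaginary F \<and>
    (\<exists>K. subfield K F \<and> totally_real (F\<lparr>carrier := K\<rparr>) \<and> ring.dimension F 2 K (carrier F))"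

definition CM_type :: "('a, 'm) ring_scheme \<Rightarrow> bool"
  where "CM_type F \<longleftrightarrow>
    totally_imaginary F \<and> (\<exists>E. subfield E F \<and> CM_field (F\<lparr>carrier := E\<rparr>))"

definition TR_type :: "('a, 'm) ring_scheme \<Rightarrow> bool"
  where "TR_type F \<longleftrightarrow>
    totally_imaginary F \<and> \<not> (\<exists>E. subfield E F \<and> CM_field (F\<lparr>carrier := E\<rparr>))"


section \<open>Galois groups and Galois closures over the rational numbers\<close>

text \<open>As in \<^const>\<open>BijGroup\<close>, automorphisms are extensional functions on the carrier, so that
  each automorphism is represented by exactly one function.\<close>

definition Gal :: "('a, 'm) ring_scheme \<Rightarrow> ('a \<Rightarrow> 'a) monoid"
  where "Gal L = (BijGroup (carrier L))
    \<lparr>carrier := {\<sigma> \<in> ring_iso L L \<inter> Bij (carrier L). \<forall>x \<in> rat_subfield L. \<sigma> x = x}\<rparr>"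

text \<open>A finite extension is Galois iff the fixed field of its automorphism group is the base
  field.\<close>

definition Galois_number_field :: "('a, 'm) ring_scheme \<Rightarrow> bool"
  where "Galois_number_field L \<longleftrightarrow>
    number_field L \<and>
    {x \<in> carrier L. \<forall>\<sigma> \<in> carrier (Gal L). \<sigma> x = x} = rat_subfield L"

text \<open>\<open>L\<close> is Galois over the rational numbers, and for some embedding of \<open>F\<close> into \<open>L\<close> no
  proper subfield of \<open>L\<close> containing the image of \<open>F\<close> is Galois over the rational numbers.\<close>

definition Galois_closure :: "('a, 'm) ring_scheme \<Rightarrow> ('b, 'n) ring_scheme \<Rightarrow> bool"
  where "Galois_closure F L \<longleftrightarrow>
    Galois_number_field L \<and>
    (\<exists>\<iota> \<in> ring_hom F L. \<forall>E. subfield E L \<and> \<iota> ` carrier F \<subseteq> E \<and>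
       Galois_number_field (L\<lparr>carrier := E\<rparr>) \<longrightarrow> E = carrier L)"

text \<open>The restriction of complex conjugation to \<open>L\<close> along some embedding \<open>h\<close> of \<open>L\<close> into the
  complex numbers.\<close>

definition represents_conjugation :: "('a, 'm) ring_scheme \<Rightarrow> ('a \<Rightarrow> 'a) \<Rightarrow> bool"
  where "represents_conjugation L c \<longleftrightarrow>
    c \<in> carrier (Gal L) \<and>
    (\<exists>h \<in> ring_hom L complex_field. \<forall>x \<in> carrier L. h (c x) = cnj (h x))"


section \<open>Some finite groups\<close>

text \<open>The pair \<open>(i, s)\<close> stands for \<open>r\<close> to the power \<open>i\<close>, followed by the factor \<open>f\<close> if \<open>s\<close> holds,
  where \<open>r\<close> is the rotation of order \<open>n\<close> and \<open>f\<close> is a reflection, so that \<open>f r f\<close> is the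
  inverse of \<open>r\<close>. The group has order \<open>2 n\<close>.\<close>

definition dihedral_group :: "nat \<Rightarrow> (int \<times> bool) monoid"
  where "dihedral_group n =
    \<lparr>carrier = {0..<int n} \<times> UNIV,
     monoid.mult = (\<lambda>(i, s) (j, t). ((if s then i - j else i + j) mod int n, s \<noteq> t)),
     one = (0, False)\<rparr>"

text \<open>The transitive group 6T13 of order 72, with the letters \<open>a\<close>, \<open>b\<close>, \<open>c\<close> written as
  4, 5, 6. The first two generators generate the normal subgroup \<open>C\<^sub>3\<^sup>2\<close>, the last two
  generate the complement \<open>D\<^sub>4\<close>.\<close>

definition C3_squared_D4 :: "(nat \<Rightarrow> nat) monoid"
  where "C3_squared_D4 = (sym_group 6)
    \<lparr>carrier := generate (sym_group 6)
       {cycle_of_list [1, 2, 3], cycle_of_list [4, 5, 6],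
        cycle_of_list [1, 4, 2, 5] \<circ> cycle_of_list [3, 6], cycle_of_list [4, 5]}\<rparr>"

end

(* By Galois theory, F is of CM type iff there are subgroups H <= M <= N of G = Gal(L/Q), where H fixes F
   and (N : M) = 2, such that N contains all conjugates of complex conjugation c and M contains none. This
   depends only on G, on c and on the core-free subgroup H of index 6, none of whose elements is a conjugate
   of c. If c is central, take M = H and N = H <c>. For the groups of (2), the normal Sylow 3-subgroup P
   gives M = HP and N = G, except for A_4 x C_2, where the normal subgroup of order 8
   is N and M = H. For S_5 and S_6, elements of order 5 lie in every subgroup of index at most 3, hence in
   H, so that H would contain the alternating group. For S_4 and S_4 x C_2 with c not central, squares or
   products of conjugates of c likewise force the Klein four-group into H; so for S_4 x C_2 the criterion
   is that c is the central involution.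

   Both types occur for S_4 x C_2: let t_1, ..., t_4 be the roots of a quartic with zero cubic term and
   Galois group S_4, and let F be generated by i (t_1 + t_2), inside L = Q(t_1, ..., t_4, i). Then c is
   central iff all t_j are real. This holds for x^4 - 4 x^2 - x + 1 and fails for x^4 - x - 1. *)
theory Submission
  imports Defs "HOL-Computational_Algebra.Fundamental_Theorem_Algebra"
begin

section \<open>Embeddings into the complex numbers\<close>

text \<open>The Galois theory rests on one count: an embedding of a subfield into the complex
  numbers extends in exactly as many ways as the degree. Embeddings are the natural tool because the
  notions totally real, totally imaginary and complex conjugation are all stated through them. After
  fixing one embedding \<open>h\<close> of \<open>L\<close>, all others are
  \<open>h \<circ> \<rho>\<close> with \<rho> in the Galois group; this is how all conjugates of
  \<open>c\<close> enter. Since (N : M) = 2 and \<open>H\<close> has index 6, the index (M : H) is 1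
  or 3. So a CM-subfield is either imaginary quadratic or \<open>F\<close> itself over a totally
  real cubic field. Each positive result exhibits one of these two shapes, each negative one
  excludes both. In the quartic examples the zero cubic term gives t_3 + t_4 = -(t_1 + t_2), so that
  i (t_1 + t_2) has six conjugates only. The linear coefficient -1 makes the product of the three
  sums t_1 + t_j equal to 1, which puts i into the Galois closure of \<open>F\<close>. Integrality
  of the polynomials reduces the irreducibility questions to the absence of integer roots and to
  non-squares.\<close>

lemma complex_field_simps [simp]:
  "carrier complex_field = UNIV" "x \<otimes>\<^bsub>complex_field\<^esub> y = x * y" "x \<oplus>\<^bsub>complex_field\<^esub> y = x + y"
  "\<one>\<^bsub>complex_field\<^esub> = 1" "\<zero>\<^bsub>complex_field\<^esub> = 0"
  by (simp_all add: ring_of_type_algebra_def)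

lemma real_field_simps [simp]:
  "carrier real_field = UNIV" "r \<otimes>\<^bsub>real_field\<^esub> s = r * s" "r \<oplus>\<^bsub>real_field\<^esub> s = r + s"
  "\<one>\<^bsub>real_field\<^esub> = 1" "\<zero>\<^bsub>real_field\<^esub> = 0"
  by (simp_all add: ring_of_type_algebra_def)

lemma field_complex_field: "field complex_field"
  by (rule field_from_type_algebra)

interpretation CC: cring complex_field
  by (rule cring_from_type_algebra)

lemma complex_field_a_inv [simp]: "\<ominus>\<^bsub>complex_field\<^esub> x = - x"
  by (rule CC.minus_equality) auto

lemma complex_field_m_inv [simp]:
  assumes "x \<noteq> 0" shows "inv\<^bsub>complex_field\<^esub> x = inverse x"
  using assms CC.comm_inv_char[of x "inverse x"] by simp

lemma complex_field_pow [simp]: "x [^]\<^bsub>complex_field\<^esub> (n::nat) = x ^ n"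
  by (induction n) auto

text \<open>\<open>eval\<close> reads coefficient lists with the leading coefficient first,
  \<open>Poly\<close> with the constant term first; hence \<open>rev\<close>.\<close>

lemma complex_field_eval: "CC.eval p z = poly (Poly (rev p)) z"
  by (induction p) (auto simp: Poly_append poly_monom algebra_simps)

text \<open>Each embedding of \<open>E\<close> is represented by one extensional function, so that embeddings can be counted.\<close>

definition embeddings ::
    "('a, 'm) ring_scheme \<Rightarrow> 'a set \<Rightarrow> 'a set \<Rightarrow> ('a \<Rightarrow> complex) \<Rightarrow> ('a \<Rightarrow> complex) set"
  where "embeddings R K E \<phi> =
    {\<psi> \<in> ring_hom (R\<lparr>carrier := E\<rparr>) complex_field \<inter> extensional E. \<forall>x \<in> K. \<psi> x = \<phi> x}"

lemma ring_hom_subD: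
  assumes "\<phi> \<in> ring_hom (R\<lparr>carrier := K\<rparr>) S"
  shows "\<And>x. x \<in> K \<Longrightarrow> \<phi> x \<in> carrier S"
    and "\<And>x y. x \<in> K \<Longrightarrow> y \<in> K \<Longrightarrow> \<phi> (x \<otimes>\<^bsub>R\<^esub> y) = \<phi> x \<otimes>\<^bsub>S\<^esub> \<phi> y"
    and "\<And>x y. x \<in> K \<Longrightarrow> y \<in> K \<Longrightarrow> \<phi> (x \<oplus>\<^bsub>R\<^esub> y) = \<phi> x \<oplus>\<^bsub>S\<^esub> \<phi> y"
    and "\<phi> \<one>\<^bsub>R\<^esub> = \<one>\<^bsub>S\<^esub>"
  using assms by (auto simp: ring_hom_def)

lemma ring_hom_subI:
  assumes "\<And>x. x \<in> K \<Longrightarrow> \<phi> x \<in> carrier S"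
    and "\<And>x y. x \<in> K \<Longrightarrow> y \<in> K \<Longrightarrow> \<phi> (x \<otimes>\<^bsub>R\<^esub> y) = \<phi> x \<otimes>\<^bsub>S\<^esub> \<phi> y"
    and "\<And>x y. x \<in> K \<Longrightarrow> y \<in> K \<Longrightarrow> \<phi> (x \<oplus>\<^bsub>R\<^esub> y) = \<phi> x \<oplus>\<^bsub>S\<^esub> \<phi> y"
    and "\<phi> \<one>\<^bsub>R\<^esub> = \<one>\<^bsub>S\<^esub>"
  shows "\<phi> \<in> ring_hom (R\<lparr>carrier := K\<rparr>) S"
  using assms by (auto simp: ring_hom_def)

context field
begin

lemma sub_hom_ring:
  assumes "subfield K R" "\<phi> \<in> ring_hom (R\<lparr>carrier := K\<rparr>) S" "ring S"
  shows "ring_hom_ring (R\<lparr>carrier := K\<rparr>) S \<phi>"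
  using assms by (intro ring_hom_ringI2) (auto intro: subring_is_ring subfieldE)

lemma sub_hom_zero:
  assumes "subfield K R" "\<phi> \<in> ring_hom (R\<lparr>carrier := K\<rparr>) S" "ring S"
  shows "\<phi> \<zero> = \<zero>\<^bsub>S\<^esub>"
proof -
  interpret h: ring_hom_ring "R\<lparr>carrier := K\<rparr>" S \<phi>
    by (rule sub_hom_ring[OF assms])
  show ?thesis using h.hom_zero by simp
qed

lemma sub_hom_a_inv:
  assumes "subfield K R" "\<phi> \<in> ring_hom (R\<lparr>carrier := K\<rparr>) S" "ring S" "x \<in> K"
  shows "\<phi> (\<ominus> x) = \<ominus>\<^bsub>S\<^esub> \<phi> x"
proof -
  interpret S: ring S by fact
  have K: "subring K R" using assms(1) by (rule subfieldE)
  have x: "x \<in> carrier R" "\<ominus> x \<in> K" using subringE[OF K] assms(4) by auto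
  have "\<phi> (\<ominus> x) \<oplus>\<^bsub>S\<^esub> \<phi> x = \<phi> (\<ominus> x \<oplus> x)"
    using ring_hom_subD[OF assms(2)] x assms(4) by simp
  also have "\<dots> = \<zero>\<^bsub>S\<^esub>" using x sub_hom_zero[OF assms(1-3)] by (simp add: l_neg)
  finally show ?thesis
    using S.minus_equality ring_hom_subD[OF assms(2)] x assms(4) by metis
qed

lemma sub_hom_m_inv:
  assumes "subfield K R" "\<phi> \<in> ring_hom (R\<lparr>carrier := K\<rparr>) S" "field S" "x \<in> K" "x \<noteq> \<zero>"
  shows "\<phi> x \<noteq> \<zero>\<^bsub>S\<^esub>" "\<phi> (inv x) = inv\<^bsub>S\<^esub> \<phi> x"
proof -
  interpret S: field S by fact
  have x: "x \<in> carrier R" "inv x \<in> K" "inv x \<otimes> x = \<one>"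
    using subfieldE(3)[OF assms(1)] subfield_m_inv[OF assms(1), of x] assms(4,5) by auto
  have e: "\<phi> (inv x) \<otimes>\<^bsub>S\<^esub> \<phi> x = \<one>\<^bsub>S\<^esub>"
    using ring_hom_subD[OF assms(2)] x assms(4) by metis
  have c: "\<phi> x \<in> carrier S" "\<phi> (inv x) \<in> carrier S"
    using ring_hom_subD(1)[OF assms(2)] x assms(4) by auto
  show "\<phi> x \<noteq> \<zero>\<^bsub>S\<^esub>" using e c S.r_null by auto
  show "\<phi> (inv x) = inv\<^bsub>S\<^esub> \<phi> x"
    using S.comm_inv_char[of "\<phi> x" "\<phi> (inv x)"] e c S.m_comm by metis
qed

lemma sub_hom_inj:
  assumes "subfield K R" "\<phi> \<in> ring_hom (R\<lparr>carrier := K\<rparr>) S" "field S"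
  shows "inj_on \<phi> K"
proof (rule inj_onI)
  interpret S: field S by fact
  have K: "subring K R" using assms(1) by (rule subfieldE)
  fix x y assume xy: "x \<in> K" "y \<in> K" "\<phi> x = \<phi> y"
  have c: "x \<in> carrier R" "y \<in> carrier R" "\<ominus> y \<in> K" "x \<oplus> \<ominus> y \<in> K"
    using subringE[OF K] xy by auto
  have "\<phi> (x \<oplus> \<ominus> y) = \<zero>\<^bsub>S\<^esub>"
    using ring_hom_subD[OF assms(2)] sub_hom_a_inv[OF assms(1,2) S.ring_axioms] xy c
    by (simp add: S.r_neg)
  then have "x \<oplus> \<ominus> y = \<zero>"
    using sub_hom_m_inv(1)[OF assms(1-3)] c by blast
  then show "x = y" using c by (metis a_minus_def r_right_minus_eq)
qed

lemma hom_restrict_sub: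
  assumes "\<phi> \<in> ring_hom (R\<lparr>carrier := E\<rparr>) S" "K \<subseteq> E"
  shows "\<phi> \<in> ring_hom (R\<lparr>carrier := K\<rparr>) S"
  using assms by (auto simp: ring_hom_def subset_iff)

lemma same_dimension_eq:
  assumes "subfield K R" "dimension n K V" "dimension n K W" "V \<subseteq> W"
  shows "V = W"
proof -
  obtain Us where Us: "set Us \<subseteq> carrier R" "independent K Us" "length Us = n" "Span K Us = V"
    using exists_base[OF assms(1,2)] by blast
  have "set Us \<subseteq> W" using Span_base_incl[OF assms(1) Us(1)] Us(4) assms(4) by blast
  then show ?thesis
    using independent_length_eq_dimension[OF assms(1,3) Us(2)] Us(3,4) by simp
qed

text \<open>A \<open>K\<close>-basis of \<open>E\<close> still spans \<open>E\<close> over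
  \<open>K'\<close>.\<close>

lemma finite_dimension_over_larger:
  assumes "subfield K R" "subfield K' R" "K \<subseteq> K'" "subfield E R" "K' \<subseteq> E" "finite_dimension K E"
  shows "finite_dimension K' E"
proof -
  obtain n where "dimension n K E" using assms(6) by auto
  then obtain Us where Us: "set Us \<subseteq> carrier R" "Span K Us = E"
    using exists_base[OF assms(1)] by blast
  have UE: "set Us \<subseteq> E" using Span_base_incl[OF assms(1) Us(1)] Us(2) by blast
  have E: "subring E R" using assms(4) by (rule subfieldE)
  have alg: "subalgebra K' E R"
    unfolding subalgebra_def subalgebra_axioms_def
    using subringE[OF E] assms(5) subring.axioms(1)[OF E] by auto
  have "subalgebra K (Span K' Us) R"
    using Span_is_subalgebra[OF assms(2) Us(1)] assms(3)
    unfolding subalgebra_def subalgebra_axioms_def by auto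
  then have "E \<subseteq> Span K' Us"
    using subalgebra_Span_incl[OF assms(1)] Span_base_incl[OF assms(2) Us(1)] Us(2) by blast
  moreover have "Span K' Us \<subseteq> E"
    using subalgebra_Span_incl[OF assms(2) alg UE] .
  ultimately show ?thesis using Span_finite_dimension[OF assms(2) Us(1)] by simp
qed

lemma subfield_subalgebra:
  assumes "subfield E R" "K \<subseteq> E" shows "subalgebra K E R"
proof -
  have E: "subring E R" using assms(1) by (rule subfieldE)
  show ?thesis
    unfolding subalgebra_def subalgebra_axioms_def
    using subringE[OF E] assms(2) subring.axioms(1)[OF E] by auto
qed

lemma simple_extension_hom_unique:
  assumes "subfield K R" "a \<in> carrier R" "subfield (simple_extension K a) R"
    and "\<psi> \<in> ring_hom (R\<lparr>carrier := simple_extension K a\<rparr>) complex_field"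
    and "\<chi> \<in> ring_hom (R\<lparr>carrier := simple_extension K a\<rparr>) complex_field"
    and "\<And>x. x \<in> K \<Longrightarrow> \<psi> x = \<chi> x" "\<psi> a = \<chi> a" "x \<in> simple_extension K a"
  shows "\<psi> x = \<chi> x"
  using assms(8)
proof (induction rule: simple_extension.induct)
  case zero
  show ?case using sub_hom_zero[OF assms(3,4)] sub_hom_zero[OF assms(3,5)] CC.ring_axioms by simp
next
  case (lin k1 k2)
  have K: "K \<subseteq> simple_extension K a"
    using simple_extension_incl[OF subfieldE(3)[OF assms(1)] assms(2)] .
  have a: "a \<in> simple_extension K a"
    using simple_extension_mem[OF subfieldE(1)[OF assms(1)] assms(2)] .
  have m: "k1 \<otimes> a \<in> simple_extension K a" "k2 \<in> simple_extension K a"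
    using subringE(6)[OF subfieldE(1)[OF assms(3)] lin(1) a] K lin(2) by auto
  have "\<psi> (k1 \<otimes> a \<oplus> k2) = \<psi> k1 * \<psi> a + \<psi> k2"
    using ring_hom_subD[OF assms(4)] m a lin(1) by simp
  moreover have "\<chi> (k1 \<otimes> a \<oplus> k2) = \<chi> k1 * \<chi> a + \<chi> k2"
    using ring_hom_subD[OF assms(5)] m a lin(1) by simp
  ultimately show ?case using lin assms(6,7) by simp
qed

lemma sub_hom_eval:
  assumes "subfield K R" "\<phi> \<in> ring_hom (R\<lparr>carrier := K\<rparr>) complex_field"
    and "set p \<subseteq> K" "a \<in> K"
  shows "\<phi> (eval p a) = CC.eval (map \<phi> p) (\<phi> a)"
proof -
  interpret h: ring_hom_ring "R\<lparr>carrier := K\<rparr>" complex_field \<phi>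
    by (rule sub_hom_ring[OF assms(1,2) CC.ring_axioms])
  have "ring.eval (R\<lparr>carrier := K\<rparr>) = eval"
    by (rule eval_consistent[OF subfieldE(1)[OF assms(1)]])
  then show ?thesis using h.eval_hom'[of a p] assms(3,4) by simp
qed


text \<open>This is the map from \<open>K[X]\<close> that will be factored through evaluation at
  \<open>a\<close> in order to extend \<phi> to \<open>simple_extension K a\<close>.\<close>

lemma univ_poly_hom_eval:
  assumes "subfield K R" "\<phi> \<in> ring_hom (R\<lparr>carrier := K\<rparr>) complex_field"
  shows "(\<lambda>p. CC.eval (map \<phi> p) b) \<in> ring_hom (K[X]) complex_field"
proof -
  interpret h: ring_hom_ring "R\<lparr>carrier := K\<rparr>" complex_field \<phi>
    by (rule sub_hom_ring[OF assms CC.ring_axioms])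
  have K: "subring K R" using assms(1) by (rule subfieldE)
  \<comment> \<open>Applying \<phi> to a sum or product of coefficient lists agrees with the sum or
    product of the images up to leading zeros, which evaluation ignores.\<close>
  have norm: "CC.eval (CC.normalize q) b = CC.eval q b" for q
    by (rule CC.eval_normalize) auto
  show ?thesis
  proof (rule ring_hom_memI)
    fix p q assume pq: "p \<in> carrier (K[X])" "q \<in> carrier (K[X])"
    then have s: "set p \<subseteq> K" "set q \<subseteq> K"
      using polynomial_incl by (auto simp: univ_poly_carrier[symmetric])
    have "CC.eval (map \<phi> (poly_mult p q)) b = CC.eval (CC.poly_mult (map \<phi> p) (map \<phi> q)) b"
      using h.poly_mult_hom'[of p q] s norm[of "map \<phi> (poly_mult p q)"] by (simp add: K)
    then show "CC.eval (map \<phi> (p \<otimes>\<^bsub>K[X]\<^esub> q)) b =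
        CC.eval (map \<phi> p) b \<otimes>\<^bsub>complex_field\<^esub> CC.eval (map \<phi> q) b"
      using CC.eval_poly_mult[of "map \<phi> p" "map \<phi> q" b] by (simp add: univ_poly_mult)
    have "CC.eval (map \<phi> (poly_add p q)) b = CC.eval (CC.poly_add (map \<phi> p) (map \<phi> q)) b"
      using h.poly_add_hom'[of p q] s norm[of "map \<phi> (poly_add p q)"]
      by (simp add: K del: poly_add.simps CC.poly_add.simps)
    then show "CC.eval (map \<phi> (p \<oplus>\<^bsub>K[X]\<^esub> q)) b =
        CC.eval (map \<phi> p) b \<oplus>\<^bsub>complex_field\<^esub> CC.eval (map \<phi> q) b"
      using CC.eval_poly_add[of "map \<phi> p" "map \<phi> q" b]
      by (simp add: univ_poly_add del: poly_add.simps CC.poly_add.simps)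
  qed (use ring_hom_subD[OF assms(2)] in \<open>auto simp: univ_poly_one\<close>)
qed

text \<open>\<open>simple_extension K a\<close> is the quotient of \<open>K[X]\<close> by the kernel
  of evaluation at \<open>a\<close>, which is generated by \<open>Irr K a\<close>. Applying \<phi>
  to the coefficients and evaluating at a root \<open>b\<close> of the image of
  \<open>Irr K a\<close> kills this kernel.\<close>

lemma simple_extension_hom_exists:
  assumes K: "subfield K R" and \<phi>: "\<phi> \<in> ring_hom (R\<lparr>carrier := K\<rparr>) complex_field"
    and a: "a \<in> carrier R" "(algebraic over K) a"
    and b: "CC.eval (map \<phi> (Irr K a)) b = 0"
  obtains \<psi> where "\<psi> \<in> ring_hom (R\<lparr>carrier := simple_extension K a\<rparr>) complex_field"
    "\<And>x. x \<in> K \<Longrightarrow> \<psi> x = \<phi> x" "\<psi> a = b"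
proof -
  have Ks: "subring K R" and Kc: "K \<subseteq> carrier R" using K by (auto intro: subfieldE)
  interpret UP: cring "K[X]" by (rule univ_poly_is_cring[OF Ks])
  define \<Phi> where "\<Phi> p = CC.eval (map \<phi> p) b" for p
  have \<Phi>: "\<Phi> \<in> ring_hom (K[X]) complex_field"
    unfolding \<Phi>_def by (rule univ_poly_hom_eval[OF K \<phi>])
  interpret ev: ring_hom_ring "K[X]" R "\<lambda>p. eval p a"
    by (rule eval_ring_hom[OF Ks a(1)])
  interpret Ph: ring_hom_ring "K[X]" complex_field \<Phi>
    using \<Phi> UP.ring_axioms CC.ring_axioms by (intro ring_hom_ringI2)
  have wd: "\<Phi> p = \<Phi> q" if "p \<in> carrier (K[X])" "q \<in> carrier (K[X])" "eval p a = eval q a" for p q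
  proof -
    let ?d = "p \<ominus>\<^bsub>K[X]\<^esub> q"
    have d: "?d \<in> carrier (K[X])" using that by simp
    have "eval ?d a = \<zero>"
      using that ev.hom_closed by (simp add: a_minus_def ev.hom_add ev.hom_a_inv r_neg)
    then have "Irr K a divides\<^bsub>K[X]\<^esub> ?d"
      using Irr_minimal[OF K a d] pdivides_iff_shell[OF K IrrE(1)[OF K a] d] by simp
    then obtain r where r: "r \<in> carrier (K[X])" "?d = Irr K a \<otimes>\<^bsub>K[X]\<^esub> r"
      by (auto simp: factor_def)
    have "\<Phi> ?d = \<Phi> (Irr K a) * \<Phi> r"
      using r IrrE(1)[OF K a] Ph.hom_mult by simp
    also have "\<Phi> (Irr K a) = 0" using b by (simp add: \<Phi>_def)
    finally have "\<Phi> ?d = 0" by simp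
    then show ?thesis
      using that by (simp add: a_minus_def Ph.hom_add Ph.hom_a_inv)
  qed
  \<comment> \<open>The representing polynomial is chosen arbitrarily; by \<open>wd\<close> the
    value does not depend on it.\<close>
  define \<psi> where "\<psi> x = \<Phi> (SOME p. p \<in> carrier (K[X]) \<and> eval p a = x)" for x
  have \<psi>: "\<psi> (eval p a) = \<Phi> p" if "p \<in> carrier (K[X])" for p
  proof -
    let ?q = "SOME q. q \<in> carrier (K[X]) \<and> eval q a = eval p a"
    have "?q \<in> carrier (K[X]) \<and> eval ?q a = eval p a"
      using that by (intro someI[of "\<lambda>q. q \<in> carrier (K[X]) \<and> eval q a = eval p a" p]) auto
    then show ?thesis using wd that unfolding \<psi>_def by metis
  qed
  have img: "simple_extension K a = (\<lambda>p. eval p a) ` carrier (K[X])"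
    by (rule simple_extension_as_eval_img[OF Kc a(1)])
  have one: "\<psi> \<one> = 1"
    using \<psi>[OF UP.one_closed] by (simp add: ev.hom_one[symmetric] del: ev.hom_one)
  show thesis
  proof
    show "\<psi> \<in> ring_hom (R\<lparr>carrier := simple_extension K a\<rparr>) complex_field"
    proof (rule ring_hom_subI)
      fix x y assume "x \<in> simple_extension K a" "y \<in> simple_extension K a"
      then obtain p q where pq: "p \<in> carrier (K[X])" "q \<in> carrier (K[X])" "x = eval p a" "y = eval q a"
        using img by auto
      show "\<psi> (x \<otimes> y) = \<psi> x \<otimes>\<^bsub>complex_field\<^esub> \<psi> y"
        using \<psi>[OF UP.m_closed[OF pq(1,2)]] pq \<psi> Ph.hom_mult[OF pq(1,2)] ev.hom_mult[OF pq(1,2)] by simp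
      show "\<psi> (x \<oplus> y) = \<psi> x \<oplus>\<^bsub>complex_field\<^esub> \<psi> y"
        using \<psi>[OF UP.a_closed[OF pq(1,2)]] pq \<psi> Ph.hom_add[OF pq(1,2)] ev.hom_add[OF pq(1,2)] by simp
    qed (use one in auto)
    show "\<psi> x = \<phi> x" if x: "x \<in> K" for x
    proof (cases "x = \<zero>")
      case True
      show ?thesis using \<psi>[of "[]"] sub_hom_zero[OF K \<phi> CC.ring_axioms] True
        by (simp add: \<Phi>_def univ_poly_zero_closed)
    next
      case False
      then have "[x] \<in> carrier (K[X])" using x by (simp add: univ_poly_carrier[symmetric] polynomial_def)
      from \<psi>[OF this] show ?thesis using x Kc by (auto simp: \<Phi>_def)
    qed
    have "[\<one>, \<zero>] \<in> carrier (K[X])" using var_closed(1)[OF Ks] by (simp add: var_def)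
    from \<psi>[OF this] show "\<psi> a = b"
      using a(1) ring_hom_subD(4)[OF \<phi>] sub_hom_zero[OF K \<phi> CC.ring_axioms] by (simp add: var_def \<Phi>_def)
  qed
qed

lemma simple_extension_hom_eval:
  assumes K: "subfield K R" and a: "a \<in> carrier R" "(algebraic over K) a"
    and \<psi>: "\<psi> \<in> ring_hom (R\<lparr>carrier := simple_extension K a\<rparr>) complex_field"
    and S: "subfield (simple_extension K a) R" and p: "set p \<subseteq> K"
  shows "\<psi> (eval p a) = CC.eval (map \<psi> p) (\<psi> a)"
  using sub_hom_eval[OF S \<psi>] p simple_extension_mem[OF subfieldE(1)[OF K] a(1)]
    simple_extension_incl[OF subfieldE(3)[OF K] a(1)] by auto

lemma card_roots_Irr:
  assumes K: "subfield K R" and \<phi>: "\<phi> \<in> ring_hom (R\<lparr>carrier := K\<rparr>) complex_field"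
    and a: "a \<in> carrier R" "(algebraic over K) a"
  shows "finite {b. CC.eval (map \<phi> (Irr K a)) b = 0}"
    "card {b. CC.eval (map \<phi> (Irr K a)) b = 0} = length (Irr K a) - 1"
proof -
  have Ks: "subring K R" and Kc: "K \<subseteq> carrier R" using K by (auto intro: subfieldE)
  define p where "p = Irr K a"
  define P where "P = Poly (rev (map \<phi> p))"
  have pc: "p \<in> carrier (K[X])" and p1: "length p - 1 \<ge> 1"
    using IrrE[OF K a] pirreducible_degree[OF K] by (auto simp: p_def)
  have pne: "p \<noteq> []" using p1 by auto
  have pK: "set p \<subseteq> K" using pc polynomial_incl by (auto simp: univ_poly_carrier[symmetric])
  have lead: "\<phi> (hd p) = 1" using IrrE(3)[OF K a] ring_hom_subD(4)[OF \<phi>] by (simp add: p_def)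
  have cP: "coeffs P = rev (map \<phi> p)"
    unfolding P_def using lead pne by (cases p) (auto simp: coeffs_Poly strip_while_def)
  have degP: "Polynomial.degree P = length p - 1"
    by (simp add: degree_eq_length_coeffs cP)
  have eqP: "{b. CC.eval (map \<phi> (Irr K a)) b = 0} = {b. poly P b = 0}"
    by (simp add: complex_field_eval P_def p_def)
  have coeffK: "Polynomial.coeff P n \<in> \<phi> ` K" for n
  proof (cases "n < length p")
    case True
    then have "coeffs P ! n \<in> set (coeffs P)" by (intro nth_mem) (simp add: cP)
    moreover have "coeffs P ! n = Polynomial.coeff P n"
      using True degP cP by (intro coeffs_nth) auto
    ultimately have "Polynomial.coeff P n \<in> set (coeffs P)" by simp
    then show ?thesis using pK by (auto simp: cP)
  next
    case False
    then have "Polynomial.coeff P n = 0" using degP p1 by (intro coeff_eq_0) auto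
    then show ?thesis using sub_hom_zero[OF K \<phi> CC.ring_axioms] subringE(2)[OF Ks] by force
  qed
  \<comment> \<open>Differentiation multiplies coefficients by natural numbers, so these have to be
    in the image of \<phi> too.\<close>
  have natK: "of_nat n \<in> \<phi> ` K" for n
  proof (induction n)
    case 0
    then show ?case using sub_hom_zero[OF K \<phi> CC.ring_axioms] subringE(2)[OF Ks] by force
  next
    case (Suc n)
    then obtain k where k: "k \<in> K" "of_nat n = \<phi> k" by auto
    have "\<phi> (\<one> \<oplus> k) = of_nat (Suc n)"
      using ring_hom_subD(3,4)[OF \<phi>] k subringE(3)[OF Ks] by simp
    then show ?case using subringE(7)[OF Ks subringE(3)[OF Ks] k(1)] by (metis imageI)
  qed
  have dK: "Polynomial.coeff (pderiv P) n \<in> \<phi> ` K" for n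
  proof -
    obtain k l where kl: "k \<in> K" "l \<in> K" "of_nat (Suc n) = \<phi> k" "Polynomial.coeff P (Suc n) = \<phi> l"
      using natK[of "Suc n"] coeffK[of "Suc n"] by auto
    have "Polynomial.coeff (pderiv P) n = \<phi> (k \<otimes> l)"
      using kl ring_hom_subD(2)[OF \<phi>] by (simp add: coeff_pderiv del: of_nat_Suc)
    then show ?thesis using subringE(6)[OF Ks kl(1,2)] by blast
  qed
  have dP: "pderiv P \<noteq> 0" using degP p1 by (simp add: pderiv_eq_0_iff)
  have "rsquarefree P"
    unfolding rsquarefree_roots
  proof (intro allI notI)
    fix b assume b: "poly P b = 0 \<and> poly (pderiv P) b = 0"
    then have "CC.eval (map \<phi> (Irr K a)) b = 0" by (simp add: complex_field_eval P_def p_def)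
    then obtain \<psi> where \<psi>: "\<psi> \<in> ring_hom (R\<lparr>carrier := simple_extension K a\<rparr>) complex_field"
      "\<And>x. x \<in> K \<Longrightarrow> \<psi> x = \<phi> x" "\<psi> a = b"
      using simple_extension_hom_exists[OF K \<phi> a] by metis
    have S: "subfield (simple_extension K a) R"
      using simple_extension_is_subfield[OF K a(1)] a(2) by simp
    \<comment> \<open>The derivative pulled back along \<phi>, leading coefficient first.\<close>
    define q where "q = map (inv_into K \<phi>) (rev (coeffs (pderiv P)))"
    have sc: "set (coeffs (pderiv P)) \<subseteq> \<phi> ` K"
      using dK by (auto simp: coeffs_def)
    have qK: "set q \<subseteq> K" using sc by (auto simp: q_def inv_into_into)
    have mq: "map \<phi> q = rev (coeffs (pderiv P))"
      unfolding q_def map_map using sc by (intro map_idI) (auto simp: f_inv_into_f)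
    have qne: "q \<noteq> []" using dP by (simp add: q_def)
    have hdq: "\<phi> (hd q) = lead_coeff (pderiv P)"
      using qne dP mq by (metis hd_map hd_rev last_coeffs_eq_coeff_degree)
    have "hd q \<noteq> \<zero>"
      using hdq dP sub_hom_zero[OF K \<phi> CC.ring_axioms] by auto
    then have qc: "q \<in> carrier (K[X])" using qK by (simp add: univ_poly_carrier[symmetric] polynomial_def)
    have "\<psi> (eval q a) = CC.eval (map \<psi> q) b"
      using simple_extension_hom_eval[OF K a \<psi>(1) S qK] \<psi>(3) by simp
    also have "map \<psi> q = map \<phi> q" using \<psi>(2) qK by auto
    also have "CC.eval (map \<phi> q) b = 0"
      using b by (simp add: mq complex_field_eval)
    finally have "eval q a = \<zero>"
      using sub_hom_m_inv(1)[OF S \<psi>(1) field_complex_field, of "eval q a"]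
        simple_extension_as_eval_img[OF Kc a(1)] qc by auto
    then have "Irr K a pdivides q" using Irr_minimal[OF K a qc] by simp
    then have "length p - 1 \<le> length q - 1"
      using pdivides_imp_degree_le[OF Ks] pc qc qne by (simp add: p_def)
    also have "length q - 1 = Polynomial.degree (pderiv P)"
      by (simp add: q_def degree_eq_length_coeffs)
    also have "\<dots> = length p - 1 - 1" by (simp add: degree_pderiv degP)
    finally show False using p1 by simp
  qed
  then have *: "smult (lead_coeff P) (\<Prod>z | poly P z = 0. [:- z, 1:]) = P"
    by (rule complex_poly_decompose_rsquarefree)
  have "P \<noteq> 0" using dP by auto
  then show fin: "finite {b. CC.eval (map \<phi> (Irr K a)) b = 0}"
    unfolding eqP by (rule poly_roots_finite)
  have "Polynomial.degree P = Polynomial.degree (\<Prod>z | poly P z = 0. [:- z, 1:])"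
    using \<open>P \<noteq> 0\<close> by (subst *[symmetric]) simp
  also have "\<dots> = card {z. poly P z = 0}"
    by (subst degree_prod_eq_sum_degree) auto
  finally show "card {b. CC.eval (map \<phi> (Irr K a)) b = 0} = length (Irr K a) - 1"
    unfolding eqP degP by (simp add: p_def)
qed


lemma embeddings_simple_extension:
  assumes K: "subfield K R" and \<phi>: "\<phi> \<in> ring_hom (R\<lparr>carrier := K\<rparr>) complex_field"
    and a: "a \<in> carrier R" "(algebraic over K) a"
  shows "bij_betw (\<lambda>\<psi>. \<psi> a) (embeddings R K (simple_extension K a) \<phi>)
    {b. CC.eval (map \<phi> (Irr K a)) b = 0}"
proof (rule bij_betw_imageI)
  let ?E = "simple_extension K a"
  have S: "subfield ?E R"
    using simple_extension_is_subfield[OF K a(1)] a(2) by simp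
  have aE: "a \<in> ?E" using simple_extension_mem[OF subfieldE(1)[OF K] a(1)] .
  have KE: "K \<subseteq> ?E" using simple_extension_incl[OF subfieldE(3)[OF K] a(1)] .
  have IK: "set (Irr K a) \<subseteq> K"
    using IrrE(1)[OF K a] polynomial_incl by (auto simp: univ_poly_carrier[symmetric])
  show "inj_on (\<lambda>\<psi>. \<psi> a) (embeddings R K ?E \<phi>)"
  proof (rule inj_onI)
    fix \<psi> \<chi> assume *: "\<psi> \<in> embeddings R K ?E \<phi>" "\<chi> \<in> embeddings R K ?E \<phi>" "\<psi> a = \<chi> a"
    show "\<psi> = \<chi>"
    proof (rule extensionalityI[of _ ?E])
      fix x assume "x \<in> ?E"
      then show "\<psi> x = \<chi> x"
        using simple_extension_hom_unique[OF K a(1) S, of \<psi> \<chi> x] * by (auto simp: embeddings_def)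
    qed (use * in \<open>auto simp: embeddings_def\<close>)
  qed
  show "(\<lambda>\<psi>. \<psi> a) ` embeddings R K ?E \<phi> = {b. CC.eval (map \<phi> (Irr K a)) b = 0}"
  proof safe
    fix \<psi> assume \<psi>: "\<psi> \<in> embeddings R K ?E \<phi>"
    then have h: "\<psi> \<in> ring_hom (R\<lparr>carrier := ?E\<rparr>) complex_field" "\<And>x. x \<in> K \<Longrightarrow> \<psi> x = \<phi> x"
      by (auto simp: embeddings_def)
    have "map \<psi> (Irr K a) = map \<phi> (Irr K a)" using h(2) IK by auto
    then have *: "CC.eval (map \<phi> (Irr K a)) (\<psi> a) = CC.eval (map \<psi> (Irr K a)) (\<psi> a)"
      by (rule arg_cong[OF sym, of _ _ "\<lambda>q. CC.eval q (\<psi> a)"])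
    have "CC.eval (map \<phi> (Irr K a)) (\<psi> a) = \<psi> (eval (Irr K a) a)"
      unfolding * using simple_extension_hom_eval[OF K a h(1) S IK] by (rule sym)
    also have "\<dots> = 0" using IrrE(4)[OF K a] sub_hom_zero[OF S h(1) CC.ring_axioms] by simp
    finally show "CC.eval (map \<phi> (Irr K a)) (\<psi> a) = 0" .
  next
    fix b assume "CC.eval (map \<phi> (Irr K a)) b = 0"
    then obtain \<psi> where \<psi>: "\<psi> \<in> ring_hom (R\<lparr>carrier := ?E\<rparr>) complex_field"
      "\<And>x. x \<in> K \<Longrightarrow> \<psi> x = \<phi> x" "\<psi> a = b"
      using simple_extension_hom_exists[OF K \<phi> a] by metis
    let ?r = "restrict \<psi> ?E"
    have "?r \<in> ring_hom (R\<lparr>carrier := ?E\<rparr>) complex_field"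
      using \<psi>(1) subringE[OF subfieldE(1)[OF S]] by (auto simp: ring_hom_def)
    then have "?r \<in> embeddings R K ?E \<phi>"
      using \<psi>(2) KE by (auto simp: embeddings_def)
    then show "b \<in> (\<lambda>\<psi>. \<psi> a) ` embeddings R K ?E \<phi>"
      using aE \<psi>(3) by (intro image_eqI[of _ _ ?r]) auto
  qed
qed

text \<open>Sorting the embeddings of \<open>E\<close> by their restriction to \<open>K'\<close>
  makes the numbers of extensions multiplicative, like degrees.\<close>

lemma embeddings_tower:
  assumes K: "subfield K R" and K': "subfield K' R" and E: "subfield E R" and le: "K \<subseteq> K'" "K' \<subseteq> E"
  shows "embeddings R K E \<phi> = (\<Union>\<phi>' \<in> embeddings R K K' \<phi>. embeddings R K' E \<phi>')"
    and "disjoint_family_on (\<lambda>\<phi>'. embeddings R K' E \<phi>') (embeddings R K K' \<phi>)"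
proof -
  show "embeddings R K E \<phi> = (\<Union>\<phi>' \<in> embeddings R K K' \<phi>. embeddings R K' E \<phi>')"
  proof safe
    fix \<psi> assume \<psi>: "\<psi> \<in> embeddings R K E \<phi>"
    let ?r = "restrict \<psi> K'"
    have "?r \<in> ring_hom (R\<lparr>carrier := K'\<rparr>) complex_field"
      using \<psi> subringE[OF subfieldE(1)[OF K']] le by (auto simp: ring_hom_def embeddings_def subset_iff)
    then have "?r \<in> embeddings R K K' \<phi>" "\<psi> \<in> embeddings R K' E ?r"
      using \<psi> le by (auto simp: embeddings_def)
    then show "\<psi> \<in> (\<Union>\<phi>' \<in> embeddings R K K' \<phi>. embeddings R K' E \<phi>')" by blast
  qed (use le in \<open>auto simp: embeddings_def\<close>)
  show "disjoint_family_on (\<lambda>\<phi>'. embeddings R K' E \<phi>') (embeddings R K K' \<phi>)"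
    unfolding disjoint_family_on_def
  proof safe
    fix \<phi>1 \<phi>2 \<psi> assume *: "\<phi>1 \<in> embeddings R K K' \<phi>" "\<phi>2 \<in> embeddings R K K' \<phi>" "\<phi>1 \<noteq> \<phi>2"
      "\<psi> \<in> embeddings R K' E \<phi>1" "\<psi> \<in> embeddings R K' E \<phi>2"
    have "\<phi>1 = \<phi>2"
      by (rule extensionalityI[of _ K']) (use * in \<open>auto simp: embeddings_def\<close>)
    then show "\<psi> \<in> {}" using * by simp
  qed
qed

text \<open>Induction on the degree, adjoining one element at a time: the degree of \<open>E\<close>
  over \<open>simple_extension K a\<close> is smaller than \<open>n\<close>, and for a simple
  extension the count is the number of roots of \<open>Irr K a\<close>. No primitive element is
  required. The claim \<open>n > 0\<close> is included for later cancellations.\<close>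

theorem card_embeddings:
  assumes "subfield K R" "subfield E R" "K \<subseteq> E" "dimension n K E"
    and "\<phi> \<in> ring_hom (R\<lparr>carrier := K\<rparr>) complex_field"
  shows "finite (embeddings R K E \<phi>) \<and> card (embeddings R K E \<phi>) = n \<and> n > 0"
  using assms
proof (induction n arbitrary: K \<phi> rule: less_induct)
  case (less n)
  note K = less.prems(1) and E = less.prems(2) and KE = less.prems(3) and n = less.prems(4) and \<phi> = less.prems(5)
  have Ks: "subring K R" and Es: "subring E R" using K E by (auto intro: subfieldE)
  show ?case
  proof (cases "K = E")
    case True
    have n1: "n = 1" using dimension_is_inj[OF K n] dimension_one[OF K] True by simp
    have "embeddings R K E \<phi> = {restrict \<phi> E}"
    proof
      have "restrict \<phi> E \<in> ring_hom (R\<lparr>carrier := E\<rparr>) complex_field"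
        using \<phi> True subringE[OF Es] by (auto simp: ring_hom_def)
      then show "{restrict \<phi> E} \<subseteq> embeddings R K E \<phi>" using True by (auto simp: embeddings_def)
      show "embeddings R K E \<phi> \<subseteq> {restrict \<phi> E}"
        using True by (auto simp: embeddings_def intro!: extensionalityI[of _ E])
    qed
    then show ?thesis using n1 by simp
  next
    case False
    then obtain a where a: "a \<in> E" "a \<notin> K" using KE by blast
    have aR: "a \<in> carrier R" using a subfieldE(3)[OF E] by blast
    have fd: "finite_dimension K E" using n by (rule finite_dimensionI)
    have alg: "(algebraic over K) a"
      by (rule finite_dimension_imp_algebraic[OF K Es fd a(1)])
    define K' where "K' = simple_extension K a"
    have K': "subfield K' R" using simple_extension_is_subfield[OF K aR] alg by (simp add: K'_def)
    have KK': "K \<subseteq> K'" using simple_extension_incl[OF subfieldE(3)[OF K] aR] by (simp add: K'_def)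
    have K'E: "K' \<subseteq> E" using simple_extension_subring_incl[OF Es KE a(1)] by (simp add: K'_def)
    have aK': "a \<in> K'" using simple_extension_mem[OF Ks aR] by (simp add: K'_def)
    define d where "d = length (Irr K a) - 1"
    have d: "dimension d K K'" using dimension_simple_extension[OF K aR alg] by (simp add: K'_def d_def)
    obtain m where m: "dimension m K' E"
      using finite_dimension_over_larger[OF K K' KK' E K'E fd] by auto
    have nm: "n = d * m" using dimension_is_inj[OF K n telescopic_base[OF K K' d m]] .
    have "n \<noteq> 0"
    proof
      assume "n = 0"
      then have "E = {\<zero>}" using n dimension_zero[OF K] by simp
      then show False using subringE(3)[OF Es] subfieldE(6)[OF E] by simp
    qed
    \<comment> \<open>Degree 1 would give \<open>K' = K\<close>, but \<open>a\<close> is not in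
      \<open>K\<close>. This makes the induction descend.\<close>
    moreover have "d \<noteq> 1"
      using same_dimension_eq[OF K _ _ KK'] dimension_one[OF K] d aK' a(2) by auto
    ultimately have "d > 1" "m > 0" using nm by (auto intro!: Nat.gr0I)
    then have "m < n" using nm by simp
    have c1: "finite (embeddings R K K' \<phi>) \<and> card (embeddings R K K' \<phi>) = d"
      using bij_betw_same_card[OF embeddings_simple_extension[OF K \<phi> aR alg]]
        bij_betw_finite[OF embeddings_simple_extension[OF K \<phi> aR alg]]
        card_roots_Irr[OF K \<phi> aR alg] by (simp add: K'_def d_def)
    have c2: "finite (embeddings R K' E \<phi>') \<and> card (embeddings R K' E \<phi>') = m"
      if "\<phi>' \<in> embeddings R K K' \<phi>" for \<phi>'
      using less.IH[OF \<open>m < n\<close> K' E K'E m] that by (auto simp: embeddings_def)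
    have "finite (embeddings R K E \<phi>)"
      unfolding embeddings_tower(1)[OF K K' E KK' K'E] using c1 c2 by blast
    moreover have "card (embeddings R K E \<phi>) = (\<Sum>\<phi>'\<in>embeddings R K K' \<phi>. card (embeddings R K' E \<phi>'))"
      unfolding embeddings_tower(1)[OF K K' E KK' K'E]
      using c1 c2 embeddings_tower(2)[OF K K' E KK' K'E, of \<phi>]
      by (intro card_UN_disjoint) (auto simp: disjoint_family_on_def)
    ultimately show ?thesis using c1 c2 nm \<open>n \<noteq> 0\<close> by simp
  qed
qed

corollary embedding_extends:
  assumes "subfield K R" "subfield E R" "K \<subseteq> E" "finite_dimension K E"
    and "\<phi> \<in> ring_hom (R\<lparr>carrier := K\<rparr>) complex_field"
  obtains \<psi> where "\<psi> \<in> ring_hom (R\<lparr>carrier := E\<rparr>) complex_field" "\<And>x. x \<in> K \<Longrightarrow> \<psi> x = \<phi> x"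
proof -
  obtain n where n: "dimension n K E" using assms(4) by auto
  have "embeddings R K E \<phi> \<noteq> {}"
    using card_embeddings[OF assms(1-3) n assms(5)] by auto
  then show ?thesis using that by (auto simp: embeddings_def)
qed

end

section \<open>The prime field and number fields\<close>

lemma (in field) rat_subfield_subfield: "subfield (rat_subfield R) R"
  unfolding rat_subfield_def by (rule generate_field_is_subfield) simp

lemma (in field) rat_subfield_subset:
  assumes "subfield K R" shows "rat_subfield R \<subseteq> K"
  unfolding rat_subfield_def using generate_field_min_subfield1[of "{}" K] assms by simp

lemma (in field) rat_subfield_sub:
  assumes "subfield K R" shows "rat_subfield (R\<lparr>carrier := K\<rparr>) = rat_subfield R"
  unfolding rat_subfield_def using subfield_gen_equality[OF assms, of "{}"] by simp

lemma (in field) homs_agree_on_rat_subfield: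
  assumes "subfield K R" "\<phi> \<in> ring_hom (R\<lparr>carrier := K\<rparr>) S" "\<psi> \<in> ring_hom (R\<lparr>carrier := K\<rparr>) S" "field S"
    and "x \<in> rat_subfield R"
  shows "\<phi> x = \<psi> x"
proof -
  interpret S: field S by fact
  have sub: "y \<in> K" if "y \<in> generate_field R {}" for y
    using that rat_subfield_subset[OF assms(1)] by (auto simp: rat_subfield_def)
  note \<phi> = ring_hom_subD[OF assms(2)] and \<psi> = ring_hom_subD[OF assms(3)]
  show ?thesis
    using assms(5) unfolding rat_subfield_def
  proof (induction rule: generate_field.induct)
    case (a_inv x)
    then show ?case
      using sub_hom_a_inv[OF assms(1,2) S.ring_axioms] sub_hom_a_inv[OF assms(1,3) S.ring_axioms] sub by simp
  next
    case (m_inv x)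
    then show ?case
      using sub_hom_m_inv(2)[OF assms(1,2,4)] sub_hom_m_inv(2)[OF assms(1,3,4)] sub by simp
  qed (use \<phi> \<psi> sub in auto)
qed

text \<open>Every element of the prime field is a quotient of two integer multiples of
  \<open>\<one>\<close>, and it is sent to the same quotient of complex numbers. Characteristic 0
  makes the quotient well defined.\<close>

lemma (in field) rat_subfield_hom_exists:
  assumes char0: "\<And>n::nat. n > 0 \<Longrightarrow> add_pow R n \<one> \<noteq> \<zero>"
  obtains \<phi> where "\<phi> \<in> ring_hom (R\<lparr>carrier := rat_subfield R\<rparr>) complex_field"
proof -
  define \<iota> :: "int \<Rightarrow> 'a" where "\<iota> k = add_pow R k \<one>" for k
  have c[simp]: "\<iota> k \<in> carrier R" for k by (simp add: \<iota>_def)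
  have add: "\<iota> (a + b) = \<iota> a \<oplus> \<iota> b" for a b
    by (simp add: \<iota>_def add.int_pow_mult)
  have mult: "\<iota> (a * b) = \<iota> a \<otimes> \<iota> b" for a b
  proof -
    have "\<iota> (a * b) = add_pow R b (\<iota> a)" unfolding \<iota>_def by (simp add: add.int_pow_pow mult.commute)
    also have "\<dots> = \<iota> a \<otimes> \<iota> b"
      using add_pow_rdistr_int[of "\<iota> a" \<one> b] by (simp add: \<iota>_def)
    finally show ?thesis .
  qed
  have one: "\<iota> 1 = \<one>" and zero: "\<iota> 0 = \<zero>" using int_pow_0[of "add_monoid R" \<one>] add.int_pow_1[of \<one>] by (simp_all add: \<iota>_def add_pow_def)
  have minus: "\<iota> (- a) = \<ominus> \<iota> a" for a
    using add[of "-a" a] zero minus_equality[of "\<iota> (-a)" "\<iota> a"] by simp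
  have pos: "\<iota> b \<noteq> \<zero>" if "b > 0" for b
    using char0[of "nat b"] that add_pow_int_ge[of b R \<one>] by (simp add: \<iota>_def)
  have nz: "\<iota> b \<noteq> \<zero>" if "b \<noteq> 0" for b
  proof (cases "b > 0")
    case False
    then have "\<iota> (- b) \<noteq> \<zero>" using that by (intro pos) simp
    then show ?thesis using minus[of b] by auto
  qed (rule pos)
  \<comment> \<open>\<open>P x a b\<close> expresses x = a/b without inverses, so that the closure
    properties are the usual rules for fractions.\<close>
  define P where "P x a b \<longleftrightarrow> x \<in> carrier R \<and> b \<noteq> 0 \<and> \<iota> b \<otimes> x = \<iota> a" for x and a b :: int
  have Pc: "x \<in> carrier R" if "P x a b" for x a b using that by (simp add: P_def)
  have Padd: "P (x \<oplus> y) (a * d + c * b) (b * d)" if "P x a b" "P y c d" for x y a b c d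
  proof -
    have "\<iota> (b * d) \<otimes> (x \<oplus> y) = (\<iota> b \<otimes> x) \<otimes> \<iota> d \<oplus> (\<iota> d \<otimes> y) \<otimes> \<iota> b"
      using Pc[OF that(1)] Pc[OF that(2)] unfolding mult by (simp add: r_distr m_ac)
    then show ?thesis using that by (simp add: P_def add mult)
  qed
  have Pmult: "P (x \<otimes> y) (a * c) (b * d)" if "P x a b" "P y c d" for x y a b c d
  proof -
    have "\<iota> (b * d) \<otimes> (x \<otimes> y) = (\<iota> b \<otimes> x) \<otimes> (\<iota> d \<otimes> y)"
      using Pc[OF that(1)] Pc[OF that(2)] unfolding mult by (simp add: m_ac)
    then show ?thesis using that by (simp add: P_def mult)
  qed
  have Pneg: "P (\<ominus> x) (- a) b" if "P x a b" for x a b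
    using that by (simp add: P_def minus r_minus)
  have Pinv: "P (inv x) b a" if "P x a b" "x \<noteq> \<zero>" for x a b
  proof -
    have x: "x \<in> Units R" using that by (simp add: P_def field_Units)
    have "\<iota> a \<noteq> \<zero>" using that integral[of "\<iota> b" x] nz[of b] by (auto simp: P_def)
    then have "a \<noteq> 0" using zero by auto
    moreover have "\<iota> a \<otimes> inv x = \<iota> b"
      using that x by (simp add: P_def) (metis Units_closed Units_inv_closed Units_r_inv c m_assoc r_one)
    ultimately show ?thesis using x by (simp add: P_def)
  qed
  have ex: "\<exists>a b. P x a b" if "x \<in> rat_subfield R" for x
    using that unfolding rat_subfield_def
  proof (induction rule: generate_field.induct)
    case one
    have "P \<one> 1 1" by (simp add: P_def one)
    then show ?case by blast
  next
    case (m_inv h)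
    then show ?case using Pinv by blast
  next
    case (a_inv h)
    then show ?case using Pneg by blast
  next
    case (eng_add h1 h2)
    then show ?case using Padd by blast
  next
    case (eng_mult h1 h2)
    then show ?case using Pmult by blast
  qed auto
  have uniq: "(of_int a :: complex) / of_int b = of_int c / of_int d" if "P x a b" "P x c d" for x a b c d
  proof -
    have "\<iota> (a * d) = (\<iota> b \<otimes> x) \<otimes> \<iota> d" using that by (simp add: P_def mult)
    also have "\<dots> = (\<iota> d \<otimes> x) \<otimes> \<iota> b" using Pc[OF that(1)] by (simp add: m_ac)
    also have "\<dots> = \<iota> (c * b)" using that by (simp add: P_def mult)
    finally have "\<iota> (a * d - c * b) = \<zero>"
      using add[of "a * d" "- (c * b)"] minus by (simp add: r_neg)
    then have "a * d = c * b" using nz[of "a * d - c * b"] by auto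
    then have "(of_int a :: complex) * of_int d = of_int c * of_int b" by (metis of_int_mult)
    then show ?thesis using that by (simp add: P_def field_simps)
  qed
  define \<phi> where "\<phi> x = (case SOME (a, b). P x a b of (a, b) \<Rightarrow> (of_int a :: complex) / of_int b)" for x
  have \<phi>: "\<phi> x = of_int a / of_int b" if "P x a b" for x a b
  proof -
    let ?p = "SOME (a, b). P x a b"
    have "case ?p of (a, b) \<Rightarrow> P x a b" using that by (intro someI[of "\<lambda>(a, b). P x a b" "(a, b)"]) auto
    moreover obtain c d where cd: "?p = (c, d)" by (cases ?p)
    ultimately have "P x c d" by simp
    moreover have "\<phi> x = of_int c / of_int d" unfolding \<phi>_def cd by simp
    ultimately show ?thesis using uniq[OF _ that] by simp
  qed
  have "\<phi> \<in> ring_hom (R\<lparr>carrier := rat_subfield R\<rparr>) complex_field"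
  proof (rule ring_hom_subI)
    fix x y assume "x \<in> rat_subfield R" "y \<in> rat_subfield R"
    then obtain a b c d where *: "P x a b" "P y c d" using ex by blast
    then have "b \<noteq> 0" "d \<noteq> 0" by (auto simp: P_def)
    then show "\<phi> (x \<otimes> y) = \<phi> x \<otimes>\<^bsub>complex_field\<^esub> \<phi> y" "\<phi> (x \<oplus> y) = \<phi> x \<oplus>\<^bsub>complex_field\<^esub> \<phi> y"
      by (simp_all add: \<phi>[OF *(1)] \<phi>[OF *(2)] \<phi>[OF Pmult[OF *]] \<phi>[OF Padd[OF *]] add_frac_eq)
  next
    have "P \<one> 1 1" by (simp add: P_def one)
    from \<phi>[OF this] show "\<phi> \<one> = \<one>\<^bsub>complex_field\<^esub>" by simp
  qed simp
  then show thesis by (rule that)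
qed

lemma number_field_field: "number_field F \<Longrightarrow> field F"
  by (simp add: number_field_def)

lemma number_field_finite_dimension:
  "number_field F \<Longrightarrow> ring.finite_dimension F (rat_subfield F) (carrier F)"
  by (simp add: number_field_def)

lemma number_field_hom_exists:
  assumes "number_field F"
  obtains h where "h \<in> ring_hom F complex_field"
proof -
  interpret field F using assms by (rule number_field_field)
  obtain \<phi> where \<phi>: "\<phi> \<in> ring_hom (F\<lparr>carrier := rat_subfield F\<rparr>) complex_field"
    using rat_subfield_hom_exists assms by (auto simp: number_field_def)
  obtain h where "h \<in> ring_hom (F\<lparr>carrier := carrier F\<rparr>) complex_field"
    using embedding_extends[OF rat_subfield_subfield carrier_is_subfield _ number_field_finite_dimension[OF assms] \<phi>]
      subfieldE(3)[OF rat_subfield_subfield] by blast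
  then show thesis using that by simp
qed

section \<open>Subfields and degrees relative to a subfield\<close>

context field
begin

lemma subfield_sub_iff:
  assumes "subfield E R"
  shows "subfield K (R\<lparr>carrier := E\<rparr>) \<longleftrightarrow> subfield K R \<and> K \<subseteq> E"
proof -
  interpret E: field "R\<lparr>carrier := E\<rparr>" using subfield_iff(2)[OF assms] .
  show ?thesis
  proof safe
    assume K: "subfield K (R\<lparr>carrier := E\<rparr>)"
    show KE: "x \<in> E" if "x \<in> K" for x using subfieldE(3)[OF K] that by auto
    show "subfield K R"
      using subfield_iff(1)[of K] E.subfield_iff(2)[OF K] KE subfieldE(3)[OF assms] by auto
  next
    assume K: "subfield K R" "K \<subseteq> E"
    show "subfield K (R\<lparr>carrier := E\<rparr>)"
      using E.subfield_iff(1)[of K] subfield_iff(2)[OF K(1)] K(2) by auto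
  qed
qed

lemma dimension_sub:
  assumes E: "subfield E R" and K: "subfield K R" "K \<subseteq> E" and V: "V \<subseteq> E"
  shows "ring.dimension (R\<lparr>carrier := E\<rparr>) n K V \<longleftrightarrow> dimension n K V"
proof -
  interpret E: field "R\<lparr>carrier := E\<rparr>" using subfield_iff(2)[OF E] .
  have Es: "subring E R" using E by (rule subfieldE)
  show ?thesis
  proof
    assume "E.dimension n K V"
    then show "dimension n K V"
    proof (induction n arbitrary: V)
      case 0
      then show ?case using E.dimension_zero[of K V] subfield_sub_iff[OF E] K by auto
    next
      case (Suc n)
      then obtain v V' where "v \<in> E" "E.dimension n K V'" "v \<notin> V'" "V = E.line_extension K v V'"
        using E.dimension_backwards[of K n V] subfield_sub_iff[OF E] K by auto
      then show ?case
        using Suc.IH line_extension_consistent[OF Es] Suc_dim[of v V' n K] subfieldE(3)[OF E] by auto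
    qed
  next
    assume "dimension n K V"
    then show "E.dimension n K V" using V
    proof (induction n arbitrary: V)
      case 0
      then show ?case using dimension_zero[of K V] K E.zero_dim[of K] by auto
    next
      case (Suc n)
      obtain v V' where v: "v \<in> carrier R" "dimension n K V'" "v \<notin> V'" "V = line_extension K v V'"
        using dimension_backwards[OF K(1) Suc.prems(1)] by auto
      \<comment> \<open>To repeat this decomposition inside \<open>E\<close> the added vector must
        lie in \<open>E\<close>; it does, being an element of \<open>V\<close>.\<close>
      have V': "V' \<subseteq> carrier R" "\<zero> \<in> V'" using space_subgroup_props[OF K(1) v(2)] by auto
      have Ks: "\<zero> \<in> K" "\<one> \<in> K" using subringE[OF subfieldE(1)[OF K(1)]] by auto
      have "w \<in> V" if "w \<in> V'" for w
        unfolding v(4) line_extension_mem_iff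
        using that V' v(1) Ks by (intro bexI[of _ \<zero>] bexI[of _ w]) auto
      moreover have "v \<in> V"
        unfolding v(4) line_extension_mem_iff
        using V' v(1) Ks by (intro bexI[of _ \<one>] bexI[of _ \<zero>]) auto
      ultimately show ?case
        using E.Suc_dim[of v V' n K] Suc.IH[OF v(2)] v(3,4) Suc.prems(2)
        by (auto simp: line_extension_consistent[OF Es])
    qed
  qed
qed

lemma number_field_sub:
  assumes "number_field R" "subfield E R"
  shows "number_field (R\<lparr>carrier := E\<rparr>)"
proof -
  let ?Q = "rat_subfield R"
  have Q: "subfield ?Q R" "?Q \<subseteq> E" by (rule rat_subfield_subfield) (rule rat_subfield_subset[OF assms(2)])
  have "finite_dimension ?Q E"
    using subalbegra_incl_imp_finite_dimension[OF Q(1) number_field_finite_dimension[OF assms(1)]]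
      subfield_subalgebra[OF assms(2) Q(2)] subfieldE(3)[OF assms(2)] by blast
  then have "ring.finite_dimension (R\<lparr>carrier := E\<rparr>) ?Q E"
    using dimension_sub[OF assms(2) Q] ring.finite_dimension_def[OF ring_axioms]
      ring.finite_dimension_def[OF field.is_ring[OF subfield_iff(2)[OF assms(2)]]] by simp
  moreover have "add_pow (R\<lparr>carrier := E\<rparr>) n \<one> = add_pow R n \<one>" for n :: nat
    by (simp add: add_pow_def nat_pow_def)
  ultimately show ?thesis
    using assms by (simp add: number_field_def subfield_iff(2) rat_subfield_sub)
qed

end

section \<open>The Galois correspondence\<close>

lemma Gal_iff:
  "\<rho> \<in> carrier (Gal L) \<longleftrightarrow> \<rho> \<in> ring_hom L L \<and> bij_betw \<rho> (carrier L) (carrier L) \<and>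
     \<rho> \<in> extensional (carrier L) \<and> (\<forall>x \<in> rat_subfield L. \<rho> x = x)"
  by (auto simp: Gal_def ring_iso_def Bij_def)

lemma Gal_one: "\<one>\<^bsub>Gal L\<^esub> = (\<lambda>x \<in> carrier L. x)"
  by (simp add: Gal_def BijGroup_def)

lemma Gal_mult_apply:
  assumes "\<rho> \<in> carrier (Gal L)" "\<tau> \<in> carrier (Gal L)" "x \<in> carrier L"
  shows "(\<rho> \<otimes>\<^bsub>Gal L\<^esub> \<tau>) x = \<rho> (\<tau> x)"
  using assms by (simp add: Gal_def BijGroup_def compose_def)

lemma Gal_closed:
  assumes "\<rho> \<in> carrier (Gal L)" "x \<in> carrier L" shows "\<rho> x \<in> carrier L"
  using assms by (auto simp: Gal_iff ring_hom_def)

lemma Gal_eqI: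
  assumes "\<rho> \<in> carrier (Gal L)" "\<tau> \<in> carrier (Gal L)" "\<And>x. x \<in> carrier L \<Longrightarrow> \<rho> x = \<tau> x"
  shows "\<rho> = \<tau>"
  by (rule extensionalityI[of _ "carrier L"]) (use assms in \<open>auto simp: Gal_iff\<close>)

lemma (in ring) restrict_ring_hom:
  assumes "g \<in> ring_hom R S" shows "restrict g (carrier R) \<in> ring_hom R S"
  using assms by (auto simp: ring_hom_def)

lemma Gal_hom: "\<rho> \<in> carrier (Gal L) \<Longrightarrow> \<rho> \<in> ring_hom L L"
  by (simp add: Gal_iff)

lemma (in field) Gal_subgroup: "subgroup (carrier (Gal R)) (BijGroup (carrier R))"
proof -
  interpret B: group "BijGroup (carrier R)" by (rule group_BijGroup)
  have Q: "rat_subfield R \<subseteq> carrier R" using rat_subfield_subfield subfieldE(3) by blast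
  have bij: "\<rho> \<in> Bij (carrier R)" if "\<rho> \<in> carrier (Gal R)" for \<rho>
    using that by (auto simp: Gal_iff Bij_def)
  show ?thesis
  proof (rule B.subgroupI)
    show "carrier (Gal R) \<subseteq> carrier (BijGroup (carrier R))"
      using bij by (auto simp: BijGroup_def)
    have "(\<lambda>x \<in> carrier R. x) \<in> carrier (Gal R)"
      using Q by (auto simp: Gal_iff ring_hom_def bij_betw_def inj_on_def)
    then show "carrier (Gal R) \<noteq> {}" by blast
  next
    fix \<rho> assume \<rho>: "\<rho> \<in> carrier (Gal R)"
    let ?\<tau> = "\<lambda>x \<in> carrier R. inv_into (carrier R) \<rho> x"
    have inv: "inv\<^bsub>BijGroup (carrier R)\<^esub> \<rho> = ?\<tau>"
      using bij[OF \<rho>] by (rule inv_BijGroup)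
    have iso: "\<rho> \<in> ring_iso R R" using \<rho> by (simp add: Gal_iff ring_iso_def)
    have inj: "inj_on \<rho> (carrier R)" and im: "\<rho> ` carrier R = carrier R"
      using \<rho> by (auto simp: Gal_iff bij_betw_def)
    have "inv_into (carrier R) \<rho> \<in> ring_iso R R"
      by (rule ring_iso_set_sym[OF ring_axioms iso])
    then have "?\<tau> \<in> ring_hom R R" "bij_betw ?\<tau> (carrier R) (carrier R)"
      by (auto simp: ring_iso_def ring_hom_def bij_betw_def inj_on_def)
    moreover have "?\<tau> x = x" if "x \<in> rat_subfield R" for x
      using that Q inv_into_f_f[OF inj, of x] \<rho> by (auto simp: Gal_iff)
    ultimately show "inv\<^bsub>BijGroup (carrier R)\<^esub> \<rho> \<in> carrier (Gal R)"
      unfolding inv by (auto simp: Gal_iff)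
  next
    fix \<rho> \<tau> assume *: "\<rho> \<in> carrier (Gal R)" "\<tau> \<in> carrier (Gal R)"
    have eq: "\<rho> \<otimes>\<^bsub>BijGroup (carrier R)\<^esub> \<tau> = compose (carrier R) \<rho> \<tau>"
      using * bij by (simp add: BijGroup_def)
    have "compose (carrier R) \<rho> \<tau> \<in> ring_hom R R"
      using restrict_ring_hom[OF ring_hom_trans[of \<tau> R R \<rho> R]] * ring_axioms by (simp add: Gal_iff compose_def comp_def)
    then show "\<rho> \<otimes>\<^bsub>BijGroup (carrier R)\<^esub> \<tau> \<in> carrier (Gal R)"
      unfolding eq using * Q compose_Bij[OF bij bij, of \<rho> \<tau>]
      by (auto simp: Gal_iff Bij_def compose_def subset_iff)
  qed
qed

lemma (in field) Gal_group: "group (Gal R)"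
  using group.subgroup_imp_group[OF group_BijGroup Gal_subgroup]
  by (simp add: Gal_def)

lemma (in field) Gal_inv_apply:
  assumes "\<rho> \<in> carrier (Gal R)" "x \<in> carrier R"
  shows "\<rho> ((inv\<^bsub>Gal R\<^esub> \<rho>) x) = x" "(inv\<^bsub>Gal R\<^esub> \<rho>) (\<rho> x) = x"
proof -
  interpret G: group "Gal R" by (rule Gal_group)
  show "\<rho> ((inv\<^bsub>Gal R\<^esub> \<rho>) x) = x"
    using Gal_mult_apply[of \<rho> R "inv\<^bsub>Gal R\<^esub> \<rho>" x] assms by (simp add: Gal_one)
  show "(inv\<^bsub>Gal R\<^esub> \<rho>) (\<rho> x) = x"
    using Gal_mult_apply[of "inv\<^bsub>Gal R\<^esub> \<rho>" R \<rho> x] assms by (simp add: Gal_one)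
qed

text \<open>Dedekind's argument: comparing the relation at \<open>y \<otimes> x\<close> with
  \<open>\<chi>0 y\<close> times the relation at \<open>x\<close> removes \<chi>0 and multiplies the
  other coefficients by \<open>\<chi> y - \<chi>0 y\<close>. Extensionality guarantees that distinct
  members differ at some \<open>y\<close> of the carrier.\<close>

lemma (in field) independence_of_homs:
  assumes "finite Y" "Y \<subseteq> ring_hom R complex_field \<inter> extensional (carrier R)"
    and "\<And>x. x \<in> carrier R \<Longrightarrow> (\<Sum>\<chi>\<in>Y. a \<chi> * \<chi> x) = 0"
  shows "\<forall>\<chi>\<in>Y. a \<chi> = 0"
  using assms
proof (induction Y arbitrary: a rule: finite_induct)
  case (insert \<chi>0 Y)
  note h = ring_hom_memE[of _ R complex_field]
  have hX: "\<chi> \<in> ring_hom R complex_field" if "\<chi> \<in> insert \<chi>0 Y" for \<chi>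
    using insert.prems(1) that by auto
  have a1: "a \<chi>1 = 0" if \<chi>1: "\<chi>1 \<in> Y" for \<chi>1
  proof -
    have "\<chi>1 \<noteq> \<chi>0" using insert.hyps(2) \<chi>1 by auto
    then obtain y where y: "y \<in> carrier R" "\<chi>1 y \<noteq> \<chi>0 y"
      using insert.prems(1) \<chi>1 extensionalityI[of \<chi>1 "carrier R" \<chi>0] by auto
    have "\<forall>\<chi>\<in>Y. a \<chi> * (\<chi> y - \<chi>0 y) = 0"
    proof (rule insert.IH)
      fix x assume x: "x \<in> carrier R"
      have "(\<Sum>\<chi>\<in>insert \<chi>0 Y. a \<chi> * \<chi> (y \<otimes> x)) = 0" "(\<Sum>\<chi>\<in>insert \<chi>0 Y. a \<chi> * \<chi> x) = 0"
        using insert.prems(2) x y by auto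
      then have "(\<Sum>\<chi>\<in>insert \<chi>0 Y. a \<chi> * \<chi> (y \<otimes> x)) - \<chi>0 y * (\<Sum>\<chi>\<in>insert \<chi>0 Y. a \<chi> * \<chi> x) = 0"
        by simp
      also have "(\<Sum>\<chi>\<in>insert \<chi>0 Y. a \<chi> * \<chi> (y \<otimes> x)) = (\<Sum>\<chi>\<in>insert \<chi>0 Y. a \<chi> * (\<chi> y * \<chi> x))"
        using h(2)[OF hX y(1) x] by (intro sum.cong) auto
      finally have "(\<Sum>\<chi>\<in>insert \<chi>0 Y. a \<chi> * (\<chi> y - \<chi>0 y) * \<chi> x) = 0"
        by (simp add: sum_distrib_left sum_subtractf[symmetric] algebra_simps)
      then show "(\<Sum>\<chi>\<in>Y. a \<chi> * (\<chi> y - \<chi>0 y) * \<chi> x) = 0"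
        using insert.hyps by simp
    qed (use insert.prems(1) in auto)
    then show ?thesis using \<chi>1 y(2) by auto
  qed
  have "(\<Sum>\<chi>\<in>insert \<chi>0 Y. a \<chi> * \<chi> \<one>) = 0" by (rule insert.prems(2)) simp
  then have "a \<chi>0 * \<chi>0 \<one> = 0" using insert.hyps a1 by simp
  then have "a \<chi>0 = 0" using h(4)[OF hX[of \<chi>0]] by simp
  then show ?case using a1 by simp
qed simp

locale Galois_embedding = field R for R (structure) +
  fixes h :: "'a \<Rightarrow> complex"
  assumes galois: "Galois_number_field R" and h: "h \<in> ring_hom R complex_field"
begin

abbreviation G where "G \<equiv> Gal R"

definition stab :: "'a set \<Rightarrow> ('a \<Rightarrow> 'a) set"
  where "stab K = {\<rho> \<in> carrier G. \<forall>x \<in> K. \<rho> x = x}"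

definition fixed_by :: "('a \<Rightarrow> 'a) set \<Rightarrow> 'a set"
  where "fixed_by M = {x \<in> carrier R. \<forall>\<rho> \<in> M. \<rho> x = x}"

sublocale G: group "Gal R"
  by (rule Gal_group)

lemma number_field: "number_field R"
  using galois by (simp add: Galois_number_field_def)

lemma h_inj: "inj_on h (carrier R)"
  using sub_hom_inj[OF carrier_is_subfield _ field_complex_field] h by simp

lemma h_eq_iff: "x \<in> carrier R \<Longrightarrow> y \<in> carrier R \<Longrightarrow> h x = h y \<longleftrightarrow> x = y"
  using h_inj by (auto dest: inj_onD)

text \<open>\<open>\<rho> \<mapsto> h \<circ> \<rho>\<close> is injective into the finitely many
  complex embeddings of \<open>R\<close>.\<close>

lemma finite_G: "finite (carrier G)"
proof -
  let ?f = "\<lambda>\<rho>. restrict (h \<circ> \<rho>) (carrier R)"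
  let ?Q = "rat_subfield R"
  have Q: "?Q \<subseteq> carrier R" using rat_subfield_subfield subfieldE(3) by blast
  obtain n where n: "dimension n ?Q (carrier R)"
    using number_field_finite_dimension[OF number_field] by auto
  have hQ: "h \<in> ring_hom (R\<lparr>carrier := ?Q\<rparr>) complex_field"
    using h Q by (auto simp: ring_hom_def)
  have fin: "finite (embeddings R ?Q (carrier R) h)"
    using card_embeddings[OF rat_subfield_subfield carrier_is_subfield Q n hQ] by simp
  have "?f ` carrier G \<subseteq> embeddings R ?Q (carrier R) h"
    using Q restrict_ring_hom[OF ring_hom_trans[OF Gal_hom h]] by (auto simp: embeddings_def Gal_iff)
  moreover have "inj_on ?f (carrier G)"
  proof (rule inj_onI)
    fix \<rho> \<tau> assume *: "\<rho> \<in> carrier G" "\<tau> \<in> carrier G" "?f \<rho> = ?f \<tau>"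
    show "\<rho> = \<tau>"
    proof (rule Gal_eqI[OF *(1,2)])
      fix x assume x: "x \<in> carrier R"
      then have "h (\<rho> x) = h (\<tau> x)" using fun_cong[OF *(3), of x] by simp
      then show "\<rho> x = \<tau> x" using h_eq_iff Gal_closed[OF _ x] *(1,2) by blast
    qed
  qed
  ultimately show ?thesis using fin finite_imageD finite_subset by metis
qed

text \<open>The trace of \<open>x\<close> over \<open>M\<close>. Its value is given under every
  embedding at once, because the relation for the independence of embeddings compares two of them at
  the same \<open>t\<close>.\<close>

lemma trace_sum:
  assumes "subgroup M G" "x \<in> carrier R"
  obtains t where "t \<in> fixed_by M" "\<And>g. g \<in> ring_hom R complex_field \<Longrightarrow> g t = (\<Sum>\<rho>\<in>M. g (\<rho> x))"
proof -
  have MG: "M \<subseteq> carrier G" using assms(1) by (rule subgroup.subset)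
  have finM: "finite M" using MG finite_G finite_subset by blast
  define t where "t = (\<Oplus>\<rho>\<in>M. \<rho> x)"
  have tc: "t \<in> carrier R"
    unfolding t_def using MG Gal_closed[OF _ assms(2)] by (intro finsum_closed) auto
  have gt: "g t = (\<Sum>\<rho>\<in>M. g (\<rho> x))" if g: "g \<in> ring_hom R complex_field" for g
  proof -
    have "g (\<Oplus>\<rho>\<in>A. \<rho> x) = (\<Sum>\<rho>\<in>A. g (\<rho> x))" if "finite A" "A \<subseteq> M" for A
      using that
    proof (induction A rule: finite_induct)
      case empty
      then show ?case using sub_hom_zero[OF carrier_is_subfield _ CC.ring_axioms] g by simp
    next
      case (insert \<rho> A)
      have c: "\<tau> x \<in> carrier R" if "\<tau> \<in> insert \<rho> A" for \<tau>
        using insert.prems MG Gal_closed[OF _ assms(2)] that by blast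
      then have "(\<Oplus>\<rho>\<in>A. \<rho> x) \<in> carrier R" by (intro finsum_closed) auto
      then show ?case
        using insert c ring_hom_memE(3)[OF g] by (simp add: finsum_insert Pi_def)
    qed
    then show ?thesis using finM by (simp add: t_def)
  qed
  \<comment> \<open>Invariance is checked after applying the injective \<open>h\<close>, where left
    multiplication by \<tau> permutes the summands.\<close>
  have "\<tau> t = t" if \<tau>: "\<tau> \<in> M" for \<tau>
  proof -
    have \<tau>G: "\<tau> \<in> carrier G" using \<tau> MG by blast
    have h\<tau>: "h \<circ> \<tau> \<in> ring_hom R complex_field"
      using ring_hom_trans[OF Gal_hom[OF \<tau>G] h] .
    have "h (\<tau> t) = (\<Sum>\<rho>\<in>M. h (\<tau> (\<rho> x)))" using gt[OF h\<tau>] by simp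
    also have "\<dots> = (\<Sum>\<rho>\<in>M. h ((\<tau> \<otimes>\<^bsub>G\<^esub> \<rho>) x))"
      using MG \<tau>G assms(2) by (intro sum.cong) (auto simp: Gal_mult_apply)
    also have "\<dots> = (\<Sum>\<rho>\<in>M. h (\<rho> x))"
    proof (rule sum.reindex_bij_witness[of _ "\<lambda>\<rho>. inv\<^bsub>G\<^esub> \<tau> \<otimes>\<^bsub>G\<^esub> \<rho>" "\<lambda>\<rho>. \<tau> \<otimes>\<^bsub>G\<^esub> \<rho>"])
      fix \<rho> assume \<rho>: "\<rho> \<in> M"
      then have \<rho>G: "\<rho> \<in> carrier G" using MG by blast
      show "inv\<^bsub>G\<^esub> \<tau> \<otimes>\<^bsub>G\<^esub> (\<tau> \<otimes>\<^bsub>G\<^esub> \<rho>) = \<rho>" "\<tau> \<otimes>\<^bsub>G\<^esub> (inv\<^bsub>G\<^esub> \<tau> \<otimes>\<^bsub>G\<^esub> \<rho>) = \<rho>"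
        using \<rho>G \<tau>G by (simp_all add: G.m_assoc[symmetric])
      show "\<tau> \<otimes>\<^bsub>G\<^esub> \<rho> \<in> M" "inv\<^bsub>G\<^esub> \<tau> \<otimes>\<^bsub>G\<^esub> \<rho> \<in> M"
        using \<rho> \<tau> assms(1) by (auto intro: subgroup.m_closed subgroup.m_inv_closed)
    qed simp
    also have "\<dots> = h t" using gt[OF h] by simp
    finally show ?thesis using h_eq_iff tc Gal_closed[OF \<tau>G tc] by blast
  qed
  then have "t \<in> fixed_by M" using tc by (simp add: fixed_by_def)
  then show thesis using that gt by blast
qed

text \<open>If \<open>g\<close> and \<open>h\<close> agree on the fixed field of \<open>M\<close>, then they agree on all traces
  \<open>\<Sum>\<rho>\<in>M. \<rho> x\<close>; by independence of characters \<open>g \<circ> \<rho> = h \<circ> \<tau>\<close> for some \<open>\<rho>, \<tau> \<in> M\<close>.\<close>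

lemma hom_agree_fix:
  assumes M: "subgroup M G" and g: "g \<in> ring_hom R complex_field"
    and agree: "\<And>x. x \<in> fixed_by M \<Longrightarrow> g x = h x"
  obtains \<rho> where "\<rho> \<in> M" "\<And>x. x \<in> carrier R \<Longrightarrow> g x = h (\<rho> x)"
proof -
  have MG: "M \<subseteq> carrier G" using M by (rule subgroup.subset)
  have finM: "finite M" using MG finite_G finite_subset by blast
  define r where "r k \<rho> = restrict (k \<circ> \<rho>) (carrier R)" for k :: "'a \<Rightarrow> complex" and \<rho> :: "'a \<Rightarrow> 'a"
  have r: "r k \<rho> \<in> ring_hom R complex_field \<inter> extensional (carrier R)"
    if "k \<in> ring_hom R complex_field" "\<rho> \<in> M" for k \<rho>
    using that MG restrict_ring_hom[OF ring_hom_trans[OF Gal_hom that(1), of \<rho>]] by (auto simp: r_def)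
  have inj: "inj_on (r k) M" if k: "k \<in> ring_hom R complex_field" for k
  proof (rule inj_onI)
    have ki: "inj_on k (carrier R)"
      using sub_hom_inj[OF carrier_is_subfield _ field_complex_field] k by simp
    fix \<rho> \<tau> assume *: "\<rho> \<in> M" "\<tau> \<in> M" "r k \<rho> = r k \<tau>"
    then have G': "\<rho> \<in> carrier G" "\<tau> \<in> carrier G" using MG by auto
    show "\<rho> = \<tau>"
    proof (rule Gal_eqI[OF G'])
      fix x assume x: "x \<in> carrier R"
      then have "k (\<rho> x) = k (\<tau> x)" using fun_cong[OF *(3), of x] by (simp add: r_def)
      then show "\<rho> x = \<tau> x" using inj_onD[OF ki] Gal_closed[OF _ x] G' by blast
    qed
  qed
  define A B where "A = r g ` M" and "B = r h ` M"
  have fin: "finite A" "finite B" using finM by (auto simp: A_def B_def)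
  have "A \<inter> B \<noteq> {}"
  proof
    assume disj: "A \<inter> B = {}"
    \<comment> \<open>If no \<open>g \<circ> \<rho>\<close> equals an
      \<open>h \<circ> \<tau>\<close>, then g t - h t = 0 for all traces \<open>t\<close> becomes a
      relation with coefficients 1 and -1 between distinct embeddings.\<close>
    define a where "a \<chi> = (if \<chi> \<in> A then 1 else - 1 :: complex)" for \<chi>
    have "\<forall>\<chi>\<in>A \<union> B. a \<chi> = 0"
    proof (rule independence_of_homs)
      fix x assume x: "x \<in> carrier R"
      obtain t where t: "t \<in> fixed_by M" "\<And>k. k \<in> ring_hom R complex_field \<Longrightarrow> k t = (\<Sum>\<rho>\<in>M. k (\<rho> x))"
        using trace_sum[OF M x] by blast
      have S: "(\<Sum>\<chi>\<in>r k ` M. \<chi> x) = k t" if "k \<in> ring_hom R complex_field" for k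
        unfolding sum.reindex[OF inj[OF that]] t(2)[OF that] using x by (simp add: r_def)
      have "(\<Sum>\<chi>\<in>A \<union> B. a \<chi> * \<chi> x) = (\<Sum>\<chi>\<in>A. a \<chi> * \<chi> x) + (\<Sum>\<chi>\<in>B. a \<chi> * \<chi> x)"
        using fin disj by (rule sum.union_disjoint)
      also have "(\<Sum>\<chi>\<in>A. a \<chi> * \<chi> x) = g t" using S[OF g] by (simp add: a_def A_def[symmetric])
      also have "(\<Sum>\<chi>\<in>B. a \<chi> * \<chi> x) = (\<Sum>\<chi>\<in>B. - \<chi> x)"
        using disj by (intro sum.cong) (auto simp: a_def)
      also have "\<dots> = - h t" using S[OF h] by (simp add: sum_negf B_def)
      finally show "(\<Sum>\<chi>\<in>A \<union> B. a \<chi> * \<chi> x) = 0" using agree[OF t(1)] by simp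
    qed (use fin r g h in \<open>auto simp: A_def B_def\<close>)
    moreover have "\<one>\<^bsub>G\<^esub> \<in> M" using M by (rule subgroup.one_closed)
    then have "r g \<one>\<^bsub>G\<^esub> \<in> A" by (auto simp: A_def)
    ultimately show False by (auto simp: a_def split: if_splits)
  qed
  then obtain \<rho> \<tau> where st: "\<rho> \<in> M" "\<tau> \<in> M" "r g \<rho> = r h \<tau>"
    by (auto simp: A_def B_def)
  then have stG: "\<rho> \<in> carrier G" "\<tau> \<in> carrier G" using MG by auto
  \<comment> \<open>From \<open>g \<circ> \<rho> = h \<circ> \<tau>\<close> one gets
    \<open>g = h \<circ> (\<tau> \<otimes> inv \<rho>)\<close>.\<close>
  show thesis
  proof
    show "\<tau> \<otimes>\<^bsub>G\<^esub> inv\<^bsub>G\<^esub> \<rho> \<in> M"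
      using st M by (auto intro: subgroup.m_closed subgroup.m_inv_closed)
    fix x assume x: "x \<in> carrier R"
    let ?y = "(inv\<^bsub>G\<^esub> \<rho>) x"
    have y: "?y \<in> carrier R" using Gal_closed[OF G.inv_closed[OF stG(1)] x] .
    have "g (\<rho> ?y) = h (\<tau> ?y)" using fun_cong[OF st(3), of ?y] y by (simp add: r_def)
    then show "g x = h ((\<tau> \<otimes>\<^bsub>G\<^esub> inv\<^bsub>G\<^esub> \<rho>) x)"
      using Gal_inv_apply(1)[OF stG(1) x] Gal_mult_apply[OF stG(2) G.inv_closed[OF stG(1)] x] by simp
  qed
qed

end

lemma (in field) fixed_points_subfield:
  assumes "M \<subseteq> ring_hom R R" shows "subfield {x \<in> carrier R. \<forall>\<rho>\<in>M. \<rho> x = x} R"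
proof (rule subfieldI'[OF subringI])
  let ?F = "{x \<in> carrier R. \<forall>\<rho>\<in>M. \<rho> x = x}"
  have e: "\<rho> \<in> ring_hom (R\<lparr>carrier := carrier R\<rparr>) R" if "\<rho> \<in> M" for \<rho>
    using that assms by auto
  have fx: "x \<in> carrier R" "\<And>\<rho>. \<rho> \<in> M \<Longrightarrow> \<rho> x = x" if "x \<in> ?F" for x
    using that by auto
  have I: "x \<in> ?F" if "x \<in> carrier R" "\<And>\<rho>. \<rho> \<in> M \<Longrightarrow> \<rho> x = x" for x
    using that by auto
  show "?F \<subseteq> carrier R" using fx by blast
  show "\<one> \<in> ?F" by (rule I) (use ring_hom_subD(4)[OF e] in auto)
  fix x y assume x: "x \<in> ?F" and y: "y \<in> ?F"
  show "x \<otimes> y \<in> ?F"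
  proof (rule I)
    show "\<rho> (x \<otimes> y) = x \<otimes> y" if "\<rho> \<in> M" for \<rho>
      using ring_hom_subD(2)[OF e[OF that], of x y] fx(1)[OF x] fx(1)[OF y] fx(2)[OF x that] fx(2)[OF y that]
      by simp
  qed (use fx(1)[OF x] fx(1)[OF y] in simp)
  show "x \<oplus> y \<in> ?F"
  proof (rule I)
    show "\<rho> (x \<oplus> y) = x \<oplus> y" if "\<rho> \<in> M" for \<rho>
      using ring_hom_subD(3)[OF e[OF that], of x y] fx(1)[OF x] fx(1)[OF y] fx(2)[OF x that] fx(2)[OF y that]
      by simp
  qed (use fx(1)[OF x] fx(1)[OF y] in simp)
next
  let ?F = "{x \<in> carrier R. \<forall>\<rho>\<in>M. \<rho> x = x}"
  have e: "\<rho> \<in> ring_hom (R\<lparr>carrier := carrier R\<rparr>) R" if "\<rho> \<in> M" for \<rho>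
    using that assms by auto
  have fx: "x \<in> carrier R" "\<And>\<rho>. \<rho> \<in> M \<Longrightarrow> \<rho> x = x" if "x \<in> ?F" for x
    using that by auto
  have I: "x \<in> ?F" if "x \<in> carrier R" "\<And>\<rho>. \<rho> \<in> M \<Longrightarrow> \<rho> x = x" for x
    using that by auto
  show "\<ominus> x \<in> ?F" if x: "x \<in> ?F" for x
  proof (rule I)
    show "\<rho> (\<ominus> x) = \<ominus> x" if r: "\<rho> \<in> M" for \<rho>
      using sub_hom_a_inv[OF carrier_is_subfield e[OF r] ring_axioms fx(1)[OF x]] fx(2)[OF x r] by simp
  qed (use fx(1)[OF x] in simp)
  show "inv x \<in> ?F" if x: "x \<in> ?F - {\<zero>}" for x
  proof (rule I)
    show "\<rho> (inv x) = inv x" if r: "\<rho> \<in> M" for \<rho>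
      using sub_hom_m_inv(2)[OF carrier_is_subfield e[OF r] field_axioms, of x] fx(2)[of x \<rho>] r x by (metis (no_types, lifting) Diff_iff fx(1) singletonI)
  qed (use x fx(1)[of x] field_Units in simp)
qed

context Galois_embedding
begin

lemma conj_apply:
  assumes "\<rho> \<in> carrier G" "c \<in> carrier G" "x \<in> carrier R"
  shows "(inv\<^bsub>G\<^esub> \<rho> \<otimes>\<^bsub>G\<^esub> c \<otimes>\<^bsub>G\<^esub> \<rho>) x = x \<longleftrightarrow> c (\<rho> x) = \<rho> x"
proof -
  have *: "(inv\<^bsub>G\<^esub> \<rho> \<otimes>\<^bsub>G\<^esub> c \<otimes>\<^bsub>G\<^esub> \<rho>) x = (inv\<^bsub>G\<^esub> \<rho>) (c (\<rho> x))"
    using assms Gal_closed[OF assms(1,3)] by (simp add: Gal_mult_apply)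
  show ?thesis
    unfolding * using Gal_inv_apply[OF assms(1)] assms Gal_closed by metis
qed

lemma stab_subgroup:
  assumes "K \<subseteq> carrier R" shows "subgroup (stab K) G"
proof (rule G.subgroupI)
  show "stab K \<subseteq> carrier G" by (auto simp: stab_def)
  have "\<one>\<^bsub>G\<^esub> \<in> stab K" using assms G.one_closed by (auto simp: stab_def) (simp add: Gal_one subset_iff)
  then show "stab K \<noteq> {}" by blast
next
  fix \<rho> assume \<rho>: "\<rho> \<in> stab K"
  then have "(inv\<^bsub>G\<^esub> \<rho>) x = x" if "x \<in> K" for x
    using Gal_inv_apply(2)[of \<rho> x] that assms by (auto simp: stab_def)
  then show "inv\<^bsub>G\<^esub> \<rho> \<in> stab K" using \<rho> by (auto simp: stab_def)
next
  fix \<rho> \<tau> assume *: "\<rho> \<in> stab K" "\<tau> \<in> stab K"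
  then show "\<rho> \<otimes>\<^bsub>G\<^esub> \<tau> \<in> stab K"
    using assms by (auto simp: stab_def Gal_mult_apply subset_iff)
qed

lemma fixed_by_subfield:
  assumes "M \<subseteq> carrier G" shows "subfield (fixed_by M) R"
  unfolding fixed_by_def using fixed_points_subfield[of M] assms Gal_hom by blast

lemma fixed_by_G: "fixed_by (carrier G) = rat_subfield R"
  using galois by (simp add: fixed_by_def Galois_number_field_def)

text \<open>The case of the whole group in \<open>hom_agree_fix\<close>: the fixed field is then the
  prime field, on which all embeddings agree.\<close>

lemma hom_eq_h_comp:
  assumes "g \<in> ring_hom R complex_field"
  obtains \<rho> where "\<rho> \<in> carrier G" "\<And>x. x \<in> carrier R \<Longrightarrow> g x = h (\<rho> x)"
proof (rule hom_agree_fix[OF G.subgroup_self assms])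
  show "g x = h x" if "x \<in> fixed_by (carrier G)" for x
    using homs_agree_on_rat_subfield[OF carrier_is_subfield _ _ field_complex_field, of g h x] assms h that
    by (simp add: fixed_by_G)
qed (use that in blast)

lemma finite_dimension_over:
  assumes "subfield K R" "subfield E R" "K \<subseteq> E" shows "finite_dimension K E"
proof -
  have "finite_dimension K (carrier R)"
    using finite_dimension_over_larger[OF rat_subfield_subfield assms(1) rat_subfield_subset[OF assms(1)]
        carrier_is_subfield subfieldE(3)[OF assms(1)] number_field_finite_dimension[OF number_field]] .
  then show ?thesis
    using subalbegra_incl_imp_finite_dimension[OF assms(1)] subfield_subalgebra[OF assms(2,3)]
      subfieldE(3)[OF assms(2)] by blast
qed

text \<open>By the count of embeddings \<open>g\<close> extends to all of \<open>R\<close>, and the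
  extension has the form \<open>h \<circ> \<rho>\<close>.\<close>

lemma hom_extends:
  assumes "subfield K R" "g \<in> ring_hom (R\<lparr>carrier := K\<rparr>) complex_field"
  obtains \<rho> where "\<rho> \<in> carrier G" "\<And>x. x \<in> K \<Longrightarrow> g x = h (\<rho> x)"
proof -
  have K: "K \<subseteq> carrier R" using assms(1) by (rule subfieldE)
  obtain \<psi> where \<psi>: "\<psi> \<in> ring_hom (R\<lparr>carrier := carrier R\<rparr>) complex_field" "\<And>x. x \<in> K \<Longrightarrow> \<psi> x = g x"
    using embedding_extends[OF assms(1) carrier_is_subfield K
        finite_dimension_over[OF assms(1) carrier_is_subfield K] assms(2)] by blast
  then obtain \<rho> where "\<rho> \<in> carrier G" "\<And>x. x \<in> carrier R \<Longrightarrow> \<psi> x = h (\<rho> x)"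
    using hom_eq_h_comp[of \<psi>] by auto
  then show thesis using that[of \<rho>] \<psi>(2) K by (metis subsetD)
qed

text \<open>Artin's theorem. If \<rho> fixes the fixed field of \<open>M\<close>, then
  \<open>h \<circ> \<rho>\<close> agrees with \<open>h\<close> there, and
  \<open>hom_agree_fix\<close> identifies \<rho> with an element of \<open>M\<close>.\<close>

lemma stab_fixed_by:
  assumes M: "subgroup M G" shows "stab (fixed_by M) = M"
proof
  have MG: "M \<subseteq> carrier G" using M by (rule subgroup.subset)
  then show "M \<subseteq> stab (fixed_by M)" by (auto simp: stab_def fixed_by_def)
  show "stab (fixed_by M) \<subseteq> M"
  proof
    fix \<rho> assume \<rho>: "\<rho> \<in> stab (fixed_by M)"
    then have \<rho>G: "\<rho> \<in> carrier G" by (simp add: stab_def)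
    obtain \<tau> where \<tau>: "\<tau> \<in> M" "\<And>x. x \<in> carrier R \<Longrightarrow> (h \<circ> \<rho>) x = h (\<tau> x)"
      using hom_agree_fix[OF M ring_hom_trans[OF Gal_hom[OF \<rho>G] h]] \<rho> by (auto simp: stab_def)
    have "\<rho> = \<tau>"
      using \<tau> MG h_eq_iff Gal_closed[OF \<rho>G] Gal_closed[of \<tau> R] by (intro Gal_eqI[OF \<rho>G]) auto
    then show "\<rho> \<in> M" using \<tau> by simp
  qed
qed

text \<open>\<open>\<rho> \<mapsto> h \<circ> \<rho>\<close> is a bijection from
  \<open>stab K\<close> to the embeddings of \<open>R\<close> that extend \<open>h\<close> on
  \<open>K\<close>, whose number is the degree.\<close>

lemma dimension_stab:
  assumes K: "subfield K R" shows "dimension (card (stab K)) K (carrier R)" "card (stab K) > 0"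
proof -
  have KR: "K \<subseteq> carrier R" using K by (rule subfieldE)
  obtain m where m: "dimension m K (carrier R)"
    using finite_dimension_over[OF K carrier_is_subfield KR] by auto
  have hK: "h \<in> ring_hom (R\<lparr>carrier := K\<rparr>) complex_field"
    using h KR by (auto simp: ring_hom_def)
  let ?f = "\<lambda>\<rho>. restrict (h \<circ> \<rho>) (carrier R)"
  have "bij_betw ?f (stab K) (embeddings R K (carrier R) h)"
  proof (rule bij_betw_imageI)
    show "inj_on ?f (stab K)"
    proof (rule inj_onI)
      fix \<rho> \<tau> assume *: "\<rho> \<in> stab K" "\<tau> \<in> stab K" "?f \<rho> = ?f \<tau>"
      then have G': "\<rho> \<in> carrier G" "\<tau> \<in> carrier G" by (auto simp: stab_def)
      show "\<rho> = \<tau>"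
      proof (rule Gal_eqI[OF G'])
        fix x assume x: "x \<in> carrier R"
        then have "h (\<rho> x) = h (\<tau> x)" using fun_cong[OF *(3), of x] by simp
        then show "\<rho> x = \<tau> x" using h_eq_iff Gal_closed[OF _ x] G' by blast
      qed
    qed
    show "?f ` stab K = embeddings R K (carrier R) h"
    proof safe
      fix \<rho> assume \<rho>: "\<rho> \<in> stab K"
      then show "?f \<rho> \<in> embeddings R K (carrier R) h"
        using restrict_ring_hom[OF ring_hom_trans[OF Gal_hom h, of \<rho>]] KR
        by (auto simp: embeddings_def stab_def)
    next
      fix \<psi> assume \<psi>: "\<psi> \<in> embeddings R K (carrier R) h"
      then obtain \<rho> where \<rho>: "\<rho> \<in> carrier G" "\<And>x. x \<in> carrier R \<Longrightarrow> \<psi> x = h (\<rho> x)"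
        using hom_eq_h_comp[of \<psi>] by (auto simp: embeddings_def)
      have "\<rho> x = x" if x: "x \<in> K" for x
      proof -
        have xR: "x \<in> carrier R" using x KR by blast
        have "h (\<rho> x) = h x" using \<rho>(2)[OF xR] \<psi> x by (auto simp: embeddings_def)
        then show ?thesis using h_eq_iff[of "\<rho> x" x] Gal_closed[OF \<rho>(1) xR] xR by blast
      qed
      moreover have "\<psi> = ?f \<rho>"
        by (rule extensionalityI[of _ "carrier R"]) (use \<psi> \<rho> in \<open>auto simp: embeddings_def\<close>)
      ultimately show "\<psi> \<in> ?f ` stab K" using \<rho>(1) by (auto simp: stab_def)
    qed
  qed
  then have "card (stab K) = m" "m > 0"
    using card_embeddings[OF K carrier_is_subfield KR m hK] bij_betw_same_card by auto
  then show "dimension (card (stab K)) K (carrier R)" "card (stab K) > 0" using m by auto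
qed

lemma dimension_iff_card_stab:
  assumes K: "subfield K R" and E: "subfield E R" and le: "K \<subseteq> E"
  shows "dimension n K E \<longleftrightarrow> card (stab K) = n * card (stab E)"
proof -
  have *: "card (stab K) = m * card (stab E)" if "dimension m K E" for m
    using dimension_is_inj[OF K dimension_stab(1)[OF K] telescopic_base[OF K E that dimension_stab(1)[OF E]]] .
  obtain m where m: "dimension m K E"
    using finite_dimension_over[OF K E le] by auto
  show ?thesis
  proof
    assume "card (stab K) = n * card (stab E)"
    then have "n = m" using *[OF m] dimension_stab(2)[OF E] by simp
    then show "dimension n K E" using m by simp
  qed (rule *)
qed

text \<open>By Artin's theorem \<open>K\<close> and the possibly larger field
  \<open>fixed_by (stab K)\<close> have the same stabiliser, so the degree between them is
  1.\<close>

lemma fixed_by_stab: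
  assumes K: "subfield K R" shows "fixed_by (stab K) = K"
proof -
  have KR: "K \<subseteq> carrier R" using K by (rule subfieldE)
  have sub: "K \<subseteq> fixed_by (stab K)" using KR by (auto simp: stab_def fixed_by_def)
  have F: "subfield (fixed_by (stab K)) R"
    by (rule fixed_by_subfield) (auto simp: stab_def)
  have "stab (fixed_by (stab K)) = stab K"
    by (rule stab_fixed_by[OF stab_subgroup[OF KR]])
  then have "dimension 1 K (fixed_by (stab K))"
    using dimension_iff_card_stab[OF K F sub] by simp
  then show ?thesis
    using same_dimension_eq[OF K dimension_one[OF K] _ sub] by simp
qed

lemma stab_antimono: "K \<subseteq> E \<Longrightarrow> stab E \<subseteq> stab K"
  by (auto simp: stab_def)

lemma fixed_by_antimono: "M \<subseteq> N \<Longrightarrow> fixed_by N \<subseteq> fixed_by M"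
  by (auto simp: fixed_by_def)

lemma card_stab_rat: "card (stab (rat_subfield R)) = card (carrier G)"
  using stab_fixed_by[OF G.subgroup_self] by (simp add: fixed_by_G)

end

locale Galois_conjugation = Galois_embedding +
  fixes c
  assumes c: "c \<in> carrier G" and hc: "\<And>x. x \<in> carrier R \<Longrightarrow> h (c x) = cnj (h x)"
begin

lemma c_fixes_iff: "x \<in> carrier R \<Longrightarrow> c x = x \<longleftrightarrow> h x \<in> \<real>"
  using h_eq_iff[of "c x" x] hc[of x] Gal_closed[OF c, of x] by (simp add: Reals_cnj_iff)

lemma c_c: "c \<otimes>\<^bsub>G\<^esub> c = \<one>\<^bsub>G\<^esub>"
proof (rule Gal_eqI)
  fix x assume x: "x \<in> carrier R"
  have "h (c (c x)) = h x" using hc[OF x] hc[OF Gal_closed[OF c x]] by simp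
  then have "c (c x) = x" using h_eq_iff[of "c (c x)" x] Gal_closed[OF c] x by blast
  then show "(c \<otimes>\<^bsub>G\<^esub> c) x = \<one>\<^bsub>G\<^esub> x" using x by (simp add: Gal_mult_apply[OF c c x] Gal_one)
qed (use c in auto)

text \<open>\<open>inv \<rho> \<otimes> c \<otimes> \<rho>\<close> fixes \<open>x\<close> iff
  \<open>c\<close> fixes \<open>\<rho> x\<close>, that is, iff \<open>h (\<rho> x)\<close> is real.
  So the real embeddings of \<open>K\<close> are recorded by the conjugates of \<open>c\<close> in
  \<open>stab K\<close>.\<close>

lemma conj_in_stab_iff:
  assumes "K \<subseteq> carrier R" "\<rho> \<in> carrier G"
  shows "inv\<^bsub>G\<^esub> \<rho> \<otimes>\<^bsub>G\<^esub> c \<otimes>\<^bsub>G\<^esub> \<rho> \<in> stab K \<longleftrightarrow> (\<forall>x\<in>K. h (\<rho> x) \<in> \<real>)"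
proof -
  have "inv\<^bsub>G\<^esub> \<rho> \<otimes>\<^bsub>G\<^esub> c \<otimes>\<^bsub>G\<^esub> \<rho> \<in> stab K \<longleftrightarrow> (\<forall>x\<in>K. c (\<rho> x) = \<rho> x)"
    using assms c by (auto simp: stab_def conj_apply subset_iff)
  then show ?thesis using assms c_fixes_iff Gal_closed[OF assms(2)] by blast
qed

lemma totally_imaginary_iff_stab:
  assumes E: "subfield E R"
  shows "totally_imaginary (R\<lparr>carrier := E\<rparr>) \<longleftrightarrow>
    (\<forall>\<rho>\<in>carrier G. inv\<^bsub>G\<^esub> \<rho> \<otimes>\<^bsub>G\<^esub> c \<otimes>\<^bsub>G\<^esub> \<rho> \<notin> stab E)"
proof -
  have ER: "E \<subseteq> carrier R" using E by (rule subfieldE)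
  have "ring_hom (R\<lparr>carrier := E\<rparr>) real_field = {} \<longleftrightarrow> (\<forall>\<rho>\<in>carrier G. \<not> (\<forall>x\<in>E. h (\<rho> x) \<in> \<real>))"
  proof safe
    fix \<rho> assume *: "ring_hom (R\<lparr>carrier := E\<rparr>) real_field = {}" "\<rho> \<in> carrier G" "\<forall>x\<in>E. h (\<rho> x) \<in> \<real>"
    have hr: "h \<circ> \<rho> \<in> ring_hom (R\<lparr>carrier := E\<rparr>) complex_field"
      using hom_restrict_sub[of "h \<circ> \<rho>" "carrier R" complex_field E] ring_hom_trans[OF Gal_hom[OF *(2)] h] ER by simp
    have im: "Im (h (\<rho> x)) = 0" if "x \<in> E" for x using *(3) that by (auto simp: complex_is_Real_iff)
    \<comment> \<open>On numbers with imaginary part 0 the map \<open>Re\<close> is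
      multiplicative.\<close>
    have "(\<lambda>x. Re (h (\<rho> x))) \<in> ring_hom (R\<lparr>carrier := E\<rparr>) real_field"
      using ring_hom_subD[OF hr] im by (intro ring_hom_subI) auto
    then show False using *(1) by blast
  next
    fix g assume *: "\<forall>\<rho>\<in>carrier G. \<not> (\<forall>x\<in>E. h (\<rho> x) \<in> \<real>)" "g \<in> ring_hom (R\<lparr>carrier := E\<rparr>) real_field"
    have "complex_of_real \<circ> g \<in> ring_hom (R\<lparr>carrier := E\<rparr>) complex_field"
      using ring_hom_subD[OF *(2)] by (intro ring_hom_subI) auto
    then obtain \<rho> where \<rho>: "\<rho> \<in> carrier G" "\<And>x. x \<in> E \<Longrightarrow> complex_of_real (g x) = h (\<rho> x)"
      using hom_extends[OF E] by (metis comp_apply)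
    then have "\<forall>x\<in>E. h (\<rho> x) \<in> \<real>" by (metis Reals_of_real)
    then show "g \<in> {}" using * \<rho>(1) by blast
  qed
  then show ?thesis
    using conj_in_stab_iff[OF ER] number_field_sub[OF number_field E] by (auto simp: totally_imaginary_def)
qed

lemma totally_real_iff_stab:
  assumes K: "subfield K R"
  shows "totally_real (R\<lparr>carrier := K\<rparr>) \<longleftrightarrow>
    (\<forall>\<rho>\<in>carrier G. inv\<^bsub>G\<^esub> \<rho> \<otimes>\<^bsub>G\<^esub> c \<otimes>\<^bsub>G\<^esub> \<rho> \<in> stab K)"
proof -
  have KR: "K \<subseteq> carrier R" using K by (rule subfieldE)
  have "(\<forall>g \<in> ring_hom (R\<lparr>carrier := K\<rparr>) complex_field. g ` K \<subseteq> \<real>) \<longleftrightarrow>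
    (\<forall>\<rho>\<in>carrier G. \<forall>x\<in>K. h (\<rho> x) \<in> \<real>)"
  proof safe
    fix \<rho> x assume *: "\<forall>g \<in> ring_hom (R\<lparr>carrier := K\<rparr>) complex_field. g ` K \<subseteq> \<real>" "\<rho> \<in> carrier G" "x \<in> K"
    have hr: "h \<circ> \<rho> \<in> ring_hom (R\<lparr>carrier := K\<rparr>) complex_field"
      using hom_restrict_sub[of "h \<circ> \<rho>" "carrier R" complex_field K] ring_hom_trans[OF Gal_hom[OF *(2)] h] KR by simp
    then show "h (\<rho> x) \<in> \<real>" using * by (metis comp_apply image_subset_iff)
  next
    fix g x assume *: "\<forall>\<rho>\<in>carrier G. \<forall>x\<in>K. h (\<rho> x) \<in> \<real>" "g \<in> ring_hom (R\<lparr>carrier := K\<rparr>) complex_field" "x \<in> K"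
    then show "g x \<in> \<real>" using hom_extends[OF K *(2)] by metis
  qed
  then show ?thesis
    using conj_in_stab_iff[OF KR] number_field_sub[OF number_field K] by (auto simp: totally_real_def)
qed

end

section \<open>CM-subfields in terms of subgroups\<close>

text \<open>For \<open>H = stab E\<close> the groups \<open>M\<close> and \<open>N\<close> are the
  stabilisers of a CM-subfield of \<open>E\<close> and of its totally real subfield; inclusions are
  reversed, and the card condition says that the extension is quadratic.\<close>

definition CM_subgroups :: "('a, 'm) monoid_scheme \<Rightarrow> 'a set \<Rightarrow> 'a \<Rightarrow> bool"
  where "CM_subgroups G H c \<longleftrightarrow> (\<exists>M N. subgroup M G \<and> subgroup N G \<and> H \<subseteq> M \<and> M \<subseteq> N \<and>
    card N = 2 * card M \<and>
    (\<forall>g\<in>carrier G. inv\<^bsub>G\<^esub> g \<otimes>\<^bsub>G\<^esub> c \<otimes>\<^bsub>G\<^esub> g \<notin> M) \<and>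
    (\<forall>g\<in>carrier G. inv\<^bsub>G\<^esub> g \<otimes>\<^bsub>G\<^esub> c \<otimes>\<^bsub>G\<^esub> g \<in> N))"

lemma (in field) CM_type_iff:
  "CM_type R \<longleftrightarrow> totally_imaginary R \<and> (\<exists>E K. subfield E R \<and> subfield K R \<and> K \<subseteq> E \<and>
     totally_imaginary (R\<lparr>carrier := E\<rparr>) \<and> totally_real (R\<lparr>carrier := K\<rparr>) \<and> dimension 2 K E)"
proof -
  have "CM_field (R\<lparr>carrier := E\<rparr>) \<longleftrightarrow> totally_imaginary (R\<lparr>carrier := E\<rparr>) \<and>
      (\<exists>K. subfield K R \<and> K \<subseteq> E \<and> totally_real (R\<lparr>carrier := K\<rparr>) \<and> dimension 2 K E)"
    if E: "subfield E R" for E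
    unfolding CM_field_def
    using subfield_sub_iff[OF E] dimension_sub[OF E, of _ E 2] by auto
  then show ?thesis unfolding CM_type_def by blast
qed

text \<open>All subfields and degrees are now those of the ambient field \<open>R\<close>, to which
  the Galois correspondence applies.\<close>

lemma (in field) CM_type_sub_iff:
  assumes E: "subfield E R"
  shows "CM_type (R\<lparr>carrier := E\<rparr>) \<longleftrightarrow> totally_imaginary (R\<lparr>carrier := E\<rparr>) \<and>
    (\<exists>E' K. subfield E' R \<and> subfield K R \<and> K \<subseteq> E' \<and> E' \<subseteq> E \<and>
     totally_imaginary (R\<lparr>carrier := E'\<rparr>) \<and> totally_real (R\<lparr>carrier := K\<rparr>) \<and> dimension 2 K E')"
proof -
  interpret E: field "R\<lparr>carrier := E\<rparr>" using subfield_iff(2)[OF E] .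
  have "E.dimension 2 K E' \<longleftrightarrow> dimension 2 K E'" if "subfield K R" "K \<subseteq> E'" "E' \<subseteq> E" for K E'
    using dimension_sub[OF E that(1)] that by auto
  then have "(subfield E' R \<and> E' \<subseteq> E) \<and> (subfield K R \<and> K \<subseteq> E) \<and> K \<subseteq> E' \<and> P E' K \<and> E.dimension 2 K E' \<longleftrightarrow>
      subfield E' R \<and> subfield K R \<and> K \<subseteq> E' \<and> E' \<subseteq> E \<and> P E' K \<and> dimension 2 K E'" for E' K P
    by auto
  from this[of _ _ "\<lambda>E' K. totally_imaginary (R\<lparr>carrier := E'\<rparr>) \<and> totally_real (R\<lparr>carrier := K\<rparr>)"]
  show ?thesis
    unfolding E.CM_type_iff subfield_sub_iff[OF E] by simp
qed

section \<open>Transport along an embedding of number fields\<close>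

locale field_hom = F: field F + L: field L for F (structure) and L (structure) +
  fixes f assumes f: "f \<in> ring_hom F L"
    and F: "number_field F" and L: "number_field L"
begin

sublocale ring_hom_ring F L f
  using f F.ring_axioms L.ring_axioms by (intro ring_hom_ringI2)

lemma f_inj: "inj_on f (carrier F)"
  using F.sub_hom_inj[OF F.carrier_is_subfield, of f L] f L.field_axioms by simp

lemma image_subfield:
  assumes "subfield E F" shows "subfield (f ` E) L"
  using img_is_subfield(2)[OF assms] L.one_not_zero by simp

lemma preimage_subfield:
  assumes "subfield E L" shows "subfield {x \<in> carrier F. f x \<in> E} F"
proof (rule F.subfieldI'[OF F.subringI])
  note E = L.subring_props[OF assms]
  fix x y assume "x \<in> {x \<in> carrier F. f x \<in> E}" "y \<in> {x \<in> carrier F. f x \<in> E}"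
  then show "x \<otimes>\<^bsub>F\<^esub> y \<in> {x \<in> carrier F. f x \<in> E}" "x \<oplus>\<^bsub>F\<^esub> y \<in> {x \<in> carrier F. f x \<in> E}"
    using E by auto
next
  note E = L.subring_props[OF assms]
  fix x assume "x \<in> {x \<in> carrier F. f x \<in> E}"
  then show "\<ominus>\<^bsub>F\<^esub> x \<in> {x \<in> carrier F. f x \<in> E}" using E by auto
next
  fix x assume x: "x \<in> {x \<in> carrier F. f x \<in> E} - {\<zero>\<^bsub>F\<^esub>}"
  then have "f x \<noteq> \<zero>\<^bsub>L\<^esub>" "f (inv\<^bsub>F\<^esub> x) = inv\<^bsub>L\<^esub> f x"
    using F.sub_hom_m_inv[OF F.carrier_is_subfield, of f L x] f L.field_axioms by auto
  then show "inv\<^bsub>F\<^esub> x \<in> {x \<in> carrier F. f x \<in> E}"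
    using x L.subfield_m_inv(1)[OF assms, of "f x"] F.field_Units by auto
next
  note E = L.subring_props[OF assms]
  show "\<one>\<^bsub>F\<^esub> \<in> {x \<in> carrier F. f x \<in> E}" using E by auto
qed auto

lemma image_preimage:
  assumes "E \<subseteq> f ` carrier F" shows "f ` {x \<in> carrier F. f x \<in> E} = E"
  using assms by auto

text \<open>Both inclusions come from the minimality of the prime field, applied to an image and to
  a preimage.\<close>

lemma image_rat_subfield: "f ` rat_subfield F = rat_subfield L"
proof
  show "rat_subfield L \<subseteq> f ` rat_subfield F"
    by (rule L.rat_subfield_subset[OF image_subfield[OF F.rat_subfield_subfield]])
  show "f ` rat_subfield F \<subseteq> rat_subfield L"
    using F.rat_subfield_subset[OF preimage_subfield[OF L.rat_subfield_subfield]] by auto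
qed

lemma dimension_image:
  assumes K: "subfield K F" and E: "subfield E F" and le: "K \<subseteq> E"
  shows "L.dimension n (f ` K) (f ` E) \<longleftrightarrow> F.dimension n K E"
proof
  have inj: "inj_on f E" using f_inj subfieldE(3)[OF E] by (rule inj_on_subset)
  have *: "L.dimension m (f ` K) (f ` E)" if "F.dimension m K E" for m
    using inj_hom_dimension[OF K _ inj that] L.one_not_zero by simp
  then show "L.dimension n (f ` K) (f ` E)" if "F.dimension n K E" using that .
  have "F.finite_dimension K (carrier F)"
    using F.finite_dimension_over_larger[OF F.rat_subfield_subfield K F.rat_subfield_subset[OF K]
        F.carrier_is_subfield subfieldE(3)[OF K] number_field_finite_dimension[OF F]] .
  then have "F.finite_dimension K E"
    using F.subalbegra_incl_imp_finite_dimension[OF K] F.subfield_subalgebra[OF E le]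
      subfieldE(3)[OF E] by blast
  then obtain m where m: "F.dimension m K E" by auto
  show "F.dimension n K E" if "L.dimension n (f ` K) (f ` E)"
    using L.dimension_is_inj[OF image_subfield[OF K] that *[OF m]] m by simp
qed

text \<open>The predicate \<open>P\<close> on the image lets one statement serve both for the
  absence of real embeddings and for embeddings with real image.\<close>

lemma hom_image_iff:
  assumes E: "subfield E F"
  shows "(\<exists>g \<in> ring_hom (L\<lparr>carrier := f ` E\<rparr>) S. P (g ` f ` E)) \<longleftrightarrow>
    (\<exists>g \<in> ring_hom (F\<lparr>carrier := E\<rparr>) S. P (g ` E))"
proof safe
  have ER: "E \<subseteq> carrier F" using E by (rule subfieldE)
  fix g assume g: "g \<in> ring_hom (L\<lparr>carrier := f ` E\<rparr>) S" "P (g ` f ` E)"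
  have "g \<circ> f \<in> ring_hom (F\<lparr>carrier := E\<rparr>) S"
    using ring_hom_subD[OF g(1)] ER ring_hom_memE[OF f]
    by (intro ring_hom_subI) (auto simp: subset_iff)
  then show "\<exists>g\<in>ring_hom (F\<lparr>carrier := E\<rparr>) S. P (g ` E)" using g(2) by (metis image_comp)
next
  have ER: "E \<subseteq> carrier F" using E by (rule subfieldE)
  have Es: "subring E F" using E by (rule subfieldE)
  have inj: "inj_on f E" using f_inj ER by (rule inj_on_subset)
  fix g assume g: "g \<in> ring_hom (F\<lparr>carrier := E\<rparr>) S" "P (g ` E)"
  define k where "k = g \<circ> inv_into E f"
  have k: "k (f x) = g x" if "x \<in> E" for x
    using inv_into_f_f[OF inj that] by (simp add: k_def)
  have "k \<in> ring_hom (L\<lparr>carrier := f ` E\<rparr>) S"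
  proof (rule ring_hom_subI)
    fix x y assume "x \<in> f ` E" "y \<in> f ` E"
    then obtain a b where ab: "a \<in> E" "b \<in> E" "x = f a" "y = f b" by auto
    then have c: "a \<in> carrier F" "b \<in> carrier F" using ER by auto
    show "k (x \<otimes>\<^bsub>L\<^esub> y) = k x \<otimes>\<^bsub>S\<^esub> k y"
      using k[OF subringE(6)[OF Es ab(1,2)]] k ab ring_hom_memE(2)[OF f c] ring_hom_subD(2)[OF g(1) ab(1,2)] by simp
    show "k (x \<oplus>\<^bsub>L\<^esub> y) = k x \<oplus>\<^bsub>S\<^esub> k y"
      using k[OF subringE(7)[OF Es ab(1,2)]] k ab ring_hom_memE(3)[OF f c] ring_hom_subD(3)[OF g(1) ab(1,2)] by simp
  next
    show "k \<one>\<^bsub>L\<^esub> = \<one>\<^bsub>S\<^esub>"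
      using k[OF subringE(3)[OF Es]] ring_hom_memE(4)[OF f] ring_hom_subD(4)[OF g(1)] by simp
  qed (use k ring_hom_subD(1)[OF g(1)] in auto)
  moreover have "k ` f ` E = g ` E" using k by (force simp: image_image)
  ultimately show "\<exists>g\<in>ring_hom (L\<lparr>carrier := f ` E\<rparr>) S. P (g ` f ` E)" using g(2) by metis
qed

lemma totally_imaginary_image:
  assumes E: "subfield E F"
  shows "totally_imaginary (L\<lparr>carrier := f ` E\<rparr>) \<longleftrightarrow> totally_imaginary (F\<lparr>carrier := E\<rparr>)"
  using hom_image_iff[OF E, of real_field "\<lambda>_. True"] F.number_field_sub[OF F E]
    L.number_field_sub[OF L image_subfield[OF E]]
  by (auto simp: totally_imaginary_def)

lemma totally_real_image:
  assumes E: "subfield E F"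
  shows "totally_real (L\<lparr>carrier := f ` E\<rparr>) \<longleftrightarrow> totally_real (F\<lparr>carrier := E\<rparr>)"
  using hom_image_iff[OF E, of complex_field "\<lambda>Y. \<not> Y \<subseteq> \<real>"] F.number_field_sub[OF F E]
    L.number_field_sub[OF L image_subfield[OF E]]
  unfolding totally_real_def by simp blast

text \<open>\<open>F\<close> is not a subset of \<open>L\<close> and may even have elements of
  another type, so it has to be replaced by its image before stabilisers make sense.\<close>

lemma CM_type_image: "CM_type (L\<lparr>carrier := f ` carrier F\<rparr>) \<longleftrightarrow> CM_type F"
proof -
  have FF: "F\<lparr>carrier := carrier F\<rparr> = F" by simp
  note I = image_subfield[OF F.carrier_is_subfield]
  have "(\<exists>E' K. subfield E' L \<and> subfield K L \<and> K \<subseteq> E' \<and> E' \<subseteq> f ` carrier F \<and>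
     totally_imaginary (L\<lparr>carrier := E'\<rparr>) \<and> totally_real (L\<lparr>carrier := K\<rparr>) \<and> L.dimension 2 K E') \<longleftrightarrow>
    (\<exists>E K. subfield E F \<and> subfield K F \<and> K \<subseteq> E \<and>
     totally_imaginary (F\<lparr>carrier := E\<rparr>) \<and> totally_real (F\<lparr>carrier := K\<rparr>) \<and> F.dimension 2 K E)"
    (is "(\<exists>E' K. ?P E' K) \<longleftrightarrow> (\<exists>E K. ?Q E K)")
  proof
    assume "\<exists>E' K. ?P E' K"
    then obtain E' K' where *: "?P E' K'" by blast
    define E K where "E = {x \<in> carrier F. f x \<in> E'}" and "K = {x \<in> carrier F. f x \<in> K'}"
    have EK: "subfield E F" "subfield K F" "K \<subseteq> E" "f ` E = E'" "f ` K = K'"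
      using preimage_subfield[of E'] preimage_subfield[of K'] image_preimage[of E'] image_preimage[of K'] *
      by (auto simp: E_def K_def)
    have "?Q E K"
      using * totally_imaginary_image[OF EK(1)] totally_real_image[OF EK(2)] dimension_image[OF EK(2,1,3)] EK
      by simp
    then show "\<exists>E K. ?Q E K" by blast
  next
    assume "\<exists>E K. ?Q E K"
    then obtain E K where *: "?Q E K" by blast
    then have "?P (f ` E) (f ` K)"
      using totally_imaginary_image[of E] totally_real_image[of K] dimension_image[of K E]
        image_subfield subfieldE(3)[of E F] by (auto simp: image_mono)
    then show "\<exists>E' K. ?P E' K" by blast
  qed
  moreover have "totally_imaginary (L\<lparr>carrier := f ` carrier F\<rparr>) \<longleftrightarrow> totally_imaginary F"
    using totally_imaginary_image[OF F.carrier_is_subfield] FF by simp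
  ultimately show ?thesis
    unfolding L.CM_type_sub_iff[OF I] F.CM_type_iff by simp
qed

end

context Galois_conjugation
begin

text \<open>The Galois correspondence turns the two fields into \<open>M\<close> and
  \<open>N\<close>, and \<open>conj_in_stab_iff\<close> turns the two conditions on embeddings into
  conditions on the conjugates of \<open>c\<close>.\<close>

lemma CM_type_sub_iff_subgroups:
  assumes E: "subfield E R" and ti: "totally_imaginary (R\<lparr>carrier := E\<rparr>)"
  shows "CM_type (R\<lparr>carrier := E\<rparr>) \<longleftrightarrow> CM_subgroups G (stab E) c"
proof -
  have "(\<exists>E' K. subfield E' R \<and> subfield K R \<and> K \<subseteq> E' \<and> E' \<subseteq> E \<and>
     totally_imaginary (R\<lparr>carrier := E'\<rparr>) \<and> totally_real (R\<lparr>carrier := K\<rparr>) \<and> dimension 2 K E')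
    \<longleftrightarrow> CM_subgroups G (stab E) c" (is "(\<exists>E' K. ?P E' K) \<longleftrightarrow> _")
  proof
    assume "\<exists>E' K. ?P E' K"
    then obtain E' K where *: "?P E' K" by blast
    then have s: "subgroup (stab E') G" "subgroup (stab K) G"
      using stab_subgroup subfieldE(3) by blast+
    have "card (stab K) = 2 * card (stab E')" using * dimension_iff_card_stab[of K E' 2] by auto
    then show "CM_subgroups G (stab E) c"
      unfolding CM_subgroups_def using * s stab_antimono[of E' E] stab_antimono[of K E']
        totally_imaginary_iff_stab[of E'] totally_real_iff_stab[of K] by blast
  next
    assume "CM_subgroups G (stab E) c"
    then obtain M N where *: "subgroup M G" "subgroup N G" "stab E \<subseteq> M" "M \<subseteq> N" "card N = 2 * card M"
      "\<forall>g\<in>carrier G. inv\<^bsub>G\<^esub> g \<otimes>\<^bsub>G\<^esub> c \<otimes>\<^bsub>G\<^esub> g \<notin> M" "\<forall>g\<in>carrier G. inv\<^bsub>G\<^esub> g \<otimes>\<^bsub>G\<^esub> c \<otimes>\<^bsub>G\<^esub> g \<in> N"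
      by (auto simp: CM_subgroups_def)
    have sub: "subfield (fixed_by M) R" "subfield (fixed_by N) R"
      using fixed_by_subfield subgroup.subset *(1,2) by blast+
    note st = stab_fixed_by[OF *(1)] stab_fixed_by[OF *(2)]
    have le: "fixed_by N \<subseteq> fixed_by M" by (rule fixed_by_antimono[OF *(4)])
    have "fixed_by M \<subseteq> fixed_by (stab E)" by (rule fixed_by_antimono[OF *(3)])
    then have "fixed_by M \<subseteq> E" using fixed_by_stab[OF E] by simp
    moreover have "dimension 2 (fixed_by N) (fixed_by M)"
      using dimension_iff_card_stab[OF sub(2,1) le] st *(5) by simp
    moreover have "totally_imaginary (R\<lparr>carrier := fixed_by M\<rparr>)" "totally_real (R\<lparr>carrier := fixed_by N\<rparr>)"
      using totally_imaginary_iff_stab[OF sub(1)] totally_real_iff_stab[OF sub(2)] st *(6,7) by auto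
    ultimately show "\<exists>E' K. ?P E' K" using sub le by blast
  qed
  then show ?thesis unfolding CM_type_sub_iff[OF E] using ti by simp
qed

end

context Galois_embedding
begin

text \<open>The fixed field of a normal subgroup is again Galois, because all of \<open>G\<close> restricts to it.\<close>

lemma fixed_by_normal_Galois:
  assumes V: "V \<lhd> G"
  shows "Galois_number_field (R\<lparr>carrier := fixed_by V\<rparr>)"
proof -
  interpret V: normal V G by fact
  let ?E = "fixed_by V"
  have VG: "V \<subseteq> carrier G" by (rule V.subset)
  have E: "subfield ?E R" by (rule fixed_by_subfield[OF VG])
  have ER: "?E \<subseteq> carrier R" by (auto simp: fixed_by_def)
  have QE: "rat_subfield R \<subseteq> ?E" by (rule rat_subfield_subset[OF E])
  \<comment> \<open>For \<tau> in \<open>V\<close>, normality puts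
    \<open>inv \<rho> \<otimes> \<tau> \<otimes> \<rho>\<close> into \<open>V\<close>; as this fixes
    \<open>x\<close>, \<tau> fixes \<open>\<rho> x\<close>.\<close>
  have stable: "\<rho> x \<in> ?E" if \<rho>: "\<rho> \<in> carrier G" and x: "x \<in> ?E" for \<rho> x
  proof -
    have xR: "x \<in> carrier R" using x ER by blast
    have "\<tau> (\<rho> x) = \<rho> x" if \<tau>: "\<tau> \<in> V" for \<tau>
    proof -
      have \<tau>G: "\<tau> \<in> carrier G" using \<tau> VG by blast
      have "inv\<^bsub>G\<^esub> \<rho> \<otimes>\<^bsub>G\<^esub> \<tau> \<otimes>\<^bsub>G\<^esub> \<rho> \<in> V" using V.inv_op_closed1 \<rho> \<tau> by blast
      then have "(inv\<^bsub>G\<^esub> \<rho> \<otimes>\<^bsub>G\<^esub> \<tau> \<otimes>\<^bsub>G\<^esub> \<rho>) x = x" using x by (auto simp: fixed_by_def)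
      then show ?thesis using conj_apply[OF \<rho> \<tau>G xR] by simp
    qed
    then show ?thesis using Gal_closed[OF \<rho> xR] by (simp add: fixed_by_def)
  qed
  have res: "restrict \<rho> ?E \<in> carrier (Gal (R\<lparr>carrier := ?E\<rparr>))" if \<rho>: "\<rho> \<in> carrier G" for \<rho>
  proof -
    note m = ring_hom_memE[OF Gal_hom[OF \<rho>]]
    have "restrict \<rho> ?E \<in> ring_hom (R\<lparr>carrier := ?E\<rparr>) (R\<lparr>carrier := ?E\<rparr>)"
      using m stable[OF \<rho>] subringE[OF subfieldE(1)[OF E]] ER by (auto simp: ring_hom_def subset_iff)
    moreover have "bij_betw \<rho> ?E ?E"
    proof (rule bij_betwI[of _ _ _ "inv\<^bsub>G\<^esub> \<rho>"])
      show "\<rho> \<in> ?E \<rightarrow> ?E" "inv\<^bsub>G\<^esub> \<rho> \<in> ?E \<rightarrow> ?E" using stable \<rho> by auto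
    qed (use Gal_inv_apply[OF \<rho>] ER in auto)
    moreover have "\<forall>x\<in>rat_subfield R. restrict \<rho> ?E x = x" using \<rho> QE by (auto simp: Gal_iff)
    moreover have "bij_betw (restrict \<rho> ?E) ?E ?E \<longleftrightarrow> bij_betw \<rho> ?E ?E"
      by (rule bij_betw_cong) simp
    ultimately show ?thesis
      unfolding Gal_iff rat_subfield_sub[OF E] by (simp del: restrict_apply)
  qed
  have "{x \<in> ?E. \<forall>\<rho>\<in>carrier (Gal (R\<lparr>carrier := ?E\<rparr>)). \<rho> x = x} = rat_subfield R"
  proof
    show "{x \<in> ?E. \<forall>\<rho>\<in>carrier (Gal (R\<lparr>carrier := ?E\<rparr>)). \<rho> x = x} \<subseteq> rat_subfield R"
    proof
      fix x assume x: "x \<in> {x \<in> ?E. \<forall>\<rho>\<in>carrier (Gal (R\<lparr>carrier := ?E\<rparr>)). \<rho> x = x}"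
      then have "\<rho> x = x" if "\<rho> \<in> carrier G" for \<rho> using res[OF that] by auto
      then have "x \<in> fixed_by (carrier G)" using x ER by (auto simp: fixed_by_def)
      then show "x \<in> rat_subfield R" by (simp add: fixed_by_G)
    qed
    show "rat_subfield R \<subseteq> {x \<in> ?E. \<forall>\<rho>\<in>carrier (Gal (R\<lparr>carrier := ?E\<rparr>)). \<rho> x = x}"
      using QE by (auto simp: Gal_iff rat_subfield_sub[OF E])
  qed
  then show ?thesis
    unfolding Galois_number_field_def using number_field_sub[OF number_field E]
    by (simp add: rat_subfield_sub[OF E])
qed

end

text \<open>The passage from fields to groups. Core-freeness of \<open>H\<close> is the minimality
  of the Galois closure: for a normal \<open>V\<close> inside \<open>H\<close> the fixed field of
  \<open>V\<close> is Galois and contains the image of \<open>F\<close>, so it is all of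
  \<open>L\<close> and \<open>V\<close> is trivial.\<close>

theorem CM_type_iff_CM_subgroups:
  assumes F: "number_field F" "sextic F" "totally_imaginary F" and FL: "Galois_closure F L"
    and h: "h \<in> ring_hom L complex_field" and c: "c \<in> carrier (Gal L)"
    and hc: "\<And>x. x \<in> carrier L \<Longrightarrow> h (c x) = cnj (h x)"
  obtains H where "group (Gal L)" "finite (carrier (Gal L))" "subgroup H (Gal L)"
    "card (carrier (Gal L)) = 6 * card H" "\<And>V. V \<lhd> Gal L \<Longrightarrow> V \<subseteq> H \<Longrightarrow> V = {\<one>\<^bsub>Gal L\<^esub>}"
    "\<And>g. g \<in> carrier (Gal L) \<Longrightarrow> inv\<^bsub>Gal L\<^esub> g \<otimes>\<^bsub>Gal L\<^esub> c \<otimes>\<^bsub>Gal L\<^esub> g \<notin> H"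
    "c \<otimes>\<^bsub>Gal L\<^esub> c = \<one>\<^bsub>Gal L\<^esub>" "CM_type F \<longleftrightarrow> CM_subgroups (Gal L) H c"
proof -
  have L: "Galois_number_field L" "number_field L"
    using FL by (auto simp: Galois_closure_def Galois_number_field_def)
  interpret L: field L using L(2) by (rule number_field_field)
  interpret F: field F using F(1) by (rule number_field_field)
  interpret C: Galois_conjugation L h c
    by unfold_locales (use L h c hc in auto)
  obtain \<iota> where \<iota>: "\<iota> \<in> ring_hom F L"
    and min: "\<And>E. subfield E L \<Longrightarrow> \<iota> ` carrier F \<subseteq> E \<Longrightarrow>
       Galois_number_field (L\<lparr>carrier := E\<rparr>) \<Longrightarrow> E = carrier L"
    using FL by (auto simp: Galois_closure_def)
  interpret I: field_hom F L \<iota>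
    by unfold_locales (use \<iota> F L in auto)
  define E where "E = \<iota> ` carrier F"
  have E: "subfield E L" unfolding E_def by (rule I.image_subfield[OF F.carrier_is_subfield])
  have EL: "E \<subseteq> carrier L" using E by (rule subfieldE)
  have QE: "rat_subfield L \<subseteq> E" by (rule L.rat_subfield_subset[OF E])
  have ti: "totally_imaginary (L\<lparr>carrier := E\<rparr>)"
    using I.totally_imaginary_image[OF F.carrier_is_subfield] F(3) by (simp add: E_def)
  show thesis
  proof (rule that[of "C.stab E"])
    show "group (Gal L)" by (rule L.Gal_group)
    show "finite (carrier (Gal L))" by (rule C.finite_G)
    show "subgroup (C.stab E) (Gal L)" by (rule C.stab_subgroup[OF EL])
    have "F.dimension 6 (rat_subfield F) (carrier F)" using F(2) by (simp add: sextic_def)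
    then have "L.dimension 6 (rat_subfield L) E"
      using I.dimension_image[OF F.rat_subfield_subfield F.carrier_is_subfield, of 6]
        subfieldE(3)[OF F.rat_subfield_subfield] I.image_rat_subfield by (simp add: E_def)
    then show "card (carrier (Gal L)) = 6 * card (C.stab E)"
      using C.dimension_iff_card_stab[OF L.rat_subfield_subfield E QE] C.card_stab_rat by simp
    show "inv\<^bsub>Gal L\<^esub> g \<otimes>\<^bsub>Gal L\<^esub> c \<otimes>\<^bsub>Gal L\<^esub> g \<notin> C.stab E" if "g \<in> carrier (Gal L)" for g
      using C.totally_imaginary_iff_stab[OF E] ti that by blast
    show "c \<otimes>\<^bsub>Gal L\<^esub> c = \<one>\<^bsub>Gal L\<^esub>" by (rule C.c_c)
    show "CM_type F \<longleftrightarrow> CM_subgroups (Gal L) (C.stab E) c"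
      using C.CM_type_sub_iff_subgroups[OF E ti] I.CM_type_image by (simp add: E_def)
    fix V assume V: "V \<lhd> Gal L" "V \<subseteq> C.stab E"
    have Vs: "subgroup V (Gal L)" using V(1) by (rule normal_imp_subgroup)
    have "E \<subseteq> C.fixed_by V"
      using EL V(2) by (auto simp: C.fixed_by_def C.stab_def subset_iff)
    then have "C.fixed_by V = carrier L"
      using min C.fixed_by_normal_Galois[OF V(1)] C.fixed_by_subfield[OF subgroup.subset[OF Vs]]
      unfolding E_def by blast
    then have eq: "\<rho> x = x" if "\<rho> \<in> V" "x \<in> carrier L" for \<rho> x
      using that by (auto simp: C.fixed_by_def)
    have "\<rho> = \<one>\<^bsub>Gal L\<^esub>" if "\<rho> \<in> V" for \<rho>
      using subgroup.mem_carrier[OF Vs that] C.G.one_closed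
      by (rule Gal_eqI) (use eq[OF that] in \<open>simp add: Gal_one\<close>)
    then show "V = {\<one>\<^bsub>Gal L\<^esub>}" using subgroup.one_closed[OF Vs] by blast
  qed
qed

text \<open>\<open>cnj \<circ> h\<close> is another embedding of \<open>L\<close>, hence of the form
  \<open>h \<circ> c\<close>.\<close>

lemma conjugation_exists:
  assumes L: "Galois_number_field L"
  obtains h c where "h \<in> ring_hom L complex_field" "c \<in> carrier (Gal L)"
    "\<And>x. x \<in> carrier L \<Longrightarrow> h (c x) = cnj (h x)"
proof -
  have nf: "number_field L" using L by (simp add: Galois_number_field_def)
  obtain h where h: "h \<in> ring_hom L complex_field" using number_field_hom_exists[OF nf] .
  interpret L: field L using nf by (rule number_field_field)
  interpret G: Galois_embedding L h by unfold_locales (use L h in auto)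
  have "cnj \<circ> h \<in> ring_hom L complex_field"
    using ring_hom_memE[OF h] by (auto intro!: ring_hom_memI)
  then obtain c where "c \<in> carrier (Gal L)" "\<And>x. x \<in> carrier L \<Longrightarrow> (cnj \<circ> h) x = h (c x)"
    using G.hom_eq_h_comp[of "cnj \<circ> h"] by blast
  then show thesis using that[OF h, of c] by simp
qed

section \<open>Subgroups for the sextic configuration\<close>

context group
begin

lemma card_subgroup_dvd:
  assumes "subgroup H G" "subgroup M G" "H \<subseteq> M"
  shows "card H dvd card M"
proof -
  interpret M: group "G\<lparr>carrier := M\<rparr>" by (rule subgroup.subgroup_is_group[OF assms(2) is_group])
  have "card (rcosets\<^bsub>G\<lparr>carrier := M\<rparr>\<^esub> H) * card H = card M"
    using M.lagrange[OF subgroup_incl[OF assms]] by (simp add: Coset.order_def)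
  then show ?thesis by (metis dvd_triv_right)
qed

lemma subgroup_eq_if_card:
  assumes "finite (carrier G)" "subgroup H G" "subgroup M G" "H \<subseteq> M" "card M \<le> card H"
  shows "H = M"
  using card_seteq[OF finite_subset[OF subgroup.subset[OF assms(3)] assms(1)] assms(4,5)] .

text \<open>\<open>N\<close> is the disjoint union of \<open>M\<close> and the coset
  \<open>M #> inv y\<close>. Since \<open>x\<close> is not in \<open>M\<close>, it lies in that
  coset, so \<open>x \<otimes> y\<close> is in \<open>M\<close>.\<close>

lemma index_two_coset:
  assumes fin: "finite (carrier G)" and M: "subgroup M G" and N: "subgroup N G" and MN: "M \<subseteq> N"
    and card: "card N = 2 * card M" and x: "x \<in> N" "x \<notin> M" and y: "y \<in> N" "y \<notin> M"
  shows "x \<otimes> y \<in> M"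
proof -
  have c: "x \<in> carrier G" "y \<in> carrier G" using x y subgroup.subset[OF N] by auto
  have NG: "N \<subseteq> carrier G" "M \<subseteq> carrier G" using subgroup.subset[OF N] subgroup.subset[OF M] by auto
  have finN: "finite N" using NG fin finite_subset by blast
  have iy: "inv y \<in> N" using subgroup.m_inv_closed[OF N y(1)] .
  let ?C = "M #> inv y"
  have sub: "?C \<subseteq> N" using MN iy subgroup.m_closed[OF N] by (auto simp: r_coset_def)
  have disj: "M \<inter> ?C = {}"
  proof (rule ccontr)
    assume "M \<inter> ?C \<noteq> {}"
    then obtain m where m: "m \<in> M" "m \<otimes> inv y \<in> M" by (auto simp: r_coset_def)
    then have "inv m \<otimes> (m \<otimes> inv y) \<in> M" using M by (auto intro: subgroup.m_closed subgroup.m_inv_closed)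
    then have "inv y \<in> M" using m c NG by (auto simp: m_assoc[symmetric] subset_iff)
    then have "inv (inv y) \<in> M" using M by (rule subgroup.m_inv_closed[rotated])
    then show False using y c by simp
  qed
  have "?C \<in> rcosets M" using c by (auto simp: RCOSETS_def)
  then have "card ?C = card M" using card_rcosets_equal NG(2) by metis
  then have "card (M \<union> ?C) = card N"
    using disj card finN MN sub by (subst card_Un_disjoint) (auto dest: finite_subset)
  then have "M \<union> ?C = N" using MN sub finN by (intro card_subset_eq) auto
  then obtain m where "m \<in> M" "x = m \<otimes> inv y" using x by (auto simp: r_coset_def)
  then show ?thesis using c NG by (auto simp: m_assoc subset_iff)
qed

corollary index_two_square:
  assumes "finite (carrier G)" "subgroup M G" "subgroup N G" "M \<subseteq> N" "card N = 2 * card M" "x \<in> N"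
  shows "x \<otimes> x \<in> M"
  using index_two_coset[OF assms(1-5), of x x] assms(2,6) subgroup.m_closed[OF assms(2), of x x] by blast

text \<open>An involution fixes one of three cosets.\<close>

lemma involution_conj_index_three:
  assumes fin: "finite (carrier G)" and H: "subgroup H G" and M: "subgroup M G" and HM: "H \<subseteq> M"
    and card: "card M = 3 * card H" and d: "d \<in> M" "d \<otimes> d = \<one>"
  obtains x where "x \<in> M" "inv x \<otimes> d \<otimes> x \<in> H"
proof (cases "d \<in> H")
  case True
  then show thesis using that[of \<one>] subgroup.mem_carrier[OF M d(1)] subgroup.one_closed[OF M] by simp
next
  case False
  have MG: "M \<subseteq> carrier G" by (rule subgroup.subset[OF M])
  have finM: "finite M" using MG fin finite_subset by blast
  then have finH: "finite H" using HM finite_subset by blast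
  have dG: "d \<in> carrier G" using d MG by blast
  have dd: "d \<otimes> (d \<otimes> x) = x" if "x \<in> carrier G" for x
    using that dG d(2) by (simp add: m_assoc[symmetric])
  have "card (H \<union> (\<lambda>h. d \<otimes> h) ` H) \<le> 2 * card H"
    using card_Un_le[of H "(\<lambda>h. d \<otimes> h) ` H"] card_image_le[OF finH, of "\<lambda>h. d \<otimes> h"] by linarith
  moreover have "card H > 0" using finH subgroup.one_closed[OF H] card_gt_0_iff by blast
  ultimately have lt: "card (H \<union> (\<lambda>h. d \<otimes> h) ` H) < card M" using card by linarith
  \<comment> \<open>The cosets H and dH have together at most 2 |H| elements, so a representative
    \<open>x\<close> of a third coset exists.\<close>
  have "\<not> M \<subseteq> H \<union> (\<lambda>h. d \<otimes> h) ` H"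
  proof
    assume "M \<subseteq> H \<union> (\<lambda>h. d \<otimes> h) ` H"
    then have "card M \<le> card (H \<union> (\<lambda>h. d \<otimes> h) ` H)" using finH by (intro card_mono) auto
    then show False using lt by simp
  qed
  then obtain x where x: "x \<in> M" "x \<notin> H" "x \<notin> (\<lambda>h. d \<otimes> h) ` H" by blast
  have xG: "x \<in> carrier G" using x MG by blast
  have HG: "H \<subseteq> carrier G" using HM MG by blast
  let ?A = "H" and ?B = "(\<lambda>h. d \<otimes> h) ` H" and ?C = "(\<lambda>h. x \<otimes> h) ` H"
  have card_im: "card ((\<lambda>h. y \<otimes> h) ` H) = card H" if "y \<in> carrier G" for y
    using that HG by (intro card_image) (auto simp: inj_on_def subset_iff)
  have AB: "?A \<inter> ?B = {}"
  proof (rule ccontr)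
    assume "?A \<inter> ?B \<noteq> {}"
    then obtain k where k: "k \<in> H" "d \<otimes> k \<in> H" by auto
    then have "(d \<otimes> k) \<otimes> inv k \<in> H" using H by (auto intro: subgroup.m_closed subgroup.m_inv_closed)
    then have "d \<in> H" using k HG dG by (auto simp: m_assoc subset_iff)
    then show False using False by simp
  qed
  have AC: "?A \<inter> ?C = {}"
  proof (rule ccontr)
    assume "?A \<inter> ?C \<noteq> {}"
    then obtain k where k: "k \<in> H" "x \<otimes> k \<in> H" by auto
    then have "(x \<otimes> k) \<otimes> inv k \<in> H" using H by (auto intro: subgroup.m_closed subgroup.m_inv_closed)
    then have "x \<in> H" using k HG xG by (auto simp: m_assoc subset_iff)
    then show False using x by simp
  qed
  have BC: "?B \<inter> ?C = {}"
  proof (rule ccontr)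
    assume "?B \<inter> ?C \<noteq> {}"
    then obtain k l where k: "k \<in> H" "l \<in> H" "d \<otimes> k = x \<otimes> l" by auto
    then have kl: "k \<in> carrier G" "l \<in> carrier G" using HG by auto
    have "x = (x \<otimes> l) \<otimes> inv l" using kl xG by (simp add: m_assoc)
    also have "\<dots> = d \<otimes> (k \<otimes> inv l)" using kl dG k(3)[symmetric] by (simp add: m_assoc)
    finally show False using x(3) k H by (auto intro: subgroup.m_closed subgroup.m_inv_closed)
  qed
  have "card (?A \<union> ?B \<union> ?C) = 3 * card H"
    using AB AC BC finH card_im[OF dG] card_im[OF xG] by (subst card_Un_disjoint; (subst card_Un_disjoint)?) auto
  moreover have "?A \<union> ?B \<union> ?C \<subseteq> M" using HM d x subgroup.m_closed[OF M] by auto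
  ultimately have eq: "?A \<union> ?B \<union> ?C = M" using finM card by (intro card_subset_eq) auto
  \<comment> \<open>Left multiplication by \<open>d\<close> interchanges H and dH, so it maps the
    third coset xH to itself.\<close>
  have "d \<otimes> x \<in> M" using d x subgroup.m_closed[OF M] by auto
  moreover have "d \<otimes> x \<notin> ?A"
  proof
    assume "d \<otimes> x \<in> H"
    then have "d \<otimes> (d \<otimes> x) \<in> ?B" by blast
    then show False using dd[OF xG] x by simp
  qed
  moreover have "d \<otimes> x \<notin> ?B"
  proof
    assume "d \<otimes> x \<in> ?B"
    then obtain k where "k \<in> H" "d \<otimes> x = d \<otimes> k" by auto
    then have "x \<in> H" using dG xG HG by (auto simp: subset_iff)
    then show False using x by simp
  qed
  ultimately obtain k where k: "k \<in> H" "d \<otimes> x = x \<otimes> k" using eq by blast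
  have kG: "k \<in> carrier G" using k HG by blast
  have "inv x \<otimes> d \<otimes> x = inv x \<otimes> (x \<otimes> k)" using k dG xG by (simp add: m_assoc)
  also have "\<dots> = k" using kG xG by (simp add: m_assoc[symmetric])
  finally have "inv x \<otimes> d \<otimes> x = k" .
  then show thesis using that x k by blast
qed

text \<open>M is the product PH, of order |H| |P| / |H \<inter> P|. The minimality clause keeps it
  inside any subgroup already known to contain both factors.\<close>

lemma normal_product:
  assumes fin: "finite (carrier G)" and H: "subgroup H G" and P: "P \<lhd> G"
  obtains M where "subgroup M G" "H \<subseteq> M" "P \<subseteq> M" "\<And>W. subgroup W G \<Longrightarrow> H \<subseteq> W \<Longrightarrow> P \<subseteq> W \<Longrightarrow> M \<subseteq> W"
    "card M dvd card H * card P"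
proof -
  interpret P: normal P G by fact
  have HG: "H \<subseteq> carrier G" and PG: "P \<subseteq> carrier G" using subgroup.subset[OF H] P.subset by auto
  have finH: "finite H" and finP: "finite P" using HG PG fin finite_subset by blast+
  define M where "M = P <#> H"
  have Mi: "x \<in> M \<longleftrightarrow> (\<exists>p\<in>P. \<exists>k\<in>H. x = p \<otimes> k)" for x by (auto simp: M_def set_mult_def)
  have M: "subgroup M G"
  proof (rule subgroupI)
    show "M \<subseteq> carrier G" using HG PG by (auto simp: Mi subset_iff)
    have "\<one> \<otimes> \<one> \<in> M" using subgroup.one_closed[OF H] P.one_closed unfolding Mi by blast
    then show "M \<noteq> {}" by blast
  next
    fix x assume "x \<in> M"
    then obtain p k where pk: "p \<in> P" "k \<in> H" "x = p \<otimes> k" by (auto simp: Mi)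
    then have c: "p \<in> carrier G" "k \<in> carrier G" using HG PG by auto
    have "inv x = (inv k \<otimes> inv p \<otimes> k) \<otimes> inv k" using pk c by (simp add: inv_mult_group m_assoc)
    moreover have "inv k \<otimes> inv p \<otimes> k \<in> P" using P.inv_op_closed1[OF c(2)] pk by simp
    ultimately show "inv x \<in> M" using pk subgroup.m_inv_closed[OF H] by (auto simp: Mi)
  next
    fix x y assume "x \<in> M" "y \<in> M"
    then obtain p k q l where pk: "p \<in> P" "k \<in> H" "x = p \<otimes> k" "q \<in> P" "l \<in> H" "y = q \<otimes> l" by (auto simp: Mi)
    then have c: "p \<in> carrier G" "k \<in> carrier G" "q \<in> carrier G" "l \<in> carrier G" using HG PG by auto
    have "x \<otimes> y = (p \<otimes> (k \<otimes> q \<otimes> inv k)) \<otimes> (k \<otimes> l)" 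
      using pk c by (simp add: m_assoc) (simp add: m_assoc[symmetric])
    moreover have "k \<otimes> q \<otimes> inv k \<in> P" using P.inv_op_closed2[OF c(2)] pk by simp
    ultimately show "x \<otimes> y \<in> M" using pk subgroup.m_closed[OF H] P.m_closed unfolding Mi by blast
  qed
  have HM: "H \<subseteq> M"
  proof
    fix k assume "k \<in> H"
    then show "k \<in> M" unfolding Mi using P.one_closed HG by (intro bexI[of _ \<one>] bexI[of _ k]) auto
  qed
  have PM: "P \<subseteq> M"
  proof
    fix p assume "p \<in> P"
    then show "p \<in> M" unfolding Mi using subgroup.one_closed[OF H] PG by (intro bexI[of _ p] bexI[of _ \<one>]) auto
  qed
  have MW: "M \<subseteq> W" if "subgroup W G" "H \<subseteq> W" "P \<subseteq> W" for W
    using that subgroup.m_closed[OF that(1)] by (auto simp: Mi subset_iff)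
  define C where "C = (\<lambda>k. P #> k) ` H"
  have finC: "finite C" using finH by (simp add: C_def)
  have CR: "C \<subseteq> rcosets P" using HG by (auto simp: C_def RCOSETS_def)
  have "M = \<Union>C" by (auto simp: M_def C_def set_mult_def r_coset_def)
  moreover have "card (\<Union>C) = (\<Sum>A\<in>C. card A)"
  proof (rule card_Union_disjoint)
    show "pairwise disjnt C" using rcos_disjoint[OF P.subgroup_axioms] CR pairwise_subset by blast
    show "finite A" if "A \<in> C" for A using that CR rcosets_finite[OF _ PG finP] by blast
  qed
  moreover have "card A = card P" if "A \<in> C" for A
    using that CR card_rcosets_equal[OF _ PG] by (metis subsetD)
  ultimately have cM: "card M = card C * card P" by simp
  \<comment> \<open>\<open>H\<close> is counted by the cosets of \<open>P\<close> that it meets: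
    each of them contains |H \<inter> P| elements of \<open>H\<close>.\<close>
  have "card H = (\<Sum>k\<in>H. 1)" by simp
  also have "\<dots> = (\<Sum>A\<in>C. \<Sum>k\<in>{k\<in>H. P #> k = A}. 1)"
    unfolding C_def by (rule sum.image_gen[OF finH])
  also have "\<dots> = (\<Sum>A\<in>C. card (H \<inter> P))"
  proof (rule sum.cong[OF refl])
    fix A assume "A \<in> C"
    then obtain k where k: "k \<in> H" "A = P #> k" by (auto simp: C_def)
    have kG: "k \<in> carrier G" using k HG by blast
    have "bij_betw (\<lambda>x. x \<otimes> k) (H \<inter> P) {l\<in>H. P #> l = A}"
    proof (rule bij_betw_imageI)
      show "inj_on (\<lambda>x. x \<otimes> k) (H \<inter> P)" using kG HG by (auto simp: inj_on_def subset_iff)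
      show "(\<lambda>x. x \<otimes> k) ` (H \<inter> P) = {l\<in>H. P #> l = A}"
      proof (intro equalityI subsetI)
        fix l assume "l \<in> (\<lambda>x. x \<otimes> k) ` (H \<inter> P)"
        then obtain x where x: "x \<in> H" "x \<in> P" "l = x \<otimes> k" by blast
        have "P #> (x \<otimes> k) = (P #> x) #> k" using x HG kG PG by (subst coset_mult_assoc) auto
        also have "P #> x = P" using x PG P.subgroup_axioms by (intro coset_join2) auto
        finally show "l \<in> {l\<in>H. P #> l = A}" using k x subgroup.m_closed[OF H] by simp
      next
        fix l assume "l \<in> {l\<in>H. P #> l = A}"
        then have l: "l \<in> H" "A = P #> l" by auto
        have lG: "l \<in> carrier G" using l HG by blast
        have "l \<in> P #> k" using l k rcos_self[OF lG P.subgroup_axioms] by simp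
        then obtain p where p: "p \<in> P" "l = p \<otimes> k" by (auto simp: r_coset_def)
        then have "p = l \<otimes> inv k" using kG PG by (auto simp: m_assoc subset_iff)
        then have "p \<in> H" using l k H by (auto intro: subgroup.m_closed subgroup.m_inv_closed)
        then show "l \<in> (\<lambda>x. x \<otimes> k) ` (H \<inter> P)" using p by blast
      qed
    qed
    then show "(\<Sum>k\<in>{k\<in>H. P #> k = A}. 1) = card (H \<inter> P)" using bij_betw_same_card by fastforce
  qed
  finally have "card H = card C * card (H \<inter> P)" by simp
  then have "card M dvd card H * card P" unfolding cM by simp
  then show thesis using that M HM PM MW by blast
qed

text \<open>If \<open>x\<close> were outside \<open>N\<close>, the five cosets of \<open>N\<close>
  represented by the powers of \<open>x\<close> would be distinct, because 5 is prime; then the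
  index would be at least 5.\<close>

lemma index_small_mem:
  assumes fin: "finite (carrier G)" and N: "subgroup N G" and K: "subgroup K G" and NK: "N \<subseteq> K"
    and card: "card K < 5 * card N" and x: "x \<in> K" "x [^] (5::nat) = \<one>"
  shows "x \<in> N"
proof (rule ccontr)
  assume xN: "x \<notin> N"
  have KG: "K \<subseteq> carrier G" by (rule subgroup.subset[OF K])
  have NG: "N \<subseteq> carrier G" using NK KG by blast
  have finK: "finite K" and finN: "finite N" using KG NG fin finite_subset by blast+
  have xG: "x \<in> carrier G" using x KG by blast
  define C where "C i = N #> (x [^] i)" for i :: nat
  have xK: "x [^] i \<in> K" for i :: nat
    using x subgroup.one_closed[OF K] subgroup.m_closed[OF K] by (induction i) auto
  have pN: "y [^] i \<in> N" if "y \<in> N" for y and i :: nat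
    using that subgroup.one_closed[OF N] subgroup.m_closed[OF N] by (induction i) auto
  have red: "x [^] i = x [^] (i mod 5)" for i :: nat
  proof -
    have "x [^] i = x [^] (5 * (i div 5) + i mod 5)" by simp
    also have "\<dots> = (x [^] (5::nat)) [^] (i div 5) \<otimes> x [^] (i mod 5)"
      using xG by (simp only: nat_pow_mult[symmetric] nat_pow_pow[symmetric])
    also have "\<dots> = x [^] (i mod 5)" using x(2) xG by (simp add: nat_pow_one)
    finally show ?thesis .
  qed
  have notN: "x [^] d \<notin> N" if "0 < d" "d < 5" for d :: nat
  proof
    assume d: "x [^] d \<in> N"
    have "d = 1 \<or> d = 2 \<or> d = 3 \<or> d = 4" using that by auto
    \<comment> \<open>By Fermat, the cube of \<open>d\<close> is its inverse modulo 5; it turns the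
      \<open>d\<close>-th power of \<open>x\<close> back into \<open>x\<close>.\<close>
    then have "(d * (d * d * d)) mod 5 = 1" by auto
    then obtain e where e: "(d * e) mod 5 = 1" by blast
    have "(x [^] d) [^] e = x [^] (1::nat)"
      using red[of "d * e"] e xG by (simp add: nat_pow_pow)
    then show False using pN[OF d, of e] xN xG by simp
  qed
  have "disjoint_family_on C {..<5}"
    unfolding disjoint_family_on_def
  proof (intro ballI impI)
    have *: False if ij: "i < j" "j < 5" and y: "y \<in> C i" "y \<in> C j" for i j :: nat and y
    proof -
      obtain a b where ab: "a \<in> N" "b \<in> N" "y = a \<otimes> x [^] i" "y = b \<otimes> x [^] j"
        using y by (auto simp: C_def r_coset_def)
      have c: "a \<in> carrier G" "b \<in> carrier G" "x [^] i \<in> carrier G" "x [^] (j - i) \<in> carrier G"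
        using ab NG xG by auto
      have "x [^] j = x [^] (j - i) \<otimes> x [^] i" using xG ij by (simp add: nat_pow_mult)
      then have "a \<otimes> x [^] i = (b \<otimes> x [^] (j - i)) \<otimes> x [^] i" using ab c by (simp add: m_assoc)
      then have "a = b \<otimes> x [^] (j - i)" using c by simp
      then have "x [^] (j - i) = inv b \<otimes> a" using c by (simp add: m_assoc[symmetric])
      then have "x [^] (j - i) \<in> N" using ab N by (auto intro: subgroup.m_closed subgroup.m_inv_closed)
      then show False using notN[of "j - i"] ij by auto
    qed
    fix i j :: nat assume "i \<in> {..<5}" "j \<in> {..<5}" "i \<noteq> j"
    then show "C i \<inter> C j = {}" using *[of i j] *[of j i] by (cases "i < j") auto
  qed
  moreover have fC: "finite (C i)" "card (C i) = card N" for i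
  proof -
    have "C i \<in> rcosets N" using xG by (auto simp: C_def RCOSETS_def)
    then show "finite (C i)" "card (C i) = card N"
      using rcosets_finite[OF _ NG finN] card_rcosets_equal[OF _ NG] by auto
  qed
  ultimately have "card (\<Union>i<5. C i) = (\<Sum>i<5::nat. card N)"
    by (subst card_UN_disjoint) (auto simp: disjoint_family_on_def)
  moreover have "(\<Union>i<5. C i) \<subseteq> K"
    using NK xK subgroup.m_closed[OF K] by (auto simp: C_def r_coset_def)
  ultimately have "5 * card N \<le> card K" using card_mono[OF finK, of "\<Union>i<5. C i"] by simp
  then show False using card by simp
qed

end

text \<open>What remains of the fields: \<open>H\<close> is the stabiliser of the image of
  \<open>F\<close>, \<open>core_free\<close> expresses that \<open>L\<close> is a Galois closure,
  and \<open>no_conj\<close> that \<open>F\<close> is totally imaginary.\<close>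

locale sextic_config = group G for G (structure) +
  fixes H c
  assumes fin: "finite (carrier G)" and H: "subgroup H G" and card_G: "card (carrier G) = 6 * card H"
    and core_free: "\<And>V. V \<lhd> G \<Longrightarrow> V \<subseteq> H \<Longrightarrow> V = {\<one>}"
    and c: "c \<in> carrier G" and no_conj: "\<And>g. g \<in> carrier G \<Longrightarrow> inv g \<otimes> c \<otimes> g \<notin> H" and cc: "c \<otimes> c = \<one>"
begin

lemma conj_closed: "g \<in> carrier G \<Longrightarrow> inv g \<otimes> c \<otimes> g \<in> carrier G"
  using c by simp

lemma conj_square: "g \<in> carrier G \<Longrightarrow> (inv g \<otimes> c \<otimes> g) \<otimes> (inv g \<otimes> c \<otimes> g) = \<one>"
proof -
  assume g: "g \<in> carrier G"
  have "g \<otimes> (inv g \<otimes> (c \<otimes> g)) = c \<otimes> g" "c \<otimes> (c \<otimes> g) = g"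
    using g c by (simp_all add: m_assoc[symmetric] cc)
  then show ?thesis using g c by (simp add: m_assoc)
qed

lemma conj_conj:
  assumes "g \<in> carrier G" "x \<in> carrier G"
  shows "inv x \<otimes> (inv g \<otimes> c \<otimes> g) \<otimes> x = inv (g \<otimes> x) \<otimes> c \<otimes> (g \<otimes> x)"
  using assms c by (simp add: inv_mult_group m_assoc)

lemma finite_H: "finite H"
  using finite_subset[OF subgroup.subset[OF H] fin] .

lemma card_H_pos: "card H > 0"
  using finite_H subgroup.one_closed[OF H] card_gt_0_iff by blast

text \<open>The CM-subfield is quadratic, with N = G. A conjugate of \<open>c\<close> in
  \<open>M\<close> would act as an involution on the three cosets of \<open>H\<close> in
  \<open>M\<close>; fixing one of them, it would have a conjugate in \<open>H\<close>.\<close>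

lemma CM_subgroups_quadratic:
  assumes M: "subgroup M G" "H \<subseteq> M" "card M = 3 * card H"
  shows "CM_subgroups G H c"
proof -
  have MG: "M \<subseteq> carrier G" by (rule subgroup.subset[OF M(1)])
  have "inv g \<otimes> c \<otimes> g \<notin> M" if g: "g \<in> carrier G" for g
  proof
    assume "inv g \<otimes> c \<otimes> g \<in> M"
    then obtain x where x: "x \<in> M" "inv x \<otimes> (inv g \<otimes> c \<otimes> g) \<otimes> x \<in> H"
      using involution_conj_index_three[OF fin H M] conj_square[OF g] by metis
    then have "x \<in> carrier G" using MG by blast
    then show False using x(2) no_conj[of "g \<otimes> x"] conj_conj[OF g] g by simp
  qed
  then show ?thesis
    unfolding CM_subgroups_def using M MG card_G conj_closed subgroup_self
    by (intro exI[of _ M] exI[of _ "carrier G"]) auto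
qed

text \<open>The CM-subfield is \<open>F\<close> itself, with M = H, and \<open>N\<close> is the
  stabiliser of a cubic subfield.\<close>

lemma CM_subgroups_cubic:
  assumes "subgroup N G" "H \<subseteq> N" "card N = 2 * card H" "\<And>g. g \<in> carrier G \<Longrightarrow> inv g \<otimes> c \<otimes> g \<in> N"
  shows "CM_subgroups G H c"
  unfolding CM_subgroups_def using assms H no_conj by (intro exI[of _ H] exI[of _ N]) auto

text \<open>\<open>P\<close> is a normal Sylow 3-subgroup. The index of \<open>H\<close> in HP is a
  power of 3 dividing 6, so it is 1 or 3. If it were 1, then \<open>P\<close> would lie in
  \<open>H\<close>, and the factor 6 = |G| / |H| would contribute one more 3 to the order of
  G.\<close>

lemma CM_subgroups_normal_3:
  assumes P: "P \<lhd> G" "card P = 3 ^ b" "\<not> 3 ^ (b + 1) dvd card (carrier G)"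
  shows "CM_subgroups G H c"
proof -
  obtain M where M: "subgroup M G" "H \<subseteq> M" "P \<subseteq> M" "card M dvd card H * card P"
    using normal_product[OF fin H P(1)] by metis
  have Ps: "subgroup P G" using P(1) by (rule normal_imp_subgroup)
  obtain m where m: "card M = card H * m" using card_subgroup_dvd[OF H M(1,2)] by (elim dvdE)
  have m3: "m dvd 3 ^ b" using M(4) card_H_pos by (simp add: m P(2))
  have "card M dvd card (carrier G)"
    using card_subgroup_dvd[OF M(1) subgroup_self subgroup.subset[OF M(1)]] .
  then have "card H * m dvd card H * 6" using m card_G by (simp add: mult.commute)
  then have "m dvd 6" using card_H_pos by simp
  obtain k where k: "k \<le> b" "m = 3 ^ k"
    using m3 divides_primepow_nat[of 3 m b] by auto
  have "\<not> 9 dvd (6::nat)" by simp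
  then have "k \<le> 1" using \<open>m dvd 6\<close> k(2) le_imp_power_dvd[of 2 k "3::nat"] dvd_trans by (cases "k \<le> 1") force+
  \<comment> \<open>This is the only place where the maximality of the power of 3 enters.\<close>
  moreover have "k \<noteq> 0"
  proof
    assume "k = 0"
    then have "3 ^ b dvd card H" using card_subgroup_dvd[OF Ps M(1,3)] m k P(2) by simp
    then have "3 * 3 ^ b dvd 6 * card H" by (intro mult_dvd_mono) auto
    then show False using P(3) card_G by simp
  qed
  ultimately have "card M = 3 * card H" using m k by (cases "k = 1") auto
  then show ?thesis using CM_subgroups_quadratic M by blast
qed

lemma CM_subgroups_central:
  assumes central: "\<And>g. g \<in> carrier G \<Longrightarrow> g \<otimes> c = c \<otimes> g"
  shows "CM_subgroups G H c"
proof (rule CM_subgroups_cubic)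
  have HG: "H \<subseteq> carrier G" by (rule subgroup.subset[OF H])
  have conj: "inv g \<otimes> c \<otimes> g = c" if "g \<in> carrier G" for g
    using central[OF that] c that by (metis inv_closed m_assoc l_inv r_one r_inv l_one central)
  have cH: "c \<notin> H" using no_conj[of \<one>] c by simp
  have ic: "inv c = c" using inv_equality[OF cc] c by simp
  let ?N = "H \<union> (\<lambda>x. x \<otimes> c) ` H"
  have cl: "x \<otimes> c \<otimes> (y \<otimes> c) = x \<otimes> y" "x \<otimes> c \<otimes> y = x \<otimes> y \<otimes> c" if "x \<in> H" "y \<in> H" for x y
  proof -
    have xy: "x \<in> carrier G" "y \<in> carrier G" using that HG by auto
    show "x \<otimes> c \<otimes> y = x \<otimes> y \<otimes> c" using central[OF xy(2)] xy c by (simp add: m_assoc)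
    have "x \<otimes> c \<otimes> (y \<otimes> c) = x \<otimes> c \<otimes> (c \<otimes> y)" using central[OF xy(2)] by simp
    also have "\<dots> = x \<otimes> (c \<otimes> c) \<otimes> y" using xy c by (simp add: m_assoc del: cc)
    finally show "x \<otimes> c \<otimes> (y \<otimes> c) = x \<otimes> y" using xy by (simp add: cc)
  qed
  show "subgroup ?N G"
  proof (rule subgroupI)
    show "?N \<subseteq> carrier G" using HG c by auto
    show "?N \<noteq> {}" using subgroup.one_closed[OF H] by blast
  next
    fix x assume "x \<in> ?N"
    then show "inv x \<in> ?N"
    proof
      assume "x \<in> (\<lambda>x. x \<otimes> c) ` H"
      then obtain y where y: "y \<in> H" "x = y \<otimes> c" by blast
      then have "inv x = inv y \<otimes> c"
        using HG c central[of "inv y"] ic by (auto simp: inv_mult_group subset_iff)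
      then show ?thesis using subgroup.m_inv_closed[OF H y(1)] by blast
    qed (use subgroup.m_inv_closed[OF H] in blast)
  next
    fix x y assume "x \<in> ?N" "y \<in> ?N"
    then show "x \<otimes> y \<in> ?N"
    proof (elim UnE imageE)
      fix b assume "x \<in> H" "y = b \<otimes> c" "b \<in> H"
      then have "x \<otimes> y = (x \<otimes> b) \<otimes> c" using HG c by (auto simp: m_assoc subset_iff)
      then show ?thesis using subgroup.m_closed[OF H \<open>x \<in> H\<close> \<open>b \<in> H\<close>] by blast
    next
      fix a b assume "x = a \<otimes> c" "a \<in> H" "y = b \<otimes> c" "b \<in> H"
      then show ?thesis using cl(1)[of a b] subgroup.m_closed[OF H, of a b] by simp
    next
      fix a assume "x = a \<otimes> c" "a \<in> H" "y \<in> H"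
      then show ?thesis using cl(2)[of a y] subgroup.m_closed[OF H, of a y] by simp
    qed (use subgroup.m_closed[OF H] in blast)
  qed
  have "H \<inter> (\<lambda>x. x \<otimes> c) ` H = {}"
  proof (rule ccontr)
    assume "H \<inter> (\<lambda>x. x \<otimes> c) ` H \<noteq> {}"
    then obtain x where x: "x \<in> H" "x \<otimes> c \<in> H" by auto
    then have "inv x \<otimes> (x \<otimes> c) \<in> H" using H by (auto intro: subgroup.m_closed subgroup.m_inv_closed)
    then show False using x HG c cH by (auto simp: m_assoc[symmetric] subset_iff)
  qed
  moreover have "card ((\<lambda>x. x \<otimes> c) ` H) = card H"
    using HG c by (intro card_image) (auto simp: inj_on_def subset_iff)
  ultimately show "card ?N = 2 * card H" using finite_H by (subst card_Un_disjoint) auto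
  fix g assume g: "g \<in> carrier G"
  have "\<one> \<otimes> c \<in> (\<lambda>x. x \<otimes> c) ` H" using subgroup.one_closed[OF H] by (rule imageI)
  then show "inv g \<otimes> c \<otimes> g \<in> ?N" using conj[OF g] c by simp
qed simp

text \<open>The indices satisfy (G : N) (M : H) = 3, so exactly one of these two steps is
  trivial.\<close>

lemma CM_subgroupsE:
  assumes "CM_subgroups G H c"
  obtains (quadratic) M where "subgroup M G" "H \<subseteq> M" "card M = 3 * card H" "card (carrier G) = 2 * card M"
  | (cubic) N where "subgroup N G" "H \<subseteq> N" "card N = 2 * card H" "card (carrier G) = 3 * card N"
      "\<And>g. g \<in> carrier G \<Longrightarrow> inv g \<otimes> c \<otimes> g \<in> N"
proof -
  obtain M N where *: "subgroup M G" "subgroup N G" "H \<subseteq> M" "M \<subseteq> N" "card N = 2 * card M"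
    "\<And>g. g \<in> carrier G \<Longrightarrow> inv g \<otimes> c \<otimes> g \<in> N"
    using assms unfolding CM_subgroups_def by blast
  obtain m where m: "card M = card H * m" using card_subgroup_dvd[OF H *(1,3)] by (elim dvdE)
  have "card N dvd card (carrier G)"
    using card_subgroup_dvd[OF *(2) subgroup_self subgroup.subset[OF *(2)]] .
  then have "(2 * card H) * m dvd (2 * card H) * 3" using * m card_G by (simp add: mult_ac)
  then have "m dvd 3" using card_H_pos by simp
  then have "m \<le> 3" "m \<noteq> 0" "m \<noteq> 2" using dvd_pos_nat[of 3 m] by (auto dest: dvd_imp_le)
  then consider "m = 1" | "m = 3" by linarith
  then show thesis
  proof cases
    case 1
    then have "H = M" using subgroup_eq_if_card[OF fin H *(1,3)] m by simp
    then show ?thesis using cubic[of N] * card_G by auto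
  next
    case 2
    then show ?thesis using quadratic[of M] * m card_G by simp
  qed
qed

text \<open>Both steps of the chain from \<open>H\<close> to G, through \<open>M\<close> or through
  \<open>N\<close>, have index at most 3 and so keep elements of order 5.\<close>

lemma CM_subgroups_order_5:
  assumes "CM_subgroups G H c" "x \<in> carrier G" "x [^] (5::nat) = \<one>"
  shows "x \<in> H"
  using assms(1)
proof (cases rule: CM_subgroupsE)
  case (quadratic M)
  have "x \<in> M"
    by (rule index_small_mem[OF fin quadratic(1) subgroup_self subgroup.subset[OF quadratic(1)]])
      (use quadratic assms card_H_pos in auto)
  then show ?thesis
    by (rule index_small_mem[OF fin H quadratic(1,2), rotated]) (use quadratic assms card_H_pos in auto)
next
  case (cubic N)
  have "x \<in> N"
    by (rule index_small_mem[OF fin cubic(1) subgroup_self subgroup.subset[OF cubic(1)]])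
      (use cubic assms card_H_pos in auto)
  then show ?thesis
    by (rule index_small_mem[OF fin H cubic(1,2), rotated]) (use cubic assms card_H_pos in auto)
qed

text \<open>Quadratic case: squares lie in the index 2 subgroup \<open>M\<close>, so HV is inside
  \<open>M\<close>; its index over \<open>H\<close> divides both 4 and 3, hence V would lie in
  \<open>H\<close>, against core-freeness. Cubic case, one alternative of \<open>c_conj\<close>
  each: an element of order 3 in \<open>N\<close>, which has index 3, would give 9 as a divisor of
  |G|; or \<open>V\<close> consists of products of two elements of \<open>N\<close> outside
  \<open>H\<close>, and these lie in \<open>H\<close> because \<open>H\<close> has index 2 in
  \<open>N\<close>.\<close>

lemma not_CM_subgroups:
  assumes V: "V \<lhd> G" "card V = 4" and squares: "\<And>v. v \<in> V \<Longrightarrow> \<exists>w\<in>carrier G. v = w \<otimes> w"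
    and nine: "\<not> 9 dvd card (carrier G)"
    and c_conj: "(\<exists>g\<in>carrier G. c \<otimes> (inv g \<otimes> c \<otimes> g) \<noteq> \<one> \<and> (c \<otimes> (inv g \<otimes> c \<otimes> g)) [^] (3::nat) = \<one>) \<or>
      (\<forall>v\<in>V. \<exists>g\<in>carrier G. \<exists>k\<in>carrier G. v = (inv g \<otimes> c \<otimes> g) \<otimes> (inv k \<otimes> c \<otimes> k))"
  shows "\<not> CM_subgroups G H c"
proof
  have Vs: "subgroup V G" using V(1) by (rule normal_imp_subgroup)
  have VH: "\<not> V \<subseteq> H" using core_free[OF V(1)] V(2) by auto
  assume "CM_subgroups G H c"
  then show False
  proof (cases rule: CM_subgroupsE)
    case (quadratic M)
    have "V \<subseteq> M"
    proof
      fix v assume "v \<in> V"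
      then obtain w where "w \<in> carrier G" "v = w \<otimes> w" using squares by blast
      then show "v \<in> M"
        using index_two_square[OF fin quadratic(1) subgroup_self subgroup.subset[OF quadratic(1)] quadratic(4)]
        by blast
    qed
    then obtain W where W: "subgroup W G" "H \<subseteq> W" "V \<subseteq> W" "W \<subseteq> M" "card W dvd card H * 4"
      using normal_product[OF fin H V(1)] quadratic(1,2) V(2) by metis
    obtain m where m: "card W = card H * m" using card_subgroup_dvd[OF H W(1,2)] by (elim dvdE)
    have "m dvd 4" using W(5) card_H_pos by (simp add: m)
    moreover have "card H * m dvd card H * 3"
      using card_subgroup_dvd[OF W(1) quadratic(1) W(4)] m quadratic(3) by (simp add: mult.commute)
    then have "m dvd 3" using card_H_pos by simp
    ultimately have "m dvd 4 - 3" by (rule dvd_diff_nat)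
    then have "m = 1" by simp
    then have "H = W" using subgroup_eq_if_card[OF fin H W(1,2)] m by simp
    then show False using W(3) VH by simp
  next
    case (cubic N)
    have cN: "c \<in> N" using cubic(5)[of \<one>] c by simp
    from c_conj show False
    proof
      assume "\<exists>g\<in>carrier G. c \<otimes> (inv g \<otimes> c \<otimes> g) \<noteq> \<one> \<and> (c \<otimes> (inv g \<otimes> c \<otimes> g)) [^] (3::nat) = \<one>"
      then obtain g where g: "g \<in> carrier G" "c \<otimes> (inv g \<otimes> c \<otimes> g) \<noteq> \<one>"
        "(c \<otimes> (inv g \<otimes> c \<otimes> g)) [^] (3::nat) = \<one>" by blast
      let ?t = "c \<otimes> (inv g \<otimes> c \<otimes> g)"
      have tN: "?t \<in> N" using subgroup.m_closed[OF cubic(1) cN cubic(5)[OF g(1)]] .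
      have tG: "?t \<in> carrier G" using subgroup.mem_carrier[OF cubic(1) tN] .
      have "ord ?t dvd 3" using pow_eq_id[OF tG, of 3] g(3) by simp
      moreover have "ord ?t \<noteq> 1" using ord_eq_1[OF tG] g(2) by simp
      moreover have "ord ?t \<le> 3" "ord ?t > 0" if "ord ?t dvd 3"
        using that dvd_imp_le[of "ord ?t" 3] dvd_pos_nat[of 3 "ord ?t"] by auto
      moreover have "\<not> (2::nat) dvd 3" by simp
      ultimately have o: "ord ?t = 3" by (metis One_nat_def Suc_1 le_Suc_eq less_numeral_extra(3) numeral_3_eq_3 le_zero_eq)
      have "generate G {?t} \<subseteq> N" using tN generate_subgroup_incl[OF _ cubic(1)] by blast
      then have "card (generate G {?t}) dvd card N"
        using card_subgroup_dvd[OF generate_is_subgroup cubic(1)] tG by blast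
      then have "3 dvd card N" using generate_pow_card[OF tG] o by simp
      then show False using cubic(4) nine by (auto simp: dvd_def)
    next
      assume *: "\<forall>v\<in>V. \<exists>g\<in>carrier G. \<exists>k\<in>carrier G. v = (inv g \<otimes> c \<otimes> g) \<otimes> (inv k \<otimes> c \<otimes> k)"
      have "V \<subseteq> H"
      proof
        fix v assume "v \<in> V"
        then obtain g k where gk: "g \<in> carrier G" "k \<in> carrier G" "v = (inv g \<otimes> c \<otimes> g) \<otimes> (inv k \<otimes> c \<otimes> k)"
          using * by blast
        show "v \<in> H"
          unfolding gk(3)
          by (rule index_two_coset[OF fin H cubic(1,2,3)]) (use gk cubic(5) no_conj in auto)
      qed
      then show False using VH by simp
    qed
  qed
qed

end

section \<open>Invariance under isomorphism\<close>

lemma (in group) CM_subgroups_iso: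
  assumes \<theta>: "\<theta> \<in> iso G K" and K: "group K" and fin: "finite (carrier G)"
    and c: "c \<in> carrier G" and CM: "CM_subgroups G H c"
  shows "CM_subgroups K (\<theta> ` H) (\<theta> c)"
proof -
  interpret K: group K by fact
  interpret \<theta>: group_hom G K \<theta>
    by unfold_locales (use \<theta> in \<open>auto simp: iso_def\<close>)
  have bij: "bij_betw \<theta> (carrier G) (carrier K)" using \<theta> by (simp add: iso_def)
  then have inj: "inj_on \<theta> (carrier G)" and im: "\<theta> ` carrier G = carrier K" by (auto simp: bij_betw_def)
  obtain M N where *: "subgroup M G" "subgroup N G" "H \<subseteq> M" "M \<subseteq> N" "card N = 2 * card M"
    "\<And>g. g \<in> carrier G \<Longrightarrow> inv g \<otimes> c \<otimes> g \<notin> M" "\<And>g. g \<in> carrier G \<Longrightarrow> inv g \<otimes> c \<otimes> g \<in> N"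
    using CM unfolding CM_subgroups_def by blast
  have MN: "M \<subseteq> carrier G" "N \<subseteq> carrier G" using subgroup.subset *(1,2) by auto
  have cj: "\<theta> (inv g \<otimes> c \<otimes> g) = inv\<^bsub>K\<^esub> \<theta> g \<otimes>\<^bsub>K\<^esub> \<theta> c \<otimes>\<^bsub>K\<^esub> \<theta> g" if "g \<in> carrier G" for g
    using that c by simp
  have card: "card (\<theta> ` A) = card A" if "A \<subseteq> carrier G" for A
    using inj that by (metis card_image inj_on_subset)
  show ?thesis
    unfolding CM_subgroups_def
  proof (rule exI[of _ "\<theta> ` M"], rule exI[of _ "\<theta> ` N"], intro conjI ballI)
    show "subgroup (\<theta> ` M) K" "subgroup (\<theta> ` N) K"
      using \<theta>.subgroup_img_is_subgroup *(1,2) by auto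
    show "\<theta> ` H \<subseteq> \<theta> ` M" "\<theta> ` M \<subseteq> \<theta> ` N" using *(3,4) by auto
    show "card (\<theta> ` N) = 2 * card (\<theta> ` M)" using card MN *(5) by simp
    fix k assume "k \<in> carrier K"
    then obtain g where g: "g \<in> carrier G" "k = \<theta> g" using im by blast
    show "inv\<^bsub>K\<^esub> k \<otimes>\<^bsub>K\<^esub> \<theta> c \<otimes>\<^bsub>K\<^esub> k \<in> \<theta> ` N" using *(7)[OF g(1)] cj[OF g(1)] g by (metis imageI)
    show "inv\<^bsub>K\<^esub> k \<otimes>\<^bsub>K\<^esub> \<theta> c \<otimes>\<^bsub>K\<^esub> k \<notin> \<theta> ` M"
    proof
      assume "inv\<^bsub>K\<^esub> k \<otimes>\<^bsub>K\<^esub> \<theta> c \<otimes>\<^bsub>K\<^esub> k \<in> \<theta> ` M"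
      then have "\<theta> (inv g \<otimes> c \<otimes> g) \<in> \<theta> ` M" using cj[OF g(1)] g by simp
      moreover have "inv g \<otimes> c \<otimes> g \<in> carrier G" using g c by simp
      ultimately have "inv g \<otimes> c \<otimes> g \<in> M" using inj_on_image_mem_iff[OF inj _ MN(1)] by blast
      then show False using *(6)[OF g(1)] by blast
    qed
  qed
qed

text \<open>The Galois group is known only up to isomorphism, so the whole configuration is carried
  over to the concrete group.\<close>

lemma (in sextic_config) config_iso:
  assumes \<theta>: "\<theta> \<in> iso G K" and K: "group K"
  shows "sextic_config K (\<theta> ` H) (\<theta> c)" "CM_subgroups G H c \<longleftrightarrow> CM_subgroups K (\<theta> ` H) (\<theta> c)"
proof -
  interpret K: group K by fact
  interpret \<theta>: group_hom G K \<theta>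
    by unfold_locales (use \<theta> in \<open>auto simp: iso_def\<close>)
  have bij: "bij_betw \<theta> (carrier G) (carrier K)" using \<theta> by (simp add: iso_def)
  then have inj: "inj_on \<theta> (carrier G)" and im: "\<theta> ` carrier G = carrier K" by (auto simp: bij_betw_def)
  have HG: "H \<subseteq> carrier G" by (rule subgroup.subset[OF H])
  let ?\<eta> = "inv_into (carrier G) \<theta>"
  have \<eta>: "?\<eta> \<in> iso K G" by (rule iso_set_sym[OF \<theta>])
  interpret \<eta>: group_hom K G ?\<eta>
    by unfold_locales (use \<eta> in \<open>auto simp: iso_def\<close>)
  have \<eta>\<theta>: "?\<eta> ` \<theta> ` A = A" if "A \<subseteq> carrier G" for A
    using inv_into_image_cancel[OF inj that] .
  have \<theta>\<eta>: "\<theta> ` ?\<eta> ` A = A" if "A \<subseteq> carrier K" for A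
    using that im by (simp add: image_inv_into_cancel)
  have cj: "\<theta> (inv g \<otimes> c \<otimes> g) = inv\<^bsub>K\<^esub> \<theta> g \<otimes>\<^bsub>K\<^esub> \<theta> c \<otimes>\<^bsub>K\<^esub> \<theta> g" if "g \<in> carrier G" for g
    using that c by simp
  have finK: "finite (carrier K)" using bij fin bij_betw_finite by blast
  show "sextic_config K (\<theta> ` H) (\<theta> c)"
  proof (rule sextic_config.intro[OF K], rule sextic_config_axioms.intro)
    show "finite (carrier K)" by (rule finK)
    show "subgroup (\<theta> ` H) K" by (rule \<theta>.subgroup_img_is_subgroup[OF H])
    show "card (carrier K) = 6 * card (\<theta> ` H)"
      using bij_betw_same_card[OF bij] card_G card_image[OF inj_on_subset[OF inj HG]] by simp
    show "\<theta> c \<in> carrier K" using c by simp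
    show "\<theta> c \<otimes>\<^bsub>K\<^esub> \<theta> c = \<one>\<^bsub>K\<^esub>" using \<theta>.hom_mult[OF c c] cc by simp
    fix k assume "k \<in> carrier K"
    then obtain g where g: "g \<in> carrier G" "k = \<theta> g" using im by blast
    show "inv\<^bsub>K\<^esub> k \<otimes>\<^bsub>K\<^esub> \<theta> c \<otimes>\<^bsub>K\<^esub> k \<notin> \<theta> ` H"
      using no_conj[OF g(1)] cj[OF g(1)] inj_on_image_mem_iff[OF inj _ HG, of "inv g \<otimes> c \<otimes> g"] g c by simp
  next
    fix V assume V: "V \<lhd> K" "V \<subseteq> \<theta> ` H"
    have VK: "V \<subseteq> carrier K" using V(1) normal_imp_subgroup subgroup.subset by blast
    have "?\<eta> ` V \<lhd> G"
    proof (rule normal_invI)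
      show "subgroup (?\<eta> ` V) G" by (rule \<eta>.subgroup_img_is_subgroup[OF normal_imp_subgroup[OF V(1)]])
      fix x y assume x: "x \<in> ?\<eta> ` V" and y: "y \<in> carrier G"
      then obtain v where v: "v \<in> V" "x = ?\<eta> v" by blast
      have "y = ?\<eta> (\<theta> y)" using y inj by simp
      then have "y \<otimes> x \<otimes> inv y = ?\<eta> (\<theta> y \<otimes>\<^bsub>K\<^esub> v \<otimes>\<^bsub>K\<^esub> inv\<^bsub>K\<^esub> \<theta> y)" using v VK y by (simp add: subset_iff)
      moreover have "\<theta> y \<otimes>\<^bsub>K\<^esub> v \<otimes>\<^bsub>K\<^esub> inv\<^bsub>K\<^esub> \<theta> y \<in> V"
        using normal.inv_op_closed2[OF V(1)] v y by simp
      ultimately show "y \<otimes> x \<otimes> inv y \<in> ?\<eta> ` V" by blast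
    qed
    moreover have "?\<eta> ` V \<subseteq> H" using image_mono[OF V(2), of ?\<eta>] \<eta>\<theta>[OF HG] by simp
    ultimately have "?\<eta> ` V = {\<one>}" by (rule core_free)
    then show "V = {\<one>\<^bsub>K\<^esub>}" using \<theta>\<eta>[OF VK] by (metis \<theta>.hom_one image_empty image_insert)
  qed
  show "CM_subgroups G H c \<longleftrightarrow> CM_subgroups K (\<theta> ` H) (\<theta> c)"
  proof
    assume "CM_subgroups K (\<theta> ` H) (\<theta> c)"
    then have "CM_subgroups G (?\<eta> ` \<theta> ` H) (?\<eta> (\<theta> c))"
      using K.CM_subgroups_iso[OF \<eta> is_group finK] c by simp
    then show "CM_subgroups G H c" using \<eta>\<theta>[OF HG] inj c by simp
  qed (rule CM_subgroups_iso[OF \<theta> K fin c])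
qed

section \<open>The individual Galois groups\<close>

text \<open>An explicit candidate for a normal Sylow 3-subgroup of exponent 3: once closed under
  multiplication the set is a normal subgroup, and in a direct product it is computed
  componentwise.\<close>

definition cube_roots :: "('a, 'm) monoid_scheme \<Rightarrow> 'a set"
  where "cube_roots G = {x \<in> carrier G. x \<otimes>\<^bsub>G\<^esub> x \<otimes>\<^bsub>G\<^esub> x = \<one>\<^bsub>G\<^esub>}"

lemma (in group) cube_roots_normal:
  assumes "\<And>x y. x \<in> cube_roots G \<Longrightarrow> y \<in> cube_roots G \<Longrightarrow> x \<otimes> y \<in> cube_roots G"
  shows "cube_roots G \<lhd> G"
proof (rule normal_invI)
  show "subgroup (cube_roots G) G"
  proof (rule subgroupI)
    have "\<one> \<in> cube_roots G" by (simp add: cube_roots_def)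
    then show "cube_roots G \<noteq> {}" by blast
  next
    fix x assume x: "x \<in> cube_roots G"
    then have xG: "x \<in> carrier G" "x \<otimes> x \<otimes> x = \<one>" by (auto simp: cube_roots_def)
    then have "inv x = x \<otimes> x" by (intro inv_equality) auto
    then show "inv x \<in> cube_roots G" using assms[OF x x] by simp
  qed (use assms in \<open>auto simp: cube_roots_def\<close>)
next
  fix x y assume x: "x \<in> cube_roots G" and y: "y \<in> carrier G"
  then have xG: "x \<in> carrier G" "x \<otimes> x \<otimes> x = \<one>" by (auto simp: cube_roots_def)
  have *: "inv y \<otimes> (y \<otimes> z) = z" if "z \<in> carrier G" for z
    using that y by (simp add: m_assoc[symmetric])
  have "(y \<otimes> x \<otimes> inv y) \<otimes> (y \<otimes> x \<otimes> inv y) \<otimes> (y \<otimes> x \<otimes> inv y) = y \<otimes> (x \<otimes> x \<otimes> x) \<otimes> inv y"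
    using xG(1) y by (simp add: m_assoc *)
  then show "y \<otimes> x \<otimes> inv y \<in> cube_roots G" using xG y by (simp add: cube_roots_def)
qed

lemma (in sextic_config) CM_subgroups_cube_roots:
  assumes "\<And>x y. x \<in> cube_roots G \<Longrightarrow> y \<in> cube_roots G \<Longrightarrow> x \<otimes> y \<in> cube_roots G"
    and "card (cube_roots G) = 3 ^ b" "\<not> 3 ^ (b + 1) dvd card (carrier G)"
  shows "CM_subgroups G H c"
  using CM_subgroups_normal_3[OF cube_roots_normal[OF assms(1)] assms(2,3)] .

lemma cube_roots_DirProd: "cube_roots (A \<times>\<times> B) = cube_roots A \<times> cube_roots B"
  by (auto simp: cube_roots_def)

lemma cube_roots_Z3: "cube_roots (integer_mod_group 3) = {0, 1, 2}"
  unfolding cube_roots_def by (auto simp: carrier_integer_mod_group; presburger)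

lemma cube_roots_Z6: "cube_roots (integer_mod_group 6) = {0, 2, 4}"
  unfolding cube_roots_def by (auto simp: carrier_integer_mod_group; presburger)

text \<open>An odd permutation has an odd cube; conversely the alternating group has order
  3.\<close>

lemma cube_roots_S3: "cube_roots (sym_group 3) = carrier (alt_group 3)"
proof (intro equalityI subsetI)
  fix p assume "p \<in> cube_roots (sym_group 3)"
  then have p: "p permutes {1..3}" "p \<circ> p \<circ> p = id"
    by (auto simp: cube_roots_def sym_group_carrier sym_group_mult sym_group_one)
  then have perm: "permutation p" by (auto simp: permutation_permutes)
  have "sign (p \<circ> p \<circ> p) = sign p * sign p * sign p"
    using perm by (simp add: sign_compose permutation_compose)
  then have "sign p * sign p * sign p = 1" using p(2) by simp
  then have "evenperm p" by (auto simp: sign_def split: if_splits)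
  then show "p \<in> carrier (alt_group 3)" using p by (simp add: alt_group_carrier)
next
  fix p assume p: "p \<in> carrier (alt_group 3)"
  interpret A: group "alt_group 3" by (rule alt_group_is_group)
  have "Coset.order (alt_group 3) = 3"
    using alt_group_card_carrier[of 3] by (simp add: Coset.order_def fact_numeral)
  then have "p [^]\<^bsub>alt_group 3\<^esub> (3::nat) = \<one>\<^bsub>alt_group 3\<^esub>" using A.pow_order_eq_1[OF p] by simp
  then have "p \<circ> p \<circ> p = id"
    by (simp add: numeral_3_eq_3 alt_group_mult alt_group_one)
  then show "p \<in> cube_roots (sym_group 3)"
    using p by (simp add: cube_roots_def alt_group_carrier sym_group_carrier sym_group_mult sym_group_one)
qed

lemma cube_roots_S3_closed:
  assumes "x \<in> cube_roots (sym_group 3)" "y \<in> cube_roots (sym_group 3)"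
  shows "x \<otimes>\<^bsub>sym_group 3\<^esub> y \<in> cube_roots (sym_group 3)"
  using assms subgroup.m_closed[OF alt_group_is_subgroup] unfolding cube_roots_S3 by blast

lemma card_cube_roots_S3: "card (cube_roots (sym_group 3)) = 3"
  using alt_group_card_carrier[of 3] by (simp add: cube_roots_S3 fact_numeral)

lemma cube_roots_Z3_closed:
  assumes "x \<in> cube_roots (integer_mod_group 3)" "y \<in> cube_roots (integer_mod_group 3)"
  shows "x \<otimes>\<^bsub>integer_mod_group 3\<^esub> y \<in> cube_roots (integer_mod_group 3)"
  using assms unfolding cube_roots_Z3 by auto

lemma CM_subgroups_C6:
  assumes "sextic_config (integer_mod_group 6) H c" shows "CM_subgroups (integer_mod_group 6) H c"
proof (rule sextic_config.CM_subgroups_cube_roots[OF assms])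
  show "card (cube_roots (integer_mod_group 6)) = 3 ^ 1" by (simp add: cube_roots_Z6)
  show "\<not> 3 ^ (1 + 1) dvd card (carrier (integer_mod_group 6))" by (simp add: carrier_integer_mod_group)
qed (auto simp: cube_roots_Z6)

lemma CM_subgroups_S3:
  assumes "sextic_config (sym_group 3) H c" shows "CM_subgroups (sym_group 3) H c"
proof (rule sextic_config.CM_subgroups_cube_roots[OF assms cube_roots_S3_closed])
  show "card (cube_roots (sym_group 3)) = 3 ^ 1" by (simp add: card_cube_roots_S3)
  show "\<not> 3 ^ (1 + 1) dvd card (carrier (sym_group 3))" by (simp add: sym_group_card_carrier fact_numeral)
qed

lemma CM_subgroups_S3_C3:
  assumes "sextic_config (sym_group 3 \<times>\<times> integer_mod_group 3) H c"
  shows "CM_subgroups (sym_group 3 \<times>\<times> integer_mod_group 3) H c"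
proof (rule sextic_config.CM_subgroups_cube_roots[OF assms])
  show "card (cube_roots (sym_group 3 \<times>\<times> integer_mod_group 3)) = 3 ^ 2"
    by (simp add: cube_roots_DirProd card_cartesian_product card_cube_roots_S3 cube_roots_Z3)
  show "\<not> 3 ^ (2 + 1) dvd card (carrier (sym_group 3 \<times>\<times> integer_mod_group 3))"
    by (simp add: card_cartesian_product sym_group_card_carrier carrier_integer_mod_group fact_numeral)
qed (use cube_roots_S3_closed cube_roots_Z3_closed in \<open>auto simp: cube_roots_DirProd simp del: mult_integer_mod_group\<close>)

lemma CM_subgroups_S3_S3:
  assumes "sextic_config (sym_group 3 \<times>\<times> sym_group 3) H c"
  shows "CM_subgroups (sym_group 3 \<times>\<times> sym_group 3) H c"
proof (rule sextic_config.CM_subgroups_cube_roots[OF assms])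
  show "card (cube_roots (sym_group 3 \<times>\<times> sym_group 3)) = 3 ^ 2"
    by (simp add: cube_roots_DirProd card_cartesian_product card_cube_roots_S3)
  show "\<not> 3 ^ (2 + 1) dvd card (carrier (sym_group 3 \<times>\<times> sym_group 3))"
    by (simp add: card_cartesian_product sym_group_card_carrier fact_numeral)
qed (use cube_roots_S3_closed in \<open>auto simp: cube_roots_DirProd\<close>)

section \<open>The dihedral group of order 12\<close>

lemma dihedral_group_group:
  assumes "n > 0" shows "group (dihedral_group n)"
proof (rule groupI)
  show "x \<otimes>\<^bsub>dihedral_group n\<^esub> y \<in> carrier (dihedral_group n)"
    if "x \<in> carrier (dihedral_group n)" "y \<in> carrier (dihedral_group n)" for x y
    using assms by (cases x; cases y) (auto simp: dihedral_group_def)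
  show "x \<otimes>\<^bsub>dihedral_group n\<^esub> y \<otimes>\<^bsub>dihedral_group n\<^esub> z = x \<otimes>\<^bsub>dihedral_group n\<^esub> (y \<otimes>\<^bsub>dihedral_group n\<^esub> z)" for x y z
    by (cases x; cases y; cases z) (auto simp: dihedral_group_def mod_simps algebra_simps)
  show "\<exists>y\<in>carrier (dihedral_group n). y \<otimes>\<^bsub>dihedral_group n\<^esub> x = \<one>\<^bsub>dihedral_group n\<^esub>"
    if "x \<in> carrier (dihedral_group n)" for x
  proof (cases x)
    case (Pair i s)
    then show ?thesis using assms
      by (intro bexI[of _ "if s then (i, True) else ((- i) mod int n, False)"])
        (use that in \<open>auto simp: dihedral_group_def mod_simps\<close>)
  qed
qed (use assms in \<open>auto simp: dihedral_group_def\<close>)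

lemma CM_subgroups_D6:
  assumes "sextic_config (dihedral_group 6) H c" shows "CM_subgroups (dihedral_group 6) H c"
proof -
  have *: "cube_roots (dihedral_group 6) = {(0, False), (2, False), (4, False)}"
  proof -
    have *: "0 \<le> i \<and> i < 6 \<and> ((i + i) mod 6 + i) mod 6 = 0 \<longleftrightarrow> i = 0 \<or> i = 2 \<or> i = 4" for i :: int
      by presburger
    \<comment> \<open>The cube of a reflection still contains the factor \<open>f\<close>, so only
      rotations remain.\<close>
    have "(i, s) \<in> cube_roots (dihedral_group 6) \<longleftrightarrow> (i, s) \<in> {(0, False), (2, False), (4, False)}" for i s
    proof (cases s)
      case False
      then have "(i, s) \<in> cube_roots (dihedral_group 6) \<longleftrightarrow> 0 \<le> i \<and> i < 6 \<and> ((i + i) mod 6 + i) mod 6 = 0"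
        by (simp add: cube_roots_def dihedral_group_def)
      then show ?thesis unfolding * using False by simp
    qed (simp add: cube_roots_def dihedral_group_def)
    then show ?thesis by (intro Set.set_eqI) (metis surj_pair)
  qed
  show ?thesis
  proof (rule sextic_config.CM_subgroups_cube_roots[OF assms])
    show "card (cube_roots (dihedral_group 6)) = 3 ^ 1" by (simp add: *)
    show "\<not> 3 ^ (1 + 1) dvd card (carrier (dihedral_group 6))"
      by (simp add: dihedral_group_def card_cartesian_product card_UNIV_bool)
  qed (unfold *, auto simp: dihedral_group_def)
qed

section \<open>The group 6T13 of order 72\<close>

definition rotations :: "nat \<Rightarrow> nat \<Rightarrow> nat \<Rightarrow> nat"
  where "rotations k l i = (if 1 \<le> i \<and> i \<le> 3 then (i - 1 + k) mod 3 + 1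
    else if 4 \<le> i \<and> i \<le> 6 then (i - 4 + l) mod 3 + 4 else i)"

text \<open>\<open>rotations k l\<close> is the product of the \<open>k\<close>-th and
  \<open>l\<close>-th powers of the two generating 3-cycles. The closed formula turns composition
  into addition of exponents.\<close>

lemma rotations_comp: "rotations k l \<circ> rotations k' l' = rotations (k + k') (l + l')"
proof
  fix i
  have *: "j mod 3 + 1 \<le> (3::nat)" "j mod 3 + 4 \<le> (6::nat)" for j using mod_less_divisor[of 3 j] by auto
  show "(rotations k l \<circ> rotations k' l') i = rotations (k + k') (l + l') i"
    using * by (auto simp: rotations_def mod_simps ac_simps)
qed

lemma rotations_0: "rotations 0 0 = id"
  by (auto simp: rotations_def fun_eq_iff)

lemma rotations_mod: "rotations k l = rotations (k mod 3) (l mod 3)"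
  by (rule ext) (simp only: rotations_def mod_add_right_eq)

lemma le_6_cases:
  fixes i :: nat
  obtains "i = 0" | "i = 1" | "i = 2" | "i = 3" | "i = 4" | "i = 5" | "i = 6" | "6 < i"
  by linarith

lemma cycles_as_rotations: "cycle_of_list [1, 2, 3] = rotations 1 0" "cycle_of_list [4, 5, 6] = rotations 0 1"
proof -
  have "cycle_of_list [1, 2, 3] i = rotations 1 0 i" for i :: nat
    by (cases i rule: le_6_cases) (auto simp: rotations_def transpose_def)
  then show "cycle_of_list [1, 2, 3] = rotations 1 0" by auto
  have "cycle_of_list [4, 5, 6] i = rotations 0 1 i" for i :: nat
    by (cases i rule: le_6_cases) (auto simp: rotations_def transpose_def)
  then show "cycle_of_list [4, 5, 6] = rotations 0 1" by auto
qed

text \<open>The permutations preserving the block system {1,2,3}, {4,5,6}. It bounds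
  \<open>C3_squared_D4\<close> from above by a condition that can be tested on values.\<close>

definition block_group :: "(nat \<Rightarrow> nat) set"
  where "block_group = {p. p permutes {1..6} \<and>
    (\<forall>i\<in>{1..6}. \<forall>j\<in>{1..6}. (p i \<le> 3 \<longleftrightarrow> p j \<le> 3) \<longleftrightarrow> (i \<le> 3 \<longleftrightarrow> j \<le> 3))}"

lemma block_group_subgroup: "subgroup block_group (sym_group 6)"
proof -
  interpret S: group "sym_group 6" by (rule sym_group_is_group)
  show ?thesis
  proof (rule S.subgroupI)
    have "id \<in> block_group" by (simp add: block_group_def permutes_id)
    then show "block_group \<noteq> {}" by blast
  next
    fix p assume p: "p \<in> block_group"
    then have pp: "p permutes {1..6}" by (simp add: block_group_def)
    have "(inv' p i \<le> 3 \<longleftrightarrow> inv' p j \<le> 3) \<longleftrightarrow> (i \<le> 3 \<longleftrightarrow> j \<le> 3)" if "i \<in> {1..6}" "j \<in> {1..6}" for i j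
    proof -
      have "inv' p i \<in> {1..6}" "inv' p j \<in> {1..6}"
        using permutes_in_image[OF permutes_inv[OF pp]] that by blast+
      then have "(p (inv' p i) \<le> 3 \<longleftrightarrow> p (inv' p j) \<le> 3) \<longleftrightarrow> (inv' p i \<le> 3 \<longleftrightarrow> inv' p j \<le> 3)"
        using p by (simp add: block_group_def)
      then show ?thesis using permutes_inverses(1)[OF pp] by simp
    qed
    then show "inv\<^bsub>sym_group 6\<^esub> p \<in> block_group"
      using pp permutes_inv[OF pp] by (simp add: sym_group_carrier block_group_def)
  next
    fix p q assume p: "p \<in> block_group" and q: "q \<in> block_group"
    then have qq: "q permutes {1..6}" by (simp add: block_group_def)
    have "q i \<in> {1..6}" if "i \<in> {1..6}" for i using permutes_in_image[OF qq] that by blast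
    then show "p \<otimes>\<^bsub>sym_group 6\<^esub> q \<in> block_group"
      using p q by (auto simp: sym_group_mult block_group_def permutes_compose)
  qed (auto simp: block_group_def sym_group_carrier)
qed

lemma atLeastAtMost_1_6: "{1..6::nat} = {1, 2, 3, 4, 5, 6}"
  by auto

lemma cycle_of_list_permutes: "set cs \<subseteq> A \<Longrightarrow> cycle_of_list cs permutes A"
  using cycle_permutes permutes_subset by blast

lemma C3_squared_D4_generators:
  "{cycle_of_list [1, 2, 3], cycle_of_list [4, 5, 6],
    cycle_of_list [1, 4, 2, 5] \<circ> cycle_of_list [3, 6], cycle_of_list [4, 5]} \<subseteq> block_group"
  unfolding block_group_def atLeastAtMost_1_6
  by (auto intro!: cycle_of_list_permutes permutes_compose simp del: cycle_of_list.simps)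
    (simp_all add: transpose_def)

lemma C3_squared_D4_subgroup:
  "subgroup (carrier C3_squared_D4) (sym_group 6)" "carrier C3_squared_D4 \<subseteq> block_group"
proof -
  interpret S: group "sym_group 6" by (rule sym_group_is_group)
  show "carrier C3_squared_D4 \<subseteq> block_group"
    unfolding C3_squared_D4_def
    using S.generate_subgroup_incl[OF C3_squared_D4_generators block_group_subgroup] by simp
  show "subgroup (carrier C3_squared_D4) (sym_group 6)"
    unfolding C3_squared_D4_def
    using S.generate_is_subgroup[OF subset_trans[OF C3_squared_D4_generators subgroup.subset[OF block_group_subgroup]]]
    by (simp del: cycle_of_list.simps)
qed

lemma C3_squared_D4_group: "group C3_squared_D4"
  using subgroup.subgroup_is_group[OF C3_squared_D4_subgroup(1) sym_group_is_group]
  by (simp add: C3_squared_D4_def)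

lemma C3_squared_D4_simps:
  "x \<otimes>\<^bsub>C3_squared_D4\<^esub> y = x \<circ> y" "\<one>\<^bsub>C3_squared_D4\<^esub> = id"
  by (simp_all add: C3_squared_D4_def sym_group_mult sym_group_one)

lemma rotations_mem: "rotations k l \<in> carrier C3_squared_D4"
proof -
  have gen: "rotations 1 0 \<in> carrier C3_squared_D4" "rotations 0 1 \<in> carrier C3_squared_D4"
    unfolding C3_squared_D4_def cycles_as_rotations[symmetric] by (auto intro: generate.incl simp del: cycle_of_list.simps)
  note cl = subgroup.m_closed[OF C3_squared_D4_subgroup(1), unfolded sym_group_mult]
  have "rotations k 0 \<in> carrier C3_squared_D4"
  proof (induction k)
    case 0
    then show ?case using subgroup.one_closed[OF C3_squared_D4_subgroup(1)] by (metis rotations_0 sym_group_one)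
  next
    case (Suc k)
    then show ?case using cl[OF gen(1) Suc] by (simp add: rotations_comp)
  qed
  then show ?thesis
  proof (induction l)
    case (Suc l)
    then show ?case using cl[OF gen(2) Suc.IH[OF Suc.prems]] by (simp add: rotations_comp)
  qed simp
qed

text \<open>A permutation whose cube is the identity cannot interchange the two blocks, and on a
  block of three letters it is a cyclic shift.\<close>

lemma cube_roots_C3_squared_D4: "cube_roots C3_squared_D4 = (\<lambda>(k, l). rotations k l) ` ({..<3} \<times> {..<3})"
proof (intro equalityI subsetI)
  fix p assume "p \<in> cube_roots C3_squared_D4"
  then have p: "p permutes {1..6}" "p \<circ> p \<circ> p = id"
    and block: "\<And>i j. i \<in> {1..6} \<Longrightarrow> j \<in> {1..6} \<Longrightarrow> (p i \<le> 3 \<longleftrightarrow> p j \<le> 3) \<longleftrightarrow> (i \<le> 3 \<longleftrightarrow> j \<le> 3)"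
    using C3_squared_D4_subgroup(2) by (auto simp: cube_roots_def C3_squared_D4_simps block_group_def subset_iff)
  have ppp: "p (p (p i)) = i" for i using fun_cong[OF p(2), of i] by simp
  have in6: "p i \<in> {1..6}" if "i \<in> {1..6}" for i using permutes_in_image[OF p(1)] that by blast
  have inj: "p i = p j \<longleftrightarrow> i = j" for i j using permutes_inj[OF p(1)] by (auto simp: inj_def)
  \<comment> \<open>If \<open>p\<close> interchanged the blocks, so would its cube, which is the
    identity.\<close>
  have pres1: "p 1 \<le> 3"
  proof (rule ccontr)
    assume "\<not> p 1 \<le> 3"
    then have swap: "p i \<le> 3 \<longleftrightarrow> \<not> i \<le> 3" if "i \<in> {1..6}" for i
      using block[of 1 i] that by auto
    have "p (p (p 1)) \<le> 3 \<longleftrightarrow> \<not> (1::nat) \<le> 3"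
      using swap[of "p (p 1)"] swap[of "p 1"] swap[of 1] in6 by simp
    then show False using ppp[of 1] by simp
  qed
  have pres: "p i \<le> 3 \<longleftrightarrow> i \<le> 3" if "i \<in> {1..6}" for i
    using block[of 1 i] pres1 that by auto
  have low: "p i \<in> {1, 2, 3}" if "i \<in> {1, 2, 3}" for i
    using that pres[of i] in6[of i] by auto
  have high: "p i \<in> {4, 5, 6}" if "i \<in> {4, 5, 6}" for i
    using that pres[of i] in6[of i] by auto
  have "p 1 = 1 \<or> p 1 = 2 \<or> p 1 = 3" "p 2 = 1 \<or> p 2 = 2 \<or> p 2 = 3" "p 3 = 1 \<or> p 3 = 2 \<or> p 3 = 3"
    using low by auto
  \<comment> \<open>The three transpositions of the block are excluded because their cubes are not
    the identity.\<close>
  then have "p 1 = 1 \<and> p 2 = 2 \<and> p 3 = 3 \<or> p 1 = 2 \<and> p 2 = 3 \<and> p 3 = 1 \<or> p 1 = 3 \<and> p 2 = 1 \<and> p 3 = 2"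
    using inj[of 1 2] inj[of 1 3] inj[of 2 3] ppp[of 1] ppp[of 2] ppp[of 3] by (elim disjE) auto
  then obtain k where k: "k < 3" "p 1 = rotations k 0 1" "p 2 = rotations k 0 2" "p 3 = rotations k 0 3"
    using that[of 0] that[of 1] that[of 2] by (elim disjE) (auto simp: rotations_def)
  have "p 4 = 4 \<or> p 4 = 5 \<or> p 4 = 6" "p 5 = 4 \<or> p 5 = 5 \<or> p 5 = 6" "p 6 = 4 \<or> p 6 = 5 \<or> p 6 = 6"
    using high by auto
  then have "p 4 = 4 \<and> p 5 = 5 \<and> p 6 = 6 \<or> p 4 = 5 \<and> p 5 = 6 \<and> p 6 = 4 \<or> p 4 = 6 \<and> p 5 = 4 \<and> p 6 = 5"
    using inj[of 4 5] inj[of 4 6] inj[of 5 6] ppp[of 4] ppp[of 5] ppp[of 6] by (elim disjE) auto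
  then obtain l where l: "l < 3" "p 4 = rotations 0 l 4" "p 5 = rotations 0 l 5" "p 6 = rotations 0 l 6"
    using that[of 0] that[of 1] that[of 2] by (elim disjE) (auto simp: rotations_def)
  have out: "p i = i" if "i \<notin> {1..6}" for i using p(1) that by (auto simp: permutes_def)
  have "p i = rotations k l i" for i
    using k l out[of i] by (cases i rule: le_6_cases) (auto simp: rotations_def)
  then have "p = rotations k l" by auto
  then show "p \<in> (\<lambda>(k, l). rotations k l) ` ({..<3} \<times> {..<3})" using k(1) l(1) by auto
next
  fix p assume "p \<in> (\<lambda>(k, l). rotations k l) ` ({..<3} \<times> {..<3})"
  then obtain k l where p: "p = rotations k l" by auto
  have "k + k + k = 3 * k" "l + l + l = 3 * l" by auto
  then have "p \<circ> p \<circ> p = rotations (3 * k) (3 * l)" by (simp only: p rotations_comp)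
  also have "\<dots> = id" using rotations_mod[of "3 * k" "3 * l"] by (simp add: rotations_0)
  finally show "p \<in> cube_roots C3_squared_D4"
    using rotations_mem by (simp add: cube_roots_def C3_squared_D4_simps p)
qed

lemma CM_subgroups_C3_squared_D4:
  assumes "sextic_config C3_squared_D4 H c" shows "CM_subgroups C3_squared_D4 H c"
proof (rule sextic_config.CM_subgroups_cube_roots[OF assms])
  have "inj_on (\<lambda>(k, l). rotations k l) ({..<3} \<times> {..<3})"
  proof (rule inj_onI, clarify)
    fix k l k' l' :: nat
    assume *: "k < 3" "l < 3" "k' < 3" "l' < 3" "rotations k l = rotations k' l'"
    have "rotations k l 1 = rotations k' l' 1" "rotations k l 4 = rotations k' l' 4" using * by auto
    then show "k = k' \<and> l = l'" using *(1-4) by (simp add: rotations_def)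
  qed
  then show "card (cube_roots C3_squared_D4) = 3 ^ 2"
    by (simp add: cube_roots_C3_squared_D4 card_image card_cartesian_product)
  \<comment> \<open>Without computing the order of the group: it divides 6! = 720, which is not
    divisible by 27.\<close>
  show "\<not> 3 ^ (2 + 1) dvd card (carrier C3_squared_D4)"
  proof
    interpret S: group "sym_group 6" by (rule sym_group_is_group)
    assume "3 ^ (2 + 1) dvd card (carrier C3_squared_D4)"
    also have "\<dots> dvd card (carrier (sym_group 6))"
      using S.card_subgroup_dvd[OF C3_squared_D4_subgroup(1) S.subgroup_self subgroup.subset[OF C3_squared_D4_subgroup(1)]] .
    finally show False by (simp add: sym_group_card_carrier fact_numeral)
  qed
  fix x y assume "x \<in> cube_roots C3_squared_D4" "y \<in> cube_roots C3_squared_D4"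
  then obtain k l k' l' where "x = rotations k l" "y = rotations k' l'"
    by (auto simp: cube_roots_C3_squared_D4)
  then have "x \<circ> y = rotations ((k + k') mod 3) ((l + l') mod 3)"
    by (simp add: rotations_comp rotations_mod[symmetric])
  then show "x \<otimes>\<^bsub>C3_squared_D4\<^esub> y \<in> cube_roots C3_squared_D4"
    unfolding cube_roots_C3_squared_D4 C3_squared_D4_simps by force
qed

section \<open>Symmetric groups of degree at least 5\<close>

lemma cycle_funpow_length:
  assumes "cycle cs" shows "cycle_of_list cs ^^ length cs = id"
proof
  fix x
  show "(cycle_of_list cs ^^ length cs) x = id x"
  proof (cases "x \<in> set cs")
    case True
    have "map (cycle_of_list cs ^^ length cs) cs = map id cs"
      using cyclic_rotation[OF assms, of "length cs"] by simp
    then show ?thesis using True by (simp only: map_eq_conv)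
  next
    case False
    then have "cycle_of_list cs x = x" by (rule id_outside_supp)
    then have "(cycle_of_list cs ^^ n) x = x" for n by (induction n) auto
    then show ?thesis by simp
  qed
qed

text \<open>This leads from the elements of order 5 to the 3-cycles, which generate the alternating
  group.\<close>

lemma three_cycle_as_five_cycles:
  assumes "distinct [a, b, c, d, e]"
  shows "cycle_of_list [a, b, c] = cycle_of_list [a, c, b, d, e] \<circ> cycle_of_list [a, c, e, d, b]"
proof
  fix x
  have ne: "a \<noteq> b" "a \<noteq> c" "a \<noteq> d" "a \<noteq> e" "b \<noteq> c" "b \<noteq> d" "b \<noteq> e" "c \<noteq> d" "c \<noteq> e" "d \<noteq> e"
    using assms by auto
  consider "x = a" | "x = b" | "x = c" | "x = d" | "x = e" | "x \<notin> {a, b, c, d, e}" by blast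
  then show "cycle_of_list [a, b, c] x = (cycle_of_list [a, c, b, d, e] \<circ> cycle_of_list [a, c, e, d, b]) x"
    by cases (simp_all add: ne ne[symmetric] transpose_apply_other)
qed

text \<open>Once \<open>H\<close> contains all 5-cycles it contains the alternating group, of order
  n!/2, whereas |H| = n!/6.\<close>

lemma not_CM_subgroups_sym_group:
  assumes n: "n \<ge> 5" and config: "sextic_config (sym_group n) H c"
  shows "\<not> CM_subgroups (sym_group n) H c"
proof
  interpret C: sextic_config "sym_group n" H c by fact
  assume CM: "CM_subgroups (sym_group n) H c"
  have five: "cycle_of_list cs \<in> H" if "cycle cs" "length cs = 5" "set cs \<subseteq> {1..n}" for cs
  proof (rule C.CM_subgroups_order_5[OF CM])
    show "cycle_of_list cs \<in> carrier (sym_group n)"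
      using that cycle_of_list_permutes by (simp add: sym_group_carrier)
    have "p [^]\<^bsub>sym_group n\<^esub> k = p ^^ k" for p and k :: nat
      by (induction k) (simp_all add: sym_group_mult sym_group_one funpow_Suc_right del: funpow.simps(2))
    then show "cycle_of_list cs [^]\<^bsub>sym_group n\<^esub> (5::nat) = \<one>\<^bsub>sym_group n\<^esub>"
      using cycle_funpow_length[OF that(1)] that(2) by (simp add: sym_group_one)
  qed
  have three: "three_cycles n \<subseteq> H"
  proof safe
    fix cs :: "nat list" assume cs: "cycle cs" "length cs = 3" "set cs \<subseteq> {1..n}"
    then obtain a b d where abd: "cs = [a, b, d]" using stupid_lemma by blast
    \<comment> \<open>The two letters that complete a 3-cycle to five letters; here n \<ge> 5 is
      used.\<close>
    have "card ({1..n} - {a, b, d}) \<ge> 2"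
      using n cs abd by (subst card_Diff_subset) auto
    then obtain e f where ef: "e \<in> {1..n} - {a, b, d}" "f \<in> {1..n} - {a, b, d}" "e \<noteq> f"
      by (metis card_2_iff' card_le_Suc0_iff_eq finite_Diff finite_atLeastAtMost not_less_eq_eq numeral_2_eq_2)
    have "cycle_of_list [a, b, d] = cycle_of_list [a, d, b, e, f] \<circ> cycle_of_list [a, d, f, e, b]"
      using cs ef unfolding abd by (intro three_cycle_as_five_cycles) auto
    moreover have "cycle_of_list [a, d, b, e, f] \<in> H" "cycle_of_list [a, d, f, e, b] \<in> H"
      using cs ef unfolding abd by (auto intro!: five simp del: cycle_of_list.simps)
    ultimately show "cycle_of_list cs \<in> H"
      using subgroup.m_closed[OF C.H] by (simp add: abd sym_group_mult del: cycle_of_list.simps)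
  qed
  have "p \<in> H" if "p \<in> generate (alt_group n) (three_cycles n)" for p
    using that
  proof (induction rule: generate.induct)
    case one
    then show ?case using subgroup.one_closed[OF C.H] by (metis alt_group_one sym_group_one)
  next
    case (inv p)
    then have p: "p \<in> H" "p \<in> carrier (alt_group n)" using three three_cycles_incl by blast+
    show ?case
      using subgroup.m_inv_closed[OF C.H p(1)]
      unfolding alt_group_inv_equality[OF p(2)] sym_group_inv_equality[OF subgroup.mem_carrier[OF C.H p(1)]] .
  next
    case (eng p q)
    show ?case
      using subgroup.m_closed[OF C.H eng.IH(1) eng.IH(2)] by (simp only: alt_group_mult sym_group_mult)
  qed (use three in blast)
  then have "carrier (alt_group n) \<subseteq> H" using alt_group_carrier_as_three_cycles by blast
  then have "card (carrier (alt_group n)) \<le> card H" by (rule card_mono[OF C.finite_H])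
  then have "fact n \<le> 2 * card H" using alt_group_card_carrier[of n] n by simp
  then show False using C.card_G C.card_H_pos by (simp add: sym_group_card_carrier)
qed

section \<open>The Klein four-group in S_4\<close>

definition double_transpositions :: "(nat \<Rightarrow> nat) set"
  where "double_transpositions =
    {transpose 1 2 \<circ> transpose 3 4, transpose 1 3 \<circ> transpose 2 4, transpose 1 4 \<circ> transpose 2 3}"

definition klein_four :: "(nat \<Rightarrow> nat) set"
  where "klein_four = insert id double_transpositions"

lemma le_4_cases:
  fixes i :: nat
  obtains "i = 0" | "i = 1" | "i = 2" | "i = 3" | "i = 4" | "4 < i"
  by linarith

lemma in_1_4: "i \<in> {1..4::nat} \<longleftrightarrow> i = 1 \<or> i = 2 \<or> i = 3 \<or> i = 4"
  by auto

text \<open>Being an involution without fixed points is visibly invariant under conjugation, which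
  yields the normality of \<open>klein_four\<close>.\<close>

lemma double_transpositions_iff:
  "p \<in> double_transpositions \<longleftrightarrow> p permutes {1..4} \<and> p \<circ> p = id \<and> (\<forall>i\<in>{1..4}. p i \<noteq> i)"
proof
  assume "p \<in> double_transpositions"
  then show "p permutes {1..4} \<and> p \<circ> p = id \<and> (\<forall>i\<in>{1..4}. p i \<noteq> i)"
    unfolding double_transpositions_def
  proof (elim insertE emptyE)
    assume p: "p = transpose 1 2 \<circ> transpose 3 4"
    have "(p \<circ> p) i = id i" for i unfolding p by (cases i rule: le_4_cases) (simp_all add: transpose_def)
    then show ?thesis unfolding p by (auto intro!: permutes_compose permutes_swap_id simp: in_1_4 transpose_def)
  next
    assume p: "p = transpose 1 3 \<circ> transpose 2 4"
    have "(p \<circ> p) i = id i" for i unfolding p by (cases i rule: le_4_cases) (simp_all add: transpose_def)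
    then show ?thesis unfolding p by (auto intro!: permutes_compose permutes_swap_id simp: in_1_4 transpose_def)
  next
    assume p: "p = transpose 1 4 \<circ> transpose 2 3"
    have "(p \<circ> p) i = id i" for i unfolding p by (cases i rule: le_4_cases) (simp_all add: transpose_def)
    then show ?thesis unfolding p by (auto intro!: permutes_compose permutes_swap_id simp: in_1_4 transpose_def)
  qed
next
  assume p: "p permutes {1..4} \<and> p \<circ> p = id \<and> (\<forall>i\<in>{1..4}. p i \<noteq> i)"
  have pp: "p (p i) = i" for i using p by (metis comp_apply id_apply)
  have in4: "p i \<in> {1..4}" if "i \<in> {1..4}" for i using permutes_in_image[OF conjunct1[OF p]] that by blast
  have out: "p i = i" if "i \<notin> {1..4}" for i using p that by (auto simp: permutes_def)
  have v: "p 1 = 2 \<or> p 1 = 3 \<or> p 1 = 4" "p 2 = 1 \<or> p 2 = 3 \<or> p 2 = 4" "p 3 = 1 \<or> p 3 = 2 \<or> p 3 = 4"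
    "p 4 = 1 \<or> p 4 = 2 \<or> p 4 = 3"
    using in4[of 1] in4[of 2] in4[of 3] in4[of 4] p unfolding in_1_4 by auto
  then have "p 1 = 2 \<and> p 2 = 1 \<and> p 3 = 4 \<and> p 4 = 3 \<or> p 1 = 3 \<and> p 3 = 1 \<and> p 2 = 4 \<and> p 4 = 2 \<or>
      p 1 = 4 \<and> p 4 = 1 \<and> p 2 = 3 \<and> p 3 = 2"
    using pp[of 1] pp[of 2] pp[of 3] pp[of 4] by (elim disjE) auto
  then show "p \<in> double_transpositions"
  proof (elim disjE)
    assume *: "p 1 = 2 \<and> p 2 = 1 \<and> p 3 = 4 \<and> p 4 = 3"
    have "p i = (transpose 1 2 \<circ> transpose 3 4) i" for i
      using * out[of i] by (cases i rule: le_4_cases) (simp_all add: transpose_def)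
    then show ?thesis by (auto simp: double_transpositions_def)
  next
    assume *: "p 1 = 3 \<and> p 3 = 1 \<and> p 2 = 4 \<and> p 4 = 2"
    have "p i = (transpose 1 3 \<circ> transpose 2 4) i" for i
      using * out[of i] by (cases i rule: le_4_cases) (simp_all add: transpose_def)
    then show ?thesis by (auto simp: double_transpositions_def)
  next
    assume *: "p 1 = 4 \<and> p 4 = 1 \<and> p 2 = 3 \<and> p 3 = 2"
    have "p i = (transpose 1 4 \<circ> transpose 2 3) i" for i
      using * out[of i] by (cases i rule: le_4_cases) (simp_all add: transpose_def)
    then show ?thesis by (auto simp: double_transpositions_def)
  qed
qed

lemma perm_eqI_4:
  assumes "p 1 = q 1" "p 2 = q 2" "p 3 = q 3" "p 4 = q 4" "\<And>i. i = 0 \<or> 4 < i \<Longrightarrow> p i = q i"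
  shows "p = (q :: nat \<Rightarrow> nat)"
proof
  fix i show "p i = q i" by (cases i rule: le_4_cases) (use assms in auto)
qed

lemma double_transpositions_mult:
  "transpose 1 2 \<circ> transpose 3 4 \<circ> (transpose 1 3 \<circ> transpose 2 4) = transpose 1 4 \<circ> transpose 2 (3::nat)"
  "transpose 1 3 \<circ> transpose 2 4 \<circ> (transpose 1 2 \<circ> transpose 3 4) = transpose 1 4 \<circ> transpose 2 (3::nat)"
  "transpose 1 2 \<circ> transpose 3 4 \<circ> (transpose 1 4 \<circ> transpose 2 3) = transpose 1 3 \<circ> transpose 2 (4::nat)"
  "transpose 1 4 \<circ> transpose 2 3 \<circ> (transpose 1 2 \<circ> transpose 3 4) = transpose 1 3 \<circ> transpose 2 (4::nat)"
  "transpose 1 3 \<circ> transpose 2 4 \<circ> (transpose 1 4 \<circ> transpose 2 3) = transpose 1 2 \<circ> transpose 3 (4::nat)"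
  "transpose 1 4 \<circ> transpose 2 3 \<circ> (transpose 1 3 \<circ> transpose 2 4) = transpose 1 2 \<circ> transpose 3 (4::nat)"
  by (rule perm_eqI_4; simp add: transpose_def)+

lemma double_transpositions_distinct:
  "transpose 1 2 \<circ> transpose 3 4 \<noteq> transpose 1 3 \<circ> transpose 2 (4::nat)"
  "transpose 1 2 \<circ> transpose 3 4 \<noteq> transpose 1 4 \<circ> transpose 2 (3::nat)"
  "transpose 1 3 \<circ> transpose 2 4 \<noteq> transpose 1 4 \<circ> transpose 2 (3::nat)"
proof -
  have "(transpose 1 2 \<circ> transpose 3 4) 1 = (2::nat)" "(transpose 1 3 \<circ> transpose 2 4) 1 = (3::nat)"
    "(transpose 1 4 \<circ> transpose 2 3) 1 = (4::nat)" by (simp_all add: transpose_def)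
  then show "transpose 1 2 \<circ> transpose 3 4 \<noteq> transpose 1 3 \<circ> transpose 2 (4::nat)"
    "transpose 1 2 \<circ> transpose 3 4 \<noteq> transpose 1 4 \<circ> transpose 2 (3::nat)"
    "transpose 1 3 \<circ> transpose 2 4 \<noteq> transpose 1 4 \<circ> transpose 2 (3::nat)"
    by (auto dest!: fun_cong[of _ _ 1])
qed

lemma klein_four_subset: "klein_four \<subseteq> carrier (sym_group 4)"
  by (auto simp: klein_four_def sym_group_carrier double_transpositions_iff permutes_id)

lemma klein_four_closed:
  assumes "p \<in> klein_four" "q \<in> klein_four" shows "p \<circ> q \<in> klein_four"
proof -
  have "p \<circ> q = id" if "p \<in> double_transpositions" "p = q"
    using that by (simp add: double_transpositions_iff)
  then show ?thesis
    using assms double_transpositions_mult unfolding klein_four_def double_transpositions_def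
    by (elim insertE emptyE) auto
qed

lemma klein_four_conj:
  assumes "p \<in> klein_four" "q permutes {1..4}" shows "q \<circ> p \<circ> inv' q \<in> klein_four"
proof (cases "p = id")
  case True
  then show ?thesis using permutes_inv_o(1)[OF assms(2)] by (simp add: klein_four_def)
next
  case False
  then have p: "p permutes {1..4}" "p \<circ> p = id" "\<forall>i\<in>{1..4}. p i \<noteq> i"
    using assms(1) by (auto simp: klein_four_def double_transpositions_iff)
  note q = permutes_inverses[OF assms(2)] permutes_inv[OF assms(2)]
  have pp: "p (p i) = i" for i using p(2) by (metis comp_apply id_apply)
  have "q (p (inv' q i)) \<noteq> i" if "i \<in> {1..4}" for i
  proof
    assume "q (p (inv' q i)) = i"
    then have "p (inv' q i) = inv' q i" using q by metis
    moreover have "inv' q i \<in> {1..4}" using permutes_in_image[OF q(3)] that by blast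
    ultimately show False using p(3) by blast
  qed
  then have "q \<circ> p \<circ> inv' q \<in> double_transpositions"
    unfolding double_transpositions_iff
    using p(1) q assms(2) pp by (auto intro!: permutes_compose simp: fun_eq_iff)
  then show ?thesis by (simp add: klein_four_def)
qed

lemma klein_four_normal: "klein_four \<lhd> sym_group 4"
proof -
  interpret S: group "sym_group 4" by (rule sym_group_is_group)
  show ?thesis
  proof (rule S.normal_invI)
    show "subgroup klein_four (sym_group 4)"
    proof (rule S.subgroupI[OF klein_four_subset])
      fix p assume p: "p \<in> klein_four"
      then have "p \<circ> p = id" by (auto simp: klein_four_def double_transpositions_iff)
      then have "inv\<^bsub>sym_group 4\<^esub> p = p"
        using p klein_four_subset by (intro S.inv_equality) (auto simp: sym_group_mult sym_group_one)
      then show "inv\<^bsub>sym_group 4\<^esub> p \<in> klein_four" using p by simp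
    qed (use klein_four_closed in \<open>auto simp: sym_group_mult klein_four_def\<close>)
    show "q \<otimes>\<^bsub>sym_group 4\<^esub> p \<otimes>\<^bsub>sym_group 4\<^esub> inv\<^bsub>sym_group 4\<^esub> q \<in> klein_four"
      if "p \<in> klein_four" "q \<in> carrier (sym_group 4)" for p q
      using klein_four_conj[OF that(1), of q] that(2) by (simp add: sym_group_mult sym_group_carrier)
  qed
qed

lemma card_klein_four: "card klein_four = 4"
proof -
  have "id \<notin> double_transpositions" by (auto simp: double_transpositions_iff)
  moreover have "card double_transpositions = 3"
    using double_transpositions_distinct unfolding double_transpositions_def by simp
  moreover have "finite double_transpositions" by (simp add: double_transpositions_def)
  ultimately show ?thesis by (simp add: klein_four_def)
qed

text \<open>A double transposition is the square of a 4-cycle in which the letters of each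
  transposed pair are opposite.\<close>

lemma klein_four_squares:
  assumes "v \<in> klein_four" shows "\<exists>w\<in>carrier (sym_group 4). v = w \<circ> w"
proof -
  have c: "cycle_of_list [1, 3, 2, 4] \<in> carrier (sym_group 4)" "cycle_of_list [1, 2, 3, 4] \<in> carrier (sym_group 4)"
    "cycle_of_list [1, 2, 4, 3] \<in> carrier (sym_group 4)" "id \<in> carrier (sym_group 4)"
    unfolding sym_group_carrier
    by (intro cycle_of_list_permutes; simp)+ (rule permutes_id)
  have "transpose 1 2 \<circ> transpose 3 4 = cycle_of_list [1, 3, 2, 4] \<circ> cycle_of_list [1, 3, 2, 4::nat]"
    "transpose 1 3 \<circ> transpose 2 4 = cycle_of_list [1, 2, 3, 4] \<circ> cycle_of_list [1, 2, 3, 4::nat]"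
    "transpose 1 4 \<circ> transpose 2 3 = cycle_of_list [1, 2, 4, 3] \<circ> cycle_of_list [1, 2, 4, 3::nat]"
    by (rule perm_eqI_4; simp add: transpose_def)+
  moreover have "id = id \<circ> (id :: nat \<Rightarrow> nat)" by simp
  ultimately show ?thesis
    using assms c unfolding klein_four_def double_transpositions_def by (elim insertE emptyE) metis+
qed

text \<open>An involution with a fixed letter is a single transposition. A fixed letter is kept as
  the third letter \<open>d\<close>, from which a 3-cycle will be built.\<close>

lemma involution_4_cases:
  assumes p: "p permutes {1..4}" "p \<circ> p = id" "p \<noteq> id"
  obtains (transposition) a b d where "a \<in> {1..4}" "b \<in> {1..4}" "d \<in> {1..4}" "distinct [a, b, d]" "p = transpose a b"
  | (double) "p \<in> double_transpositions"
proof (cases "p \<in> double_transpositions")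
  case False
  then obtain x where x: "x \<in> {1..4}" "p x = x" using p by (auto simp: double_transpositions_iff)
  have pp: "p (p i) = i" for i using p(2) by (metis comp_apply id_apply)
  have in4: "p i \<in> {1..4}" if "i \<in> {1..4}" for i using permutes_in_image[OF p(1)] that by blast
  have out: "p i = i" if "i \<notin> {1..4}" for i using p(1) that by (auto simp: permutes_def)
  obtain a where a: "p a \<noteq> a" using p(3) by (auto simp: fun_eq_iff)
  then have a4: "a \<in> {1..4}" using out by blast
  have "p z = transpose a (p a) z" for z
  proof (cases "z = a \<or> z = p a")
    case False
    have "p z = z"
    proof (rule ccontr)
      assume z: "p z \<noteq> z"
      then have z4: "z \<in> {1..4}" using out by blast
      \<comment> \<open>Two transposed pairs and a fixed letter do not fit into four
        letters.\<close>
      have "card {a, p a, z, p z, x} = 5"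
        using False z a x pp by (auto simp: card_insert_if) (metis pp)+
      moreover have "{a, p a, z, p z, x} \<subseteq> {1..4}" using a4 z4 x in4 by blast
      ultimately show False using card_mono[of "{1..4::nat}" "{a, p a, z, p z, x}"] by simp
    qed
    then show ?thesis using False by (simp add: transpose_def)
  qed (use pp in \<open>auto simp: transpose_def\<close>)
  then have "p = transpose a (p a)" by (rule ext)
  moreover have "a \<noteq> x" "p a \<noteq> x" "a \<noteq> p a" using a x pp by metis+
  ultimately show ?thesis using transposition[of a "p a" x] a4 x in4[OF a4] by simp
qed (rule double)

text \<open>The conjugating element can be taken to be the identity or a transposition; being its
  own inverse, it spares the inverse in the computations.\<close>

lemma double_transpositions_conj:
  assumes "p \<in> double_transpositions" "q \<in> double_transpositions"
  obtains g where "g \<in> carrier (sym_group 4)" "inv\<^bsub>sym_group 4\<^esub> g \<otimes>\<^bsub>sym_group 4\<^esub> p \<otimes>\<^bsub>sym_group 4\<^esub> g = q"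
proof -
  have idg: "\<exists>g. g permutes {1..4} \<and> inv' g = g \<and> g \<circ> p \<circ> g = p"
    by (rule exI[of _ id]) (simp add: permutes_id)
  have tr: "\<exists>g. g permutes {1..4} \<and> inv' g = g \<and> g \<circ> r \<circ> g = s"
    if "i \<in> {1..4}" "j \<in> {1..4}" "transpose i j \<circ> r \<circ> transpose i j = s" for i j :: nat and r s
    using that by (intro exI[of _ "transpose i j"]) (simp add: permutes_swap_id)
  have "transpose 2 3 \<circ> (transpose 1 2 \<circ> transpose 3 4) \<circ> transpose 2 3 = transpose 1 3 \<circ> transpose 2 (4::nat)"
    "transpose 2 4 \<circ> (transpose 1 2 \<circ> transpose 3 4) \<circ> transpose 2 4 = transpose 1 4 \<circ> transpose 2 (3::nat)"
    "transpose 2 3 \<circ> (transpose 1 3 \<circ> transpose 2 4) \<circ> transpose 2 3 = transpose 1 2 \<circ> transpose 3 (4::nat)"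
    "transpose 3 4 \<circ> (transpose 1 3 \<circ> transpose 2 4) \<circ> transpose 3 4 = transpose 1 4 \<circ> transpose 2 (3::nat)"
    "transpose 2 4 \<circ> (transpose 1 4 \<circ> transpose 2 3) \<circ> transpose 2 4 = transpose 1 2 \<circ> transpose 3 (4::nat)"
    "transpose 3 4 \<circ> (transpose 1 4 \<circ> transpose 2 3) \<circ> transpose 3 4 = transpose 1 3 \<circ> transpose 2 (4::nat)"
    by (rule perm_eqI_4; simp add: transpose_def)+
  note ex = this[THEN tr[rotated 2]]
  have "\<exists>g. g permutes {1..4} \<and> inv' g = g \<and> g \<circ> p \<circ> g = q"
    using assms idg ex unfolding double_transpositions_def by (elim insertE emptyE) auto
  then obtain g where "g permutes {1..4}" "inv' g = g" "g \<circ> p \<circ> g = q" by blast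
  then show thesis using that[of g] by (simp add: sym_group_carrier sym_group_mult)
qed

text \<open>The two cases of the hypothesis of \<open>not_CM_subgroups\<close>: for a transposition \<open>c\<close> the product
  with a suitable conjugate is a 3-cycle.\<close>

lemma sym_group_4_involution:
  assumes p: "p \<in> carrier (sym_group 4)" "p \<circ> p = id" "p \<noteq> id"
  shows "(\<exists>g\<in>carrier (sym_group 4). let t = p \<circ> (inv\<^bsub>sym_group 4\<^esub> g \<otimes>\<^bsub>sym_group 4\<^esub> p \<otimes>\<^bsub>sym_group 4\<^esub> g) in
      t \<noteq> id \<and> t \<circ> t \<circ> t = id) \<or>
    (\<forall>v\<in>klein_four. \<exists>g\<in>carrier (sym_group 4). \<exists>k\<in>carrier (sym_group 4).
      v = (inv\<^bsub>sym_group 4\<^esub> g \<otimes>\<^bsub>sym_group 4\<^esub> p \<otimes>\<^bsub>sym_group 4\<^esub> g) \<circ> (inv\<^bsub>sym_group 4\<^esub> k \<otimes>\<^bsub>sym_group 4\<^esub> p \<otimes>\<^bsub>sym_group 4\<^esub> k))"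
proof -
  have pp: "p permutes {1..4}" using p(1) by (simp add: sym_group_carrier)
  show ?thesis
    using pp p(2,3)
  proof (cases rule: involution_4_cases)
    case (transposition a b d)
    \<comment> \<open>Conjugation by (b d) turns (a b) into (a d), and (a b)(a d) is a
      3-cycle.\<close>
    let ?g = "transpose b d"
    have g: "?g \<in> carrier (sym_group 4)" using transposition by (simp add: sym_group_carrier permutes_swap_id)
    let ?t = "transpose a b \<circ> (transpose b d \<circ> transpose a b \<circ> transpose b d)"
    have "?t d \<noteq> d" using transposition by (simp add: transpose_def)
    then have "?t \<noteq> id" by force
    moreover have "(?t \<circ> ?t \<circ> ?t) x = id x" for x
    proof -
      consider "x = a" | "x = b" | "x = d" | "x \<notin> {a, b, d}" by blast
      then show ?thesis using transposition by cases (simp_all add: transpose_def)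
    qed
    then have "?t \<circ> ?t \<circ> ?t = id" by auto
    ultimately show ?thesis
      using g transposition by (intro disjI1 bexI[of _ ?g]) (simp_all add: Let_def sym_group_mult)
  next
    case double
    \<comment> \<open>The identity is the square of any double transposition, and each double
      transposition is the product of the other two.\<close>
    have "\<exists>x\<in>double_transpositions. \<exists>y\<in>double_transpositions. v = x \<circ> y" if "v \<in> klein_four" for v
      using that double_transpositions_mult double p(2)
      unfolding klein_four_def double_transpositions_def by (elim insertE emptyE) (metis insertI1 insertI2)+
    then show ?thesis using double_transpositions_conj[OF double] by (intro disjI2 ballI) metis
  qed
qed

lemma not_CM_subgroups_S4:
  assumes config: "sextic_config (sym_group 4) H c"
  shows "\<not> CM_subgroups (sym_group 4) H c"
proof -
  interpret C: sextic_config "sym_group 4" H c by fact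
  have "c \<noteq> id"
  proof
    assume "c = id"
    then have "c = \<one>\<^bsub>sym_group 4\<^esub>" by (simp only: sym_group_one)
    then show False using C.no_conj[OF C.one_closed] subgroup.one_closed[OF C.H] C.inv_one C.r_one C.one_closed by metis
  qed
  moreover have "c \<circ> c = id" using C.cc by (simp add: sym_group_mult sym_group_one)
  ultimately have "(\<exists>g\<in>carrier (sym_group 4). let t = c \<circ> (inv\<^bsub>sym_group 4\<^esub> g \<otimes>\<^bsub>sym_group 4\<^esub> c \<otimes>\<^bsub>sym_group 4\<^esub> g) in
      t \<noteq> id \<and> t \<circ> t \<circ> t = id) \<or>
    (\<forall>v\<in>klein_four. \<exists>g\<in>carrier (sym_group 4). \<exists>k\<in>carrier (sym_group 4).
      v = (inv\<^bsub>sym_group 4\<^esub> g \<otimes>\<^bsub>sym_group 4\<^esub> c \<otimes>\<^bsub>sym_group 4\<^esub> g) \<circ> (inv\<^bsub>sym_group 4\<^esub> k \<otimes>\<^bsub>sym_group 4\<^esub> c \<otimes>\<^bsub>sym_group 4\<^esub> k))"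
    using sym_group_4_involution[OF C.c] by blast
  then show ?thesis
    using klein_four_squares
    by (intro C.not_CM_subgroups[OF klein_four_normal card_klein_four])
      (auto simp: Let_def sym_group_mult sym_group_one numeral_3_eq_3 sym_group_card_carrier fact_numeral
        simp del: sym_group_inv_equality)
qed

section \<open>The group S_4 x C_2\<close>

abbreviation S4_C2 where "S4_C2 \<equiv> sym_group 4 \<times>\<times> integer_mod_group 2"

lemma S4_C2_group: "group S4_C2"
  by (intro DirProd_group sym_group_is_group group_integer_mod_group)

lemma S4_C2_mult: "(p, e) \<otimes>\<^bsub>S4_C2\<^esub> (q, f) = (p \<otimes>\<^bsub>sym_group 4\<^esub> q, (e + f) mod 2)"
  by simp

lemma S4_C2_inv:
  assumes "p \<in> carrier (sym_group 4)" "e \<in> {0, 1}"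
  shows "inv\<^bsub>S4_C2\<^esub> (p, e) = (inv\<^bsub>sym_group 4\<^esub> p, e)"
  using assms by (subst inv_DirProd)
    (auto simp: sym_group_is_group carrier_integer_mod_group simp del: sym_group_inv_equality)

lemma S4_C2_carrier: "(p, e) \<in> carrier S4_C2 \<longleftrightarrow> p \<in> carrier (sym_group 4) \<and> e \<in> {0, 1}"
  by (auto simp: carrier_integer_mod_group)

lemma S4_C2_conj:
  assumes "(p, e) \<in> carrier S4_C2" "g \<in> carrier (sym_group 4)"
  shows "inv\<^bsub>S4_C2\<^esub> (g, 0) \<otimes>\<^bsub>S4_C2\<^esub> (p, e) \<otimes>\<^bsub>S4_C2\<^esub> (g, 0) =
    (inv\<^bsub>sym_group 4\<^esub> g \<otimes>\<^bsub>sym_group 4\<^esub> p \<otimes>\<^bsub>sym_group 4\<^esub> g, e)"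
  using assms unfolding S4_C2_carrier by (subst S4_C2_inv) (auto simp del: sym_group_inv_equality)

lemma CM_subgroups_S4_C2_iff:
  assumes config: "sextic_config S4_C2 H c"
  shows "CM_subgroups S4_C2 H c \<longleftrightarrow> c = (id, 1)"
proof -
  interpret C: sextic_config S4_C2 H c by fact
  obtain p e where c: "c = (p, e)" by (cases c)
  have pe: "p \<in> carrier (sym_group 4)" "e \<in> {0, 1}" "(p, e) \<in> carrier S4_C2" using C.c unfolding c S4_C2_carrier by auto
  have pp: "p \<circ> p = id" using C.cc by (simp add: c sym_group_mult sym_group_one)
  \<comment> \<open>In a product of two conjugates of \<open>c\<close> the components in C_2 cancel,
    so everything reduces to the component in S_4.\<close>
  have ee: "(e + e) mod 2 = 0" using pe(2) by auto
  interpret S: group "sym_group 4" by (rule sym_group_is_group)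
  show ?thesis
  proof (cases "p = id")
    case True
    have "e \<noteq> 0"
    proof
      assume "e = 0"
      then have "c = \<one>\<^bsub>S4_C2\<^esub>" by (simp add: c True sym_group_one)
      then show False using C.no_conj[OF C.one_closed] subgroup.one_closed[OF C.H] C.inv_one C.r_one C.one_closed by metis
    qed
    then have "e = 1" using pe by auto
    moreover have "CM_subgroups S4_C2 H c"
      by (rule C.CM_subgroups_central) (auto simp: c True sym_group_mult add.commute)
    ultimately show ?thesis by (simp add: c True)
  next
    case False
    have V: "klein_four \<times> {0} \<lhd> S4_C2"
      using S.DirProd_normal[OF group_integer_mod_group klein_four_normal group.one_is_normal[OF group_integer_mod_group]]
      by simp
    have "\<not> CM_subgroups S4_C2 H c"
    proof (rule C.not_CM_subgroups[OF V])
      show "card (klein_four \<times> {0::int}) = 4" by (simp add: card_cartesian_product card_klein_four)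
      show "\<not> 9 dvd card (carrier S4_C2)"
        by (simp add: card_cartesian_product sym_group_card_carrier carrier_integer_mod_group fact_numeral)
      show "\<exists>w\<in>carrier S4_C2. v = w \<otimes>\<^bsub>S4_C2\<^esub> w" if v: "v \<in> klein_four \<times> {0}" for v
      proof -
        obtain w where w: "w \<in> carrier (sym_group 4)" "fst v = w \<circ> w" using klein_four_squares v by force
        then have "v = (w, 0) \<otimes>\<^bsub>S4_C2\<^esub> (w, 0)" using v by (cases v) (simp add: sym_group_mult)
        moreover have "(w, 0) \<in> carrier S4_C2" using w by (simp add: S4_C2_carrier)
        ultimately show ?thesis by blast
      qed
      have g0: "(g, 0) \<in> carrier S4_C2" if "g \<in> carrier (sym_group 4)" for g
        using that by (simp add: S4_C2_carrier)
      show "(\<exists>g\<in>carrier S4_C2. c \<otimes>\<^bsub>S4_C2\<^esub> (inv\<^bsub>S4_C2\<^esub> g \<otimes>\<^bsub>S4_C2\<^esub> c \<otimes>\<^bsub>S4_C2\<^esub> g) \<noteq> \<one>\<^bsub>S4_C2\<^esub> \<and>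
          (c \<otimes>\<^bsub>S4_C2\<^esub> (inv\<^bsub>S4_C2\<^esub> g \<otimes>\<^bsub>S4_C2\<^esub> c \<otimes>\<^bsub>S4_C2\<^esub> g)) [^]\<^bsub>S4_C2\<^esub> (3::nat) = \<one>\<^bsub>S4_C2\<^esub>) \<or>
        (\<forall>v\<in>klein_four \<times> {0}. \<exists>g\<in>carrier S4_C2. \<exists>k\<in>carrier S4_C2.
          v = (inv\<^bsub>S4_C2\<^esub> g \<otimes>\<^bsub>S4_C2\<^esub> c \<otimes>\<^bsub>S4_C2\<^esub> g) \<otimes>\<^bsub>S4_C2\<^esub> (inv\<^bsub>S4_C2\<^esub> k \<otimes>\<^bsub>S4_C2\<^esub> c \<otimes>\<^bsub>S4_C2\<^esub> k))"
        using sym_group_4_involution[OF pe(1) pp False]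
      proof
        assume "\<exists>g\<in>carrier (sym_group 4). let t = p \<circ> (inv\<^bsub>sym_group 4\<^esub> g \<otimes>\<^bsub>sym_group 4\<^esub> p \<otimes>\<^bsub>sym_group 4\<^esub> g) in
          t \<noteq> id \<and> t \<circ> t \<circ> t = id"
        then obtain g t where g: "g \<in> carrier (sym_group 4)"
          "t = p \<otimes>\<^bsub>sym_group 4\<^esub> (inv\<^bsub>sym_group 4\<^esub> g \<otimes>\<^bsub>sym_group 4\<^esub> p \<otimes>\<^bsub>sym_group 4\<^esub> g)" "t \<noteq> id" "t \<circ> t \<circ> t = id"
          by (auto simp: Let_def sym_group_mult)
        have "c \<otimes>\<^bsub>S4_C2\<^esub> (inv\<^bsub>S4_C2\<^esub> (g, 0) \<otimes>\<^bsub>S4_C2\<^esub> c \<otimes>\<^bsub>S4_C2\<^esub> (g, 0)) = (t, 0)"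
          unfolding c S4_C2_conj[OF pe(3) g(1)] S4_C2_mult g(2) ee ..
        moreover have "(t, 0) [^]\<^bsub>S4_C2\<^esub> (3::nat) = \<one>\<^bsub>S4_C2\<^esub>"
          using g(4) by (simp add: numeral_3_eq_3 sym_group_mult sym_group_one)
        ultimately show ?thesis
          using g(3) by (intro disjI1 bexI[OF _ g0[OF g(1)]]) (simp add: sym_group_one)
      next
        assume *: "\<forall>v\<in>klein_four. \<exists>g\<in>carrier (sym_group 4). \<exists>k\<in>carrier (sym_group 4).
          v = (inv\<^bsub>sym_group 4\<^esub> g \<otimes>\<^bsub>sym_group 4\<^esub> p \<otimes>\<^bsub>sym_group 4\<^esub> g) \<circ> (inv\<^bsub>sym_group 4\<^esub> k \<otimes>\<^bsub>sym_group 4\<^esub> p \<otimes>\<^bsub>sym_group 4\<^esub> k)"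
        show ?thesis
        proof (intro disjI2 ballI)
          fix v :: "(nat \<Rightarrow> nat) \<times> int" assume v: "v \<in> klein_four \<times> {0}"
          then obtain g k where gk: "g \<in> carrier (sym_group 4)" "k \<in> carrier (sym_group 4)"
            "fst v = (inv\<^bsub>sym_group 4\<^esub> g \<otimes>\<^bsub>sym_group 4\<^esub> p \<otimes>\<^bsub>sym_group 4\<^esub> g) \<circ> (inv\<^bsub>sym_group 4\<^esub> k \<otimes>\<^bsub>sym_group 4\<^esub> p \<otimes>\<^bsub>sym_group 4\<^esub> k)"
            using * by force
          have "v = (inv\<^bsub>S4_C2\<^esub> (g, 0) \<otimes>\<^bsub>S4_C2\<^esub> c \<otimes>\<^bsub>S4_C2\<^esub> (g, 0)) \<otimes>\<^bsub>S4_C2\<^esub> (inv\<^bsub>S4_C2\<^esub> (k, 0) \<otimes>\<^bsub>S4_C2\<^esub> c \<otimes>\<^bsub>S4_C2\<^esub> (k, 0))"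
            unfolding c S4_C2_conj[OF pe(3) gk(1)] S4_C2_conj[OF pe(3) gk(2)] S4_C2_mult ee
            using v gk(3) by (cases v) (simp add: sym_group_mult del: sym_group_inv_equality)
          then show "\<exists>g\<in>carrier S4_C2. \<exists>k\<in>carrier S4_C2.
            v = (inv\<^bsub>S4_C2\<^esub> g \<otimes>\<^bsub>S4_C2\<^esub> c \<otimes>\<^bsub>S4_C2\<^esub> g) \<otimes>\<^bsub>S4_C2\<^esub> (inv\<^bsub>S4_C2\<^esub> k \<otimes>\<^bsub>S4_C2\<^esub> c \<otimes>\<^bsub>S4_C2\<^esub> k)"
            using g0[OF gk(1)] g0[OF gk(2)] by blast
        qed
      qed
    qed
    then show ?thesis using False by (simp add: c)
  qed
qed

section \<open>The group A_4 x C_2\<close>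

lemma (in sextic_config) CM_subgroups_normal_8:
  assumes Q: "Q \<lhd> G" "card Q = 8" and G: "card (carrier G) = 24"
  shows "CM_subgroups G H c"
proof -
  have Qs: "subgroup Q G" using Q(1) by (rule normal_imp_subgroup)
  have H4: "card H = 4" using card_G G by simp
  \<comment> \<open>A normal Sylow 2-subgroup contains every subgroup of order dividing 4: the order
    of WQ divides 24 and 32, hence their difference 8, so that WQ = Q. This applies to
    \<open>H\<close> and to the subgroup generated by \<open>c\<close>.\<close>
  have sub: "W \<subseteq> Q" if W: "subgroup W G" "card W dvd 4" for W
  proof -
    obtain M where M: "subgroup M G" "W \<subseteq> M" "Q \<subseteq> M" "card M dvd card W * card Q"
      using normal_product[OF fin W(1) Q(1)] by metis
    have "card M dvd 24"
      using card_subgroup_dvd[OF M(1) subgroup_self subgroup.subset[OF M(1)]] G by simp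
    moreover have "card W * card Q dvd 4 * 8" using mult_dvd_mono[OF W(2) dvd_refl[of 8]] Q(2) by simp
    then have "card M dvd 32" using dvd_trans[OF M(4)] by simp
    ultimately have "card M dvd 32 - 24" by (intro dvd_diff_nat)
    then have "card M \<le> card Q" using Q(2) by (intro dvd_imp_le) auto
    then show ?thesis using subgroup_eq_if_card[OF fin Qs M(1,3)] M(2) by simp
  qed
  have cyc: "subgroup {\<one>, c} G"
    using c cc inv_equality[OF cc] by (intro subgroupI) auto
  have "card {\<one>, c} = 1 \<or> card {\<one>, c} = 2" by (cases "c = \<one>") auto
  moreover have "(1::nat) dvd 4" "(2::nat) dvd 4" by simp_all
  ultimately have "card {\<one>, c} dvd 4" by metis
  then have cQ: "c \<in> Q" using sub[OF cyc] by blast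
  show ?thesis
  proof (rule CM_subgroups_cubic[OF Qs])
    show "H \<subseteq> Q" using sub[OF H] H4 by simp
    show "card Q = 2 * card H" using Q(2) H4 by simp
    show "inv g \<otimes> c \<otimes> g \<in> Q" if "g \<in> carrier G" for g
      using normal.inv_op_closed1[OF Q(1) that cQ] .
  qed
qed

lemma klein_four_normal_alt: "klein_four \<lhd> alt_group 4"
proof -
  interpret A: group "alt_group 4" by (rule alt_group_is_group)
  have sub: "klein_four \<subseteq> carrier (alt_group 4)"
    unfolding klein_four_def double_transpositions_def
    by (auto simp: alt_group_carrier permutes_id evenperm_comp permutation_swap_id evenperm_swap
        intro!: permutes_compose permutes_swap_id)
  show ?thesis
  proof (rule A.normal_invI)
    show "subgroup klein_four (alt_group 4)"
    proof (rule A.subgroupI[OF sub])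
      fix p assume p: "p \<in> klein_four"
      then have "p \<circ> p = id" by (auto simp: klein_four_def double_transpositions_iff)
      then have "inv\<^bsub>alt_group 4\<^esub> p = p"
        using p sub by (intro A.inv_equality) (auto simp: alt_group_mult alt_group_one)
      then show "inv\<^bsub>alt_group 4\<^esub> p \<in> klein_four" using p by simp
    qed (use klein_four_closed in \<open>auto simp: alt_group_mult klein_four_def\<close>)
    show "q \<otimes>\<^bsub>alt_group 4\<^esub> p \<otimes>\<^bsub>alt_group 4\<^esub> inv\<^bsub>alt_group 4\<^esub> q \<in> klein_four"
      if "p \<in> klein_four" "q \<in> carrier (alt_group 4)" for p q
      using klein_four_conj[OF that(1), of q] that(2)
      by (simp add: alt_group_mult alt_group_carrier alt_group_inv_equality)
  qed
qed

lemma CM_subgroups_A4_C2: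
  assumes config: "sextic_config (alt_group 4 \<times>\<times> integer_mod_group 2) H c"
  shows "CM_subgroups (alt_group 4 \<times>\<times> integer_mod_group 2) H c"
proof (rule sextic_config.CM_subgroups_normal_8[OF config])
  interpret A: group "alt_group 4" by (rule alt_group_is_group)
  interpret Z: group "integer_mod_group 2" by simp
  show "klein_four \<times> carrier (integer_mod_group 2) \<lhd> alt_group 4 \<times>\<times> integer_mod_group 2"
    by (rule A.DirProd_normal[OF group_integer_mod_group klein_four_normal_alt Z.normal_self])
  show "card (klein_four \<times> carrier (integer_mod_group 2)) = 8"
    by (simp add: card_cartesian_product card_klein_four carrier_integer_mod_group)
  show "card (carrier (alt_group 4 \<times>\<times> integer_mod_group 2)) = 24"
    using alt_group_card_carrier[of 4] by (simp add: card_cartesian_product carrier_integer_mod_group fact_numeral)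
qed

section \<open>From the Galois group back to the type of the field\<close>

lemma TR_type_iff: "TR_type F \<longleftrightarrow> totally_imaginary F \<and> \<not> CM_type F"
  by (auto simp: TR_type_def CM_type_def)

lemma Galois_closure_sextic_config:
  assumes "number_field F" "sextic F" "totally_imaginary F" "Galois_closure F L" "represents_conjugation L c"
  obtains H where "sextic_config (Gal L) H c" "CM_type F \<longleftrightarrow> CM_subgroups (Gal L) H c"
proof -
  obtain h where h: "h \<in> ring_hom L complex_field" and c: "c \<in> carrier (Gal L)"
    and hc: "\<And>x. x \<in> carrier L \<Longrightarrow> h (c x) = cnj (h x)"
    using assms(5) by (auto simp: represents_conjugation_def)
  show thesis
  proof (rule CM_type_iff_CM_subgroups[OF assms(1-4) h c hc])
    fix H assume "group (Gal L)" "finite (carrier (Gal L))" "subgroup H (Gal L)"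
      "card (carrier (Gal L)) = 6 * card H" "\<And>V. V \<lhd> Gal L \<Longrightarrow> V \<subseteq> H \<Longrightarrow> V = {\<one>\<^bsub>Gal L\<^esub>}"
      "\<And>g. g \<in> carrier (Gal L) \<Longrightarrow> inv\<^bsub>Gal L\<^esub> g \<otimes>\<^bsub>Gal L\<^esub> c \<otimes>\<^bsub>Gal L\<^esub> g \<notin> H"
      "c \<otimes>\<^bsub>Gal L\<^esub> c = \<one>\<^bsub>Gal L\<^esub>" "CM_type F \<longleftrightarrow> CM_subgroups (Gal L) H c"
    then show thesis using c by (intro that[of H]) (auto intro!: sextic_config.intro sextic_config_axioms.intro)
  qed
qed

lemma represents_conjugation_exists:
  assumes "Galois_closure F L" obtains c where "represents_conjugation L c"
  using conjugation_exists[of L] assms unfolding Galois_closure_def represents_conjugation_def by metis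

lemma CM_type_of_group:
  assumes F: "number_field F" "sextic F" "totally_imaginary F" "Galois_closure F L"
    and iso: "Gal L \<cong> K" and K: "group K"
    and CM: "\<And>H c. sextic_config K H c \<Longrightarrow> CM_subgroups K H c"
  shows "CM_type F"
proof -
  obtain c where c: "represents_conjugation L c" using represents_conjugation_exists[OF F(4)] .
  obtain H where H: "sextic_config (Gal L) H c" "CM_type F \<longleftrightarrow> CM_subgroups (Gal L) H c"
    using Galois_closure_sextic_config[OF F c] .
  obtain \<theta> where \<theta>: "\<theta> \<in> iso (Gal L) K" using iso by (auto simp: is_iso_def)
  show ?thesis using H CM sextic_config.config_iso[OF H(1) \<theta> K] by simp
qed

lemma TR_type_of_group:
  assumes F: "number_field F" "sextic F" "totally_imaginary F" "Galois_closure F L"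
    and iso: "Gal L \<cong> K" and K: "group K"
    and CM: "\<And>H c. sextic_config K H c \<Longrightarrow> \<not> CM_subgroups K H c"
  shows "TR_type F"
proof -
  obtain c where c: "represents_conjugation L c" using represents_conjugation_exists[OF F(4)] .
  obtain H where H: "sextic_config (Gal L) H c" "CM_type F \<longleftrightarrow> CM_subgroups (Gal L) H c"
    using Galois_closure_sextic_config[OF F c] .
  obtain \<theta> where \<theta>: "\<theta> \<in> iso (Gal L) K" using iso by (auto simp: is_iso_def)
  show ?thesis using H CM sextic_config.config_iso[OF H(1) \<theta> K] F(3) by (simp add: TR_type_iff)
qed

text \<open>\<open>(id, 1)\<close> is the only nontrivial central element of S_4 x C_2, so the
  criterion does not depend on the choice of \<theta>.\<close>

lemma CM_type_iff_central:
  assumes F: "number_field F" "sextic F" "totally_imaginary F" "Galois_closure F L"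
    and \<theta>: "\<theta> \<in> iso (Gal L) S4_C2" and c: "represents_conjugation L c"
  shows "CM_type F \<longleftrightarrow> \<theta> c = (id, 1)"
proof -
  obtain H where H: "sextic_config (Gal L) H c" "CM_type F \<longleftrightarrow> CM_subgroups (Gal L) H c"
    using Galois_closure_sextic_config[OF F c] .
  show ?thesis
    using H(2) sextic_config.config_iso[OF H(1) \<theta> S4_C2_group] CM_subgroups_S4_C2_iff by simp
qed

lemma S4_C2_central_order: "(id, 1) \<in> carrier S4_C2" "group.ord S4_C2 (id, 1) = 2"
proof -
  interpret G: group S4_C2 by (rule S4_C2_group)
  show c: "(id, 1) \<in> carrier S4_C2" by (simp add: S4_C2_carrier sym_group_carrier permutes_id del: carrier_DirProd)
  have "(id, 1) [^]\<^bsub>S4_C2\<^esub> (2::nat) = \<one>\<^bsub>S4_C2\<^esub>"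
    by (simp add: numeral_2_eq_2 sym_group_mult sym_group_one)
  then have "G.ord (id, 1) dvd 2" using G.pow_eq_id[OF c] by simp
  moreover have "G.ord (id, 1) \<noteq> 1" using G.ord_eq_1[OF c] by simp
  moreover have "d = 1 \<or> d = 2" if "d dvd 2" for d :: nat
    using that dvd_imp_le[OF that] dvd_pos_nat[OF _ that] by linarith
  ultimately show "group.ord S4_C2 (id, 1) = 2" by metis
qed

section \<open>A generation criterion for S4 x C2\<close>

lemma cycle_of_list_3:
  assumes "distinct [x, y, z]"
  shows "cycle_of_list [x, y, z] w = (if w = x then y else if w = y then z else if w = z then x else w)"
  using assms by (auto simp: transpose_def)

text \<open>The orbit of a moved letter \<open>x\<close> has three elements, which leaves a single
  letter \<open>a\<close>.\<close>

lemma order_three_cycle: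
  assumes p: "p permutes {1..4::nat}" "p \<circ> p \<circ> p = id" "p \<noteq> id"
  obtains x a where "x \<in> {1..4}" "distinct [x, p x, p (p x), a]" "{1..4} = {x, p x, p (p x), a}"
    "p = cycle_of_list [x, p x, p (p x)]"
proof -
  have ppp: "p (p (p i)) = i" for i using fun_cong[OF p(2), of i] by simp
  have in4: "p i \<in> {1..4}" if "i \<in> {1..4}" for i using permutes_in_image[OF p(1)] that by blast
  have out: "p i = i" if "i \<notin> {1..4}" for i using p(1) that by (auto simp: permutes_def)
  have inj: "p i = p j \<longleftrightarrow> i = j" for i j using permutes_inj[OF p(1)] by (auto simp: inj_def)
  obtain x where x: "p x \<noteq> x" using p(3) by (auto simp: fun_eq_iff)
  then have x4: "x \<in> {1..4}" using out by blast
  have d: "distinct [x, p x, p (p x)]" using x ppp inj by auto metis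
  have sub: "{x, p x, p (p x)} \<subseteq> {1..4}" using x4 in4 by blast
  have "card ({1..4} - {x, p x, p (p x)}) = 1" using d sub by (subst card_Diff_subset) auto
  then obtain a where a: "{1..4} - {x, p x, p (p x)} = {a}" by (auto simp: card_1_singleton_iff)
  have pa: "p a = a"
  proof -
    have "a \<in> {1..4} - {x, p x, p (p x)}" unfolding a by simp
    then have a4: "a \<in> {1..4}" "a \<notin> {x, p x, p (p x)}" by blast+
    \<comment> \<open>By injectivity an image in the orbit would put \<open>a\<close> itself into
      the orbit.\<close>
    have "p a \<notin> {x, p x, p (p x)}"
    proof
      assume "p a \<in> {x, p x, p (p x)}"
      then have "p a = p (p (p x)) \<or> p a = p x \<or> p a = p (p x)" using ppp by auto
      then show False using inj a4(2) by auto
    qed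
    then have "p a \<in> {1..4} - {x, p x, p (p x)}" using in4[OF a4(1)] by blast
    then show ?thesis unfolding a by simp
  qed
  show thesis
  proof
    show "x \<in> {1..4}" by (rule x4)
    show "distinct [x, p x, p (p x), a]" using d a by auto
    show all: "{1..4} = {x, p x, p (p x), a}" using sub a by blast
    show "p = cycle_of_list [x, p x, p (p x)]"
    proof
      fix w
      have "p w = w" if "w \<notin> {x, p x, p (p x)}" using that pa out all by (cases "w \<in> {1..4}") auto
      then show "p w = cycle_of_list [x, p x, p (p x)] w"
        unfolding cycle_of_list_3[OF d] using ppp by auto
    qed
  qed
qed

text \<open>On three letters there are just two 3-cycles, and each is the square of the
  other.\<close>

lemma same_support_three_cycles:
  assumes "distinct [u, v, w]" "distinct [x, y, z]" "{x, y, z} = {u, v, w}"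
  shows "cycle_of_list [u, v, w] = cycle_of_list [x, y, z] \<or>
    cycle_of_list [u, v, w] = cycle_of_list [x, y, z] \<circ> cycle_of_list [x, y, z]"
proof -
  have "u \<noteq> v" "v \<noteq> w" "u \<noteq> w" "x \<noteq> y" "y \<noteq> z" "x \<noteq> z" using assms by auto
  note ne = this this[symmetric]
  have "x \<in> {u, v, w}" "y \<in> {u, v, w}" "z \<in> {u, v, w}" using assms(3) by auto
  then consider (rotation) "x = u \<and> y = v \<and> z = w \<or> x = v \<and> y = w \<and> z = u \<or> x = w \<and> y = u \<and> z = v"
    | (inverse) "x = u \<and> y = w \<and> z = v \<or> x = v \<and> y = u \<and> z = w \<or> x = w \<and> y = v \<and> z = u"
    using ne by auto
  then show ?thesis
  proof cases
    case rotation
    then have "cycle_of_list [u, v, w] i = cycle_of_list [x, y, z] i" for i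
      unfolding cycle_of_list_3[OF assms(1)] cycle_of_list_3[OF assms(2)] using ne by (elim disjE) simp_all
    then show ?thesis by blast
  next
    case inverse
    then have "cycle_of_list [u, v, w] i = (cycle_of_list [x, y, z] \<circ> cycle_of_list [x, y, z]) i" for i
      unfolding comp_apply cycle_of_list_3[OF assms(1)] cycle_of_list_3[OF assms(2)] using ne by (elim disjE) simp_all
    then show ?thesis by blast
  qed
qed

text \<open>The 3-cycle \<open>p\<close> is transitive on three letters; \<open>move\<close> makes
  \<open>U\<close> transitive on all four, so conjugates of \<open>p\<close> provide all 3-cycles
  and \<open>U\<close> contains A_4 x {0}. The quotient of S_4 x C_2 by A_4 x {0} is a Klein
  four-group, and the last three hypotheses say that the image of \<open>U\<close> lies in none of
  its three subgroups of order 2.\<close>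

lemma S4_C2_subgroup_eq:
  assumes U: "subgroup U S4_C2" and p: "(p, 0) \<in> U" "p \<circ> p \<circ> p = id" "p \<noteq> id"
    and move: "\<And>a. a \<in> {1..4} \<Longrightarrow> \<exists>(q, e)\<in>U. q a \<noteq> a"
    and odd: "\<exists>(q, e)\<in>U. \<not> evenperm q" and one: "\<exists>(q, e)\<in>U. e = 1"
    and mixed: "\<exists>(q, e)\<in>U. evenperm q \<noteq> (e = 0)"
  shows "U = carrier S4_C2"
proof -
  interpret G: group S4_C2 by (rule S4_C2_group)
  have UG: "q permutes {1..4} \<and> e \<in> {0, 1}" if "(q, e) \<in> U" for q e
    using subgroup.mem_carrier[OF U that] unfolding S4_C2_carrier by (simp add: sym_group_carrier)
  have mult: "(q \<circ> q', (e + e') mod 2) \<in> U" if "(q, e) \<in> U" "(q', e') \<in> U" for q q' e e'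
    using subgroup.m_closed[OF U that] by (simp add: sym_group_mult)
  have hinv: "(inv' q, e) \<in> U" if "(q, e) \<in> U" for q e
    using subgroup.m_inv_closed[OF U that] UG[OF that] S4_C2_inv[of q e] by (simp add: sym_group_carrier)
  have pp: "p permutes {1..4}" using UG[OF p(1)] by simp
  obtain x a where xa: "x \<in> {1..4}" "distinct [x, p x, p (p x), a]" "{1..4} = {x, p x, p (p x), a}"
    "p = cycle_of_list [x, p x, p (p x)]"
    using order_three_cycle[OF pp p(2,3)] by blast
  have ppp: "p (p (p i)) = i" for i using fun_cong[OF p(2), of i] by simp
  have pU: "(p \<circ> q, e) \<in> U" if "(q, e) \<in> U" for q e
    using mult[OF p(1) that] UG[OF that] by auto
  \<comment> \<open>Some element of \<open>U\<close> moves \<open>a\<close> to one of the other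
    three letters, and powers of \<open>p\<close> lead from there to the rest of them.\<close>
  have trans: "\<exists>(g, e)\<in>U. g a = b" if b: "b \<in> {1..4}" for b
  proof (cases "b = a")
    case True
    then show ?thesis using subgroup.one_closed[OF U] by (intro bexI[of _ "(id, 0)"]) (auto simp: sym_group_one)
  next
    case False
    have "a \<in> {1..4}" using xa(3) by blast
    then obtain g e where g: "(g, e) \<in> U" "g a \<noteq> a" using move[of a] by blast
    have "g a \<in> {1..4}" using permutes_in_image[OF conjunct1[OF UG[OF g(1)]]] \<open>a \<in> {1..4}\<close> by blast
    then have "g a \<in> {x, p x, p (p x)}" "b \<in> {x, p x, p (p x)}"
      using g(2) False b unfolding xa(3) by blast+
    then have "b = g a \<or> b = p (g a) \<or> b = p (p (g a))" by (elim insertE emptyE) (simp_all add: ppp)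
    then have "\<exists>q. (q, e) \<in> U \<and> q a = b"
      using g(1) pU[OF g(1)] pU[OF pU[OF g(1)]]
      by (elim disjE) (auto intro: exI[of _ g] exI[of _ "p \<circ> g"] exI[of _ "p \<circ> (p \<circ> g)"])
    then show ?thesis by blast
  qed
  \<comment> \<open>The 3-cycle fixing \<open>b\<close> is obtained by conjugating \<open>p\<close>,
    which fixes \<open>a\<close>, by an element taking \<open>a\<close> to \<open>b\<close>.\<close>
  have three: "(cycle_of_list [u, v, w], 0) \<in> U" if uvw: "distinct [u, v, w]" "{u, v, w} \<subseteq> {1..4}" for u v w
  proof -
    have "card ({1..4} - {u, v, w}) = 1" using uvw by (subst card_Diff_subset) auto
    then obtain b where b: "{1..4} - {u, v, w} = {b}" by (auto simp: card_1_singleton_iff)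
    then have "b \<in> {1..4}" by blast
    then obtain g e where g: "(g, e) \<in> U" "g a = b" using trans by blast
    have gp: "g permutes {1..4}" using UG[OF g(1)] by simp
    have gi: "g i = g j \<longleftrightarrow> i = j" for i j using permutes_inj[OF gp] by (auto simp: inj_def)
    let ?xs = "[g x, g (p x), g (p (p x))]"
    have "g \<circ> p \<circ> inv' g = cycle_of_list ?xs"
    proof -
      have "g \<circ> cycle_of_list [x, p x, p (p x)] \<circ> inv' g = cycle_of_list (map g [x, p x, p (p x)])"
        using xa(2) permutes_bij[OF gp] by (intro conjugation_of_cycle) auto
      then show ?thesis using xa(4) by simp
    qed
    moreover have "(g \<circ> p \<circ> inv' g, (((e + 0) mod 2) + e) mod 2) \<in> U"
      using mult[OF mult[OF g(1) p(1)] hinv[OF g(1)]] .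
    moreover have "(((e + 0) mod 2) + e) mod 2 = 0" using UG[OF g(1)] by auto
    ultimately have c: "(cycle_of_list ?xs, 0) \<in> U" by metis
    have "g ` {1..4} = {1..4}" by (rule permutes_image[OF gp])
    then have "{g x, g (p x), g (p (p x)), b} = {1..4}" unfolding xa(3) image_insert image_empty g(2) .
    moreover have "b \<notin> {g x, g (p x), g (p (p x))}" using xa(2) gi g(2) by auto
    ultimately have "{g x, g (p x), g (p (p x))} = {1..4} - {b}" by blast
    also have "\<dots> = {u, v, w}" using b uvw by blast
    finally have supp: "{g x, g (p x), g (p (p x))} = {u, v, w}" .
    have "distinct ?xs" using xa(2) gi by auto
    from same_support_three_cycles[OF uvw(1) this supp] show ?thesis
      using c mult[OF c c] by (auto simp del: cycle_of_list.simps)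
  qed
  have alt: "(q, 0) \<in> U" if "q permutes {1..4}" "evenperm q" for q
  proof -
    have "q \<in> generate (alt_group 4) (three_cycles 4)"
      using that unfolding alt_group_carrier_as_three_cycles[symmetric] by (simp add: alt_group_carrier)
    then show ?thesis
    proof (induction rule: generate.induct)
      case one
      have "(id, 0) \<in> U" using subgroup.one_closed[OF U] by (simp add: sym_group_one one_DirProd del: id_apply)
      then show ?case by (simp only: alt_group_one)
    next
      case (incl h)
      then obtain cs where cs: "cycle cs" "length cs = 3" "set cs \<subseteq> {1..4}" "h = cycle_of_list cs" by blast
      obtain u v w where "cs = [u, v, w]" using cs(2) stupid_lemma by blast
      then show ?case using three[of u v w] cs by (simp del: cycle_of_list.simps)
    next
      case (inv h)
      then obtain cs where cs: "cycle cs" "length cs = 3" "set cs \<subseteq> {1..4}" "h = cycle_of_list cs" by blast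
      obtain u v w where "cs = [u, v, w]" using cs(2) stupid_lemma by blast
      then have "(h, 0) \<in> U" using three[of u v w] cs by (simp del: cycle_of_list.simps)
      moreover have "h \<in> carrier (alt_group 4)" using inv three_cycles_incl by blast
      ultimately show ?case using hinv alt_group_inv_equality by metis
    next
      case (eng h1 h2)
      have "(h1 \<circ> h2, (0 + 0) mod 2) \<in> U" using mult[OF eng.IH] .
      then show ?case by (simp only: alt_group_mult add_0 mod_0)
    qed
  qed
  \<comment> \<open>Membership in \<open>U\<close> depends only on the class modulo A_4 x {0}, that
    is, on the parity and on the component in C_2.\<close>
  have same: "(q', e) \<in> U" if "(q, e) \<in> U" "q' permutes {1..4}" "evenperm q' = evenperm q" for q q' e
  proof -
    have q: "q permutes {1..4}" using UG[OF that(1)] by simp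
    have perm: "permutation q" "permutation q'" using q that(2) by (auto simp: permutation_permutes)
    have "evenperm (q' \<circ> inv' q)"
      using perm that(3) by (simp add: evenperm_comp permutation_inverse evenperm_inv)
    then have "(q' \<circ> inv' q, 0) \<in> U" using alt permutes_compose[OF permutes_inv[OF q] that(2)] by blast
    from mult[OF this that(1)] have "(q' \<circ> (inv' q \<circ> q), e) \<in> U"
      using UG[OF that(1)] by (auto simp: comp_assoc)
    then show ?thesis using permutes_inv_o(2)[OF q] by simp
  qed
  obtain q1 e1 where u1: "(q1, e1) \<in> U" "\<not> evenperm q1" using odd by blast
  obtain q2 where u2: "(q2, 1) \<in> U" using one by blast
  obtain q3 e3 where u3: "(q3, e3) \<in> U" "evenperm q3 \<noteq> (e3 = 0)" using mixed by blast
  have perm: "permutation q" if "(q, e) \<in> U" for q e using UG[OF that] by (auto simp: permutation_permutes)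
  have ev: "evenperm (q \<circ> q') \<longleftrightarrow> evenperm q = evenperm q'" if "(q, e) \<in> U" "(q', e') \<in> U" for q q' e e'
    using perm[OF that(1)] perm[OF that(2)] by (rule evenperm_comp)
  \<comment> \<open>The three nontrivial classes are reached in turn: odd with 0, even with 1, and
    as their product odd with 1.\<close>
  have odd0: "\<exists>q. (q, 0) \<in> U \<and> \<not> evenperm q"
  proof (cases "e1 = 0")
    case False
    then have e1: "e1 = 1" using UG[OF u1(1)] by auto
    show ?thesis
    proof (cases "evenperm q3")
      case True
      then have "e3 = 1" using u3 UG[OF u3(1)] by auto
      then show ?thesis using mult[OF u1(1) u3(1)] ev[OF u1(1) u3(1)] u1(2) True e1 by (intro exI[of _ "q1 \<circ> q3"]) simp
    next
      case False
      then show ?thesis using u3 by auto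
    qed
  qed (use u1 in auto)
  then obtain q0 where q0: "(q0, 0) \<in> U" "\<not> evenperm q0" by blast
  have "\<exists>q. (q, 1) \<in> U \<and> evenperm q"
  proof (cases "evenperm q2")
    case False
    then show ?thesis using mult[OF q0(1) u2] ev[OF q0(1) u2] q0(2) by (intro exI[of _ "q0 \<circ> q2"]) simp
  qed (use u2 in auto)
  then obtain q4 where q4: "(q4, 1) \<in> U" "evenperm q4" by blast
  have q5: "(q0 \<circ> q4, 1) \<in> U" "\<not> evenperm (q0 \<circ> q4)"
    using mult[OF q0(1) q4(1)] ev[OF q0(1) q4(1)] q0(2) q4(2) by auto
  show ?thesis
  proof
    show "U \<subseteq> carrier S4_C2" by (rule subgroup.subset[OF U])
    show "carrier S4_C2 \<subseteq> U"
    proof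
      fix u assume u: "u \<in> carrier S4_C2"
      obtain q e where qe: "u = (q, e)" by (cases u)
      have q: "q permutes {1..4}" and e: "e = 0 \<or> e = 1"
        using u unfolding qe S4_C2_carrier by (auto simp: sym_group_carrier)
      show "u \<in> U"
        unfolding qe using e same[OF q0(1) q] alt[OF q] same[OF q4(1) q] same[OF q5(1) q] q0(2) q4(2) q5(2)
        by (cases "evenperm q") auto
    qed
  qed
qed

section \<open>Galois extensions inside the complex numbers\<close>

lemma number_field_complex_subfield:
  assumes L: "subfield L complex_field" and fd: "CC.finite_dimension (rat_subfield complex_field) L"
  shows "number_field (complex_field\<lparr>carrier := L\<rparr>)"
proof -
  interpret C: field complex_field by (rule field_complex_field)
  note Q = C.rat_subfield_subfield C.rat_subfield_subset[OF L]
  have LF: "field (complex_field\<lparr>carrier := L\<rparr>)" by (rule CC.subfield_iff(2)[OF L])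
  have fd': "ring.finite_dimension (complex_field\<lparr>carrier := L\<rparr>) (rat_subfield complex_field) L"
    using fd C.dimension_sub[OF L Q] CC.finite_dimension_def ring.finite_dimension_def[OF field.is_ring[OF LF]] by simp
  have "add_pow complex_field n 1 = of_nat n" for n :: nat
  proof (induction n)
    case (Suc n)
    have "add_pow complex_field (Suc n) (1 :: complex) = add_pow complex_field n 1 + 1"
      using CC.add.nat_pow_Suc[of 1 n] by simp
    then show ?case using Suc by simp
  qed simp
  moreover have "add_pow (complex_field\<lparr>carrier := L\<rparr>) n 1 = add_pow complex_field n 1" for n :: nat
    by (simp add: add_pow_def nat_pow_def)
  ultimately show ?thesis
    using LF fd' by (simp add: number_field_def C.rat_subfield_sub[OF L])
qed

lemma rat_subfield_complex: "rat_subfield complex_field \<subseteq> \<rat>"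
proof
  interpret C: field complex_field by (rule field_complex_field)
  fix x assume "x \<in> rat_subfield complex_field"
  then show "x \<in> \<rat>"
    unfolding rat_subfield_def
  proof (induction rule: generate_field.induct)
    case (m_inv h)
    then show ?case by (cases "h = 0") auto
  qed auto
qed

lemma of_int_in_subfield:
  assumes L: "subfield L complex_field" shows "of_int n \<in> L"
proof -
  note L = subringE[OF subfieldE(1)[OF L]]
  have *: "of_nat m \<in> L" for m
    using L(2,3,7) by (induction m) (auto simp: add.commute)
  show ?thesis using *[of "nat n"] L(5)[OF *[of "nat (- n)"]] by (cases "n \<ge> 0") auto
qed

lemma algebraic_over_rat:
  assumes "poly (map_poly of_int q) x = 0" "q \<noteq> (0 :: int poly)"
  shows "(CC.algebraic over rat_subfield complex_field) x"
proof (rule CC.algebraicI)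
  interpret C: field complex_field by (rule field_complex_field)
  let ?q = "map_poly of_int q :: complex poly"
  have q: "?q \<noteq> 0" using assms(2) by (simp add: map_poly_eq_0_iff)
  show "rev (coeffs ?q) \<noteq> []" using q by simp
  have "set (coeffs ?q) \<subseteq> rat_subfield complex_field"
  proof
    fix c assume "c \<in> set (coeffs ?q)"
    then obtain k where "c = coeff ?q k" using range_coeff[of ?q] by blast
    then show "c \<in> rat_subfield complex_field"
      using of_int_in_subfield[OF C.rat_subfield_subfield] by (simp add: coeff_map_poly)
  qed
  moreover have "hd (rev (coeffs ?q)) \<noteq> 0"
    using q by (simp add: hd_rev last_coeffs_eq_coeff_degree)
  ultimately show "rev (coeffs ?q) \<in> carrier (univ_poly complex_field (rat_subfield complex_field))"
    by (simp add: univ_poly_carrier[symmetric] polynomial_def)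
  show "CC.eval (rev (coeffs ?q)) x = \<zero>\<^bsub>complex_field\<^esub>"
    using assms(1) by (simp add: complex_field_eval)
qed

text \<open>All embeddings restrict to automorphisms, which fix \<open>K'\<close>; thus \<open>L\<close> has the same number of
  embeddings over the rational numbers as over \<open>K'\<close>.\<close>

lemma normal_imp_Galois:
  assumes L: "subfield L complex_field" and nf: "number_field (complex_field\<lparr>carrier := L\<rparr>)"
    and normal: "\<And>g. g \<in> ring_hom (complex_field\<lparr>carrier := L\<rparr>) complex_field \<Longrightarrow> g ` L \<subseteq> L"
  shows "Galois_number_field (complex_field\<lparr>carrier := L\<rparr>)"
proof -
  let ?R = "complex_field\<lparr>carrier := L\<rparr>"
  interpret R: field ?R using nf by (rule number_field_field)
  let ?Q = "rat_subfield ?R"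
  define K where "K = {x \<in> carrier ?R. \<forall>\<rho> \<in> carrier (Gal ?R). \<rho> x = x}"
  have Q: "subfield ?Q ?R" by (rule R.rat_subfield_subfield)
  have K: "subfield K ?R" unfolding K_def using R.fixed_points_subfield[of "carrier (Gal ?R)"] Gal_hom by blast
  have QK: "?Q \<subseteq> K" by (rule R.rat_subfield_subset[OF K])
  have KL: "K \<subseteq> L" using subfieldE(3)[OF K] by simp
  have fd: "R.finite_dimension ?Q L" using number_field_finite_dimension[OF nf] by simp
  have LL: "subfield L ?R" using R.carrier_is_subfield by simp
  obtain n where n: "R.dimension n ?Q L" using fd by auto
  obtain m where m: "R.dimension m K L" using R.finite_dimension_over_larger[OF Q K QK LL KL fd] by auto
  have "R.finite_dimension ?Q K"
    using R.subalbegra_incl_imp_finite_dimension[OF Q fd] R.subfield_subalgebra[OF K QK] KL by blast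
  then obtain k where k: "R.dimension k ?Q K" by auto
  have id: "id \<in> ring_hom (?R\<lparr>carrier := A\<rparr>) complex_field" for A by (auto simp: ring_hom_def)
  have aut: "g \<in> carrier (Gal ?R)"
    if g: "g \<in> ring_hom ?R complex_field" "g \<in> extensional L" for g
  proof -
    have gR: "g \<in> ring_hom ?R ?R" using g normal[OF g(1)] by (auto simp: ring_hom_def)
    interpret f: field_hom ?R ?R g
      by unfold_locales (use gR nf in auto)
    have "R.dimension n ?Q (g ` L)"
      using f.dimension_image[OF Q LL, of n] n f.image_rat_subfield QK KL by auto
    then have "g ` L = L" using R.same_dimension_eq[OF Q _ n normal[OF g(1)]] by blast
    then have "bij_betw g L L" using f.f_inj by (simp add: bij_betw_def)
    moreover have "g x = x" if "x \<in> ?Q" for x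
      using R.homs_agree_on_rat_subfield[OF LL _ _ R.field_axioms, of g id x] gR that by (auto simp: ring_hom_def)
    ultimately show ?thesis using gR g(2) by (simp add: Gal_iff)
  qed
  have "embeddings ?R ?Q L id = embeddings ?R K L id"
  proof (intro equalityI subsetI)
    fix g assume "g \<in> embeddings ?R ?Q L id"
    then have g: "g \<in> ring_hom ?R complex_field" "g \<in> extensional L" by (auto simp: embeddings_def)
    then show "g \<in> embeddings ?R K L id" using aut[OF g] by (auto simp: embeddings_def K_def)
  next
    fix g assume "g \<in> embeddings ?R K L id"
    then show "g \<in> embeddings ?R ?Q L id" using QK by (auto simp: embeddings_def)
  qed
  then have "n = m" "n > 0"
    using R.card_embeddings[OF Q LL _ n id] R.card_embeddings[OF K LL KL m id] QK KL by auto
  moreover have "n = k * m" by (rule R.dimension_is_inj[OF Q n R.telescopic_base[OF Q K k m]])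
  ultimately have "k = 1" by simp
  then have "?Q = K" using R.same_dimension_eq[OF Q R.dimension_one[OF Q] _ QK] k by simp
  then show ?thesis using nf unfolding Galois_number_field_def K_def by simp
qed

text \<open>If no element of \<open>M\<close> is a 3-cycle, then \<open>M\<close> contains two different transpositions, whose product is
  a 3-cycle.\<close>

lemma derangement_of_three:
  assumes d: "distinct [x, y, w]" and M: "\<And>f. f \<in> M \<Longrightarrow> f ` {x, y, w} \<subseteq> {x, y, w} \<and> inj_on f {x, y, w}"
    and comp: "\<And>f g. f \<in> M \<Longrightarrow> g \<in> M \<Longrightarrow> \<exists>k\<in>M. \<forall>v\<in>{x, y, w}. k v = f (g v)"
    and move: "\<And>v. v \<in> {x, y, w} \<Longrightarrow> \<exists>f\<in>M. f v \<noteq> v"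
  obtains f where "f \<in> M" "f x \<noteq> x" "f y \<noteq> y" "f w \<noteq> w"
proof -
  have swap: "f u = v \<and> f v = u"
    if f: "f \<in> M" and uvs: "distinct [u, v, s]" "{u, v, s} = {x, y, w}" and "f s = s" "f u \<noteq> u" for f u v s
  proof -
    have mem: "f u \<in> {u, v, s}" "f v \<in> {u, v, s}" and inj: "inj_on f {u, v, s}"
      using M[OF f] unfolding uvs(2)[symmetric] by blast+
    have "f u \<noteq> f s" "f v \<noteq> f s" "f v \<noteq> f u"
      using uvs(1) inj_on_eq_iff[OF inj, of u s] inj_on_eq_iff[OF inj, of v s] inj_on_eq_iff[OF inj, of v u] by auto
    moreover have "f u = u \<or> f u = v \<or> f u = s" "f v = u \<or> f v = v \<or> f v = s" using mem by simp_all
    ultimately show ?thesis using \<open>f s = s\<close> \<open>f u \<noteq> u\<close> by metis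
  qed
  have main: "\<exists>k\<in>M. k u \<noteq> u \<and> k v \<noteq> v \<and> k s \<noteq> s"
    if f: "f \<in> M" and uvs: "distinct [u, v, s]" "{u, v, s} = {x, y, w}" and fs: "f s = s" "f u \<noteq> u" for f u v s
  proof -
    have fuv: "f u = v" "f v = u" using swap[OF that] by blast+
    obtain g where g: "g \<in> M" "g s \<noteq> s" using move[of s] uvs(2) by blast
    obtain k where k: "k \<in> M" "k u = f (g u)" "k v = f (g v)" "k s = f (g s)"
      using comp[OF f g(1)] unfolding uvs(2)[symmetric] by (metis insertI1 insertI2)
    have perm: "distinct [s, v, u]" "{s, v, u} = {x, y, w}" "distinct [s, u, v]" "{s, u, v} = {x, y, w}"
      using uvs(1) unfolding uvs(2)[symmetric] by auto
    consider "g u = u" | "g v = v" | "g u \<noteq> u" "g v \<noteq> v" by blast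
    then show ?thesis
    proof cases
      case 1
      have "g s = v \<and> g v = s" by (rule swap[OF g(1) perm(1,2) 1 g(2)])
      then show ?thesis using k fuv fs 1 uvs(1) by (intro bexI[of _ k]) auto
    next
      case 2
      have "g s = u \<and> g u = s" by (rule swap[OF g(1) perm(3,4) 2 g(2)])
      then show ?thesis using k fuv fs 2 uvs(1) by (intro bexI[of _ k]) auto
    next
      case 3
      then show ?thesis using g by blast
    qed
  qed
  obtain f where f: "f \<in> M" "f x \<noteq> x" using move[of x] by blast
  consider "f y = y" | "f w = w" | "f y \<noteq> y" "f w \<noteq> w" by blast
  then have "\<exists>k\<in>M. k x \<noteq> x \<and> k y \<noteq> y \<and> k w \<noteq> w"
  proof cases
    case 1
    have "\<exists>k\<in>M. k x \<noteq> x \<and> k w \<noteq> w \<and> k y \<noteq> y"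
      by (rule main[OF f(1) _ _ 1 f(2)]) (use d in auto)
    then show ?thesis by blast
  next
    case 2
    show ?thesis by (rule main[OF f(1) _ _ 2 f(2)]) (use d in auto)
  next
    case 3
    then show ?thesis using f by blast
  qed
  then show thesis using that by blast
qed

text \<open>\<open>f\<close> is a function of the three partitions of \<open>{1..4}\<close> into pairs; a permutation fixing none of
  these is a 3-cycle.\<close>

lemma pairing_derangement:
  fixes f :: "nat \<Rightarrow> nat \<Rightarrow> 'a"
  assumes q: "q permutes {1..4}" and sym: "\<And>a b. f a b = f b a"
    and f: "f 3 4 = f 1 2" "f 2 4 = f 1 3" "f 2 3 = f 1 4"
    and ne: "f (q 1) (q 2) \<noteq> f 1 2" "f (q 1) (q 3) \<noteq> f 1 3" "f (q 1) (q 4) \<noteq> f 1 4"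
  shows "q \<circ> q \<circ> q = id" "q \<circ> q \<noteq> id"
proof -
  have "q 1 \<noteq> q 2" "q 1 \<noteq> q 3" "q 1 \<noteq> q 4" "q 2 \<noteq> q 3" "q 2 \<noteq> q 4" "q 3 \<noteq> q 4"
    using permutes_inj[OF q] by (auto simp: inj_eq)
  moreover have "q i \<in> {1..4}" if "i \<in> {1..4}" for i using permutes_in_image[OF q, of i] that by blast
  then have "q 1 = 1 \<or> q 1 = 2 \<or> q 1 = 3 \<or> q 1 = 4" "q 2 = 1 \<or> q 2 = 2 \<or> q 2 = 3 \<or> q 2 = 4"
    "q 3 = 1 \<or> q 3 = 2 \<or> q 3 = 3 \<or> q 3 = 4" "q 4 = 1 \<or> q 4 = 2 \<or> q 4 = 3 \<or> q 4 = 4"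
    unfolding in_1_4[symmetric] by simp_all
  moreover have "f 4 3 = f 1 2" "f 2 1 = f 1 2" "f 4 2 = f 1 3" "f 3 1 = f 1 3" "f 3 2 = f 1 4" "f 4 1 = f 1 4"
    using f sym[of 4 3] sym[of 2 1] sym[of 4 2] sym[of 3 1] sym[of 3 2] sym[of 4 1] by simp_all
  \<comment> \<open>A check over all values of \<open>q\<close>: those at 1 and 2 are split and
    simplified first, so that injectivity discards most cases before those at 3 and 4 are
    considered.\<close>
  ultimately have *: "q (q (q 1)) = 1 \<and> q (q (q 2)) = 2 \<and> q (q (q 3)) = 3 \<and> q (q (q 4)) = 4 \<and>
      (q (q 1) \<noteq> 1 \<or> q (q 2) \<noteq> 2)"
    using f ne
    by - (erule disjE[of "q 1 = 1"]; (erule disjE[of "q 1 = 2"])?; (erule disjE[of "q 1 = 3"])?;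
        erule disjE[of "q 2 = 1"]; (erule disjE[of "q 2 = 2"])?; (erule disjE[of "q 2 = 3"])?; simp;
        (elim disjE; simp))
  have "(q \<circ> q \<circ> q) i = id i" for i
  proof (cases "i \<in> {1..4}")
    case True
    then show ?thesis using * unfolding in_1_4 by auto
  next
    case False
    then show ?thesis using permutes_not_in[OF q] by simp
  qed
  then show "q \<circ> q \<circ> q = id" by blast
  show "q \<circ> q \<noteq> id" using * by (metis comp_apply id_apply)
qed

definition vandermonde :: "(nat \<Rightarrow> complex) \<Rightarrow> complex"
  where "vandermonde t = (t 1 - t 2) * (t 1 - t 3) * (t 1 - t 4) * (t 2 - t 3) * (t 2 - t 4) * (t 3 - t 4)"

lemma vandermonde_permute:
  assumes "q permutes {1..4}"
  shows "vandermonde (t \<circ> q) = of_int (sign q) * vandermonde t"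
proof -
  have "\<forall>t. vandermonde (t \<circ> q) = of_int (sign q) * vandermonde t"
    using assms finite_atLeastAtMost
  proof (induction rule: permutes_induct)
    case id
    then show ?case by (simp add: sign_id)
  next
    case (swap a b q)
    have "vandermonde (t \<circ> transpose a b) = - vandermonde t" for t :: "nat \<Rightarrow> complex"
    proof -
      have "a = 1 \<or> a = 2 \<or> a = 3 \<or> a = 4" "b = 1 \<or> b = 2 \<or> b = 3 \<or> b = 4"
        using swap.hyps(1,2) unfolding in_1_4 .
      then show ?thesis
        unfolding vandermonde_def using swap.hyps(3)
        by (elim disjE) (simp_all add: transpose_def algebra_simps)
    qed
    moreover have "sign (transpose a b \<circ> q) = - sign q"
      using sign_compose[OF permutation_swap_id permutes_imp_permutation[OF finite_atLeastAtMost swap.hyps(4)]]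
        swap.hyps(3) by (simp add: sign_swap_id)
    ultimately show ?case using swap.IH by (simp only: comp_assoc[symmetric]) simp
  qed
  then show ?thesis by blast
qed

section \<open>The field of a quartic with group S4, adjoined an imaginary unit\<close>

text \<open>The \<open>t j\<close> are the roots of \<open>x^4 + p x^2 - x + r\<close>, and the \<open>(t 1 + t j)^2\<close> those of its resolvent
  cubic; both have the discriminant that appears in \<open>disc\<close>. The last assumption makes all nonpositive
  numbers non-roots of the cubic.\<close>

locale quartic =
  fixes t :: "nat \<Rightarrow> complex" and p r :: int
  assumes e1: "t 1 + t 2 + t 3 + t 4 = 0"
    and e2: "t 1 * t 2 + t 1 * t 3 + t 1 * t 4 + t 2 * t 3 + t 2 * t 4 + t 3 * t 4 = of_int p"
    and e3: "t 1 * t 2 * t 3 + t 1 * t 2 * t 4 + t 1 * t 3 * t 4 + t 2 * t 3 * t 4 = 1"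
    and e4: "t 1 * t 2 * t 3 * t 4 = of_int r"
    and no_root: "\<And>n::int. n ^ 4 + p * n\<^sup>2 - n + r \<noteq> 0"
    and no_resolvent_root: "\<And>n::int. n ^ 3 + 2 * p * n\<^sup>2 + (p\<^sup>2 - 4 * r) * n - 1 \<noteq> 0"
    and disc: "\<And>n::int. \<bar>4 * p\<^sup>2 * (p\<^sup>2 - 4 * r)\<^sup>2 - 4 * (p\<^sup>2 - 4 * r) ^ 3 + 32 * p ^ 3 - 36 * p * (p\<^sup>2 - 4 * r) - 27\<bar> \<noteq> n\<^sup>2"
    and signs: "p \<le> 0" "p\<^sup>2 - 4 * r \<ge> 0"
begin

definition D :: int
  where "D = 4 * p\<^sup>2 * (p\<^sup>2 - 4 * r)\<^sup>2 - 4 * (p\<^sup>2 - 4 * r) ^ 3 + 32 * p ^ 3 - 36 * p * (p\<^sup>2 - 4 * r) - 27"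

text \<open>As the four roots have sum 0, the square depends only on the partition of the four
  letters into {a, b} and its complement.\<close>

definition z :: "nat \<Rightarrow> nat \<Rightarrow> complex"
  where "z a b = (t a + t b)\<^sup>2"

lemma t4: "t 4 = - (t 1 + t 2 + t 3)"
  using e1 by (simp add: eq_neg_iff_add_eq_0 algebra_simps)

lemma factor: "x ^ 4 + of_int p * x\<^sup>2 - x + of_int r = (x - t 1) * (x - t 2) * (x - t 3) * (x - t 4)"
proof -
  have "(x - a) * (x - b) * (x - c) * (x - d) = x ^ 4 - (a + b + c + d) * x ^ 3
     + (a * b + a * c + a * d + b * c + b * d + c * d) * x\<^sup>2
     - (a * b * c + a * b * d + a * c * d + b * c * d) * x + a * b * c * d" for a b c d
    by Groebner_Basis.algebra
  from this[of "t 1" "t 2" "t 3" "t 4"] show ?thesis unfolding e1 e2 e3 e4 by simp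
qed

lemma root_iff: "x ^ 4 + of_int p * x\<^sup>2 - x + of_int r = 0 \<longleftrightarrow> (\<exists>j\<in>{1..4}. x = t j)"
  unfolding factor Bex_def in_1_4 by auto

lemma z_pairs: "z 3 4 = z 1 2" "z 2 4 = z 1 3" "z 2 3 = z 1 4" "z a b = z b a"
  unfolding z_def t4 by (simp_all add: power2_eq_square algebra_simps)

text \<open>When the sum of the roots is 0, this product is their third elementary symmetric
  function, which the linear coefficient -1 normalises to 1.\<close>

lemma sums_product: "(t 1 + t 2) * (t 1 + t 3) * (t 1 + t 4) = 1"
proof -
  have "(a + b) * (a + c) * (a + d) = a\<^sup>2 * (a + b + c + d) + (a * b * c + a * b * d + a * c * d + b * c * d)"
    for a b c d :: complex by Groebner_Basis.algebra
  from this[of "t 1" "t 2" "t 3" "t 4"] show ?thesis unfolding e1 e3 by simp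
qed

lemma z_sums:
  "z 1 2 + z 1 3 + z 1 4 = of_int (- 2 * p)"
  "z 1 2 * z 1 3 + z 1 2 * z 1 4 + z 1 3 * z 1 4 = of_int (p\<^sup>2 - 4 * r)"
  "z 1 2 * z 1 3 * z 1 4 = 1"
proof -
  have *: "(a + b)\<^sup>2 + (a + c)\<^sup>2 + (a + d)\<^sup>2 = - 2 * (a * b + a * c + a * d + b * c + b * d + c * d)"
    "(a + b)\<^sup>2 * (a + c)\<^sup>2 + (a + b)\<^sup>2 * (a + d)\<^sup>2 + (a + c)\<^sup>2 * (a + d)\<^sup>2 =
      (a * b + a * c + a * d + b * c + b * d + c * d)\<^sup>2 - 4 * (a * b * c * d)"
    if "a + b + c + d = 0" for a b c d :: complex using that by Groebner_Basis.algebra+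
  show "z 1 2 + z 1 3 + z 1 4 = of_int (- 2 * p)"
    unfolding z_def *(1)[OF e1] e2 by simp
  show "z 1 2 * z 1 3 + z 1 2 * z 1 4 + z 1 3 * z 1 4 = of_int (p\<^sup>2 - 4 * r)"
    unfolding z_def *(2)[OF e1] e2 e4 by simp
  have "z 1 2 * z 1 3 * z 1 4 = ((t 1 + t 2) * (t 1 + t 3) * (t 1 + t 4))\<^sup>2"
    unfolding z_def by (simp only: power_mult_distrib)
  then show "z 1 2 * z 1 3 * z 1 4 = 1" unfolding sums_product by simp
qed

lemma z_resolvent:
  assumes "j \<in> {2..4}"
  shows "z 1 j ^ 3 + of_int (2 * p) * (z 1 j)\<^sup>2 + of_int (p\<^sup>2 - 4 * r) * z 1 j - 1 = 0"
proof -
  have *: "x ^ 3 + of_int (2 * p) * x\<^sup>2 + of_int (p\<^sup>2 - 4 * r) * x - 1 = (x - z 1 2) * (x - z 1 3) * (x - z 1 4)" for x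
  proof -
    have "(x - a) * (x - b) * (x - c) = x ^ 3 - (a + b + c) * x\<^sup>2 + (a * b + a * c + b * c) * x - a * b * c"
      for a b c by Groebner_Basis.algebra
    from this[of "z 1 2" "z 1 3" "z 1 4"] show ?thesis unfolding z_sums by simp
  qed
  moreover have "j = 2 \<or> j = 3 \<or> j = 4" using assms by auto
  ultimately show ?thesis unfolding * by auto
qed

text \<open>The reason why the quartic and its resolvent cubic have the same discriminant; it also
  shows that distinct roots give distinct values of \<open>z\<close>.\<close>

lemma z_differences:
  "z 1 2 - z 1 3 = (t 2 - t 3) * (t 1 - t 4)" "z 1 2 - z 1 4 = (t 2 - t 4) * (t 1 - t 3)"
  "z 1 3 - z 1 4 = (t 3 - t 4) * (t 1 - t 2)"
proof -
  have *: "(a + b)\<^sup>2 - (a + c)\<^sup>2 = (b - c) * (a - d)" if "a + b + c + d = 0" for a b c d :: complex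
    using that by Groebner_Basis.algebra
  show "z 1 2 - z 1 3 = (t 2 - t 3) * (t 1 - t 4)" "z 1 2 - z 1 4 = (t 2 - t 4) * (t 1 - t 3)"
    "z 1 3 - z 1 4 = (t 3 - t 4) * (t 1 - t 2)"
    unfolding z_def by (rule *; use e1 in \<open>simp add: algebra_simps\<close>)+
qed

lemma vandermonde_square: "(vandermonde t)\<^sup>2 = of_int D"
proof -
  have 1: "(vandermonde t)\<^sup>2 = ((z 1 2 - z 1 3) * (z 1 2 - z 1 4) * (z 1 3 - z 1 4))\<^sup>2"
    unfolding vandermonde_def z_differences by (simp add: power_mult_distrib)
  \<comment> \<open>The discriminant of a cubic in terms of the elementary symmetric functions of
    its roots.\<close>
  have *: "((a - b) * (a - c) * (b - c))\<^sup>2 = (a + b + c)\<^sup>2 * (a * b + a * c + b * c)\<^sup>2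
      - 4 * (a * b + a * c + b * c) ^ 3 - 4 * (a + b + c) ^ 3 * (a * b * c)
      + 18 * (a + b + c) * (a * b + a * c + b * c) * (a * b * c) - 27 * (a * b * c)\<^sup>2" for a b c :: complex
    by Groebner_Basis.algebra
  have "((z 1 2 - z 1 3) * (z 1 2 - z 1 4) * (z 1 3 - z 1 4))\<^sup>2 = of_int D"
    unfolding *[of "z 1 2" "z 1 3" "z 1 4"] z_sums D_def by (simp add: power_mult_distrib)
  then show ?thesis unfolding 1 .
qed

lemma D_nonzero: "D \<noteq> 0" "D \<noteq> n\<^sup>2" "- D \<noteq> n\<^sup>2"
proof -
  have *: "\<bar>D\<bar> \<noteq> n\<^sup>2" for n using disc[of n] unfolding D_def .
  show "D \<noteq> 0" using *[of 0] by auto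
  show "D \<noteq> n\<^sup>2" using *[of n] zero_le_power2[of n] by linarith
  show "- D \<noteq> n\<^sup>2" using *[of n] zero_le_power2[of n] by linarith
qed

lemma distinct: "t 1 \<noteq> t 2" "t 1 \<noteq> t 3" "t 1 \<noteq> t 4" "t 2 \<noteq> t 3" "t 2 \<noteq> t 4" "t 3 \<noteq> t 4"
  using vandermonde_square D_nonzero(1) unfolding vandermonde_def by auto

lemma t_inj: "inj_on t {1..4}"
  using distinct unfolding inj_on_def in_1_4 Ball_def by auto

lemma z_distinct: "z 1 2 \<noteq> z 1 3" "z 1 2 \<noteq> z 1 4" "z 1 3 \<noteq> z 1 4" "z 1 2 \<noteq> 0" "z 1 3 \<noteq> 0" "z 1 4 \<noteq> 0"
proof -
  show "z 1 2 \<noteq> z 1 3" "z 1 2 \<noteq> z 1 4" "z 1 3 \<noteq> z 1 4" using distinct z_differences by auto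
  show "z 1 2 \<noteq> 0" "z 1 3 \<noteq> 0" "z 1 4 \<noteq> 0" using z_sums(3) by auto
qed

text \<open>At -s no term of the resolvent cubic is positive, by \<open>signs\<close>, and the
  constant term is -1. It is used to show that no square root of \<open>- z 1 j\<close> is
  real.\<close>

lemma not_nonpos_z: "j \<in> {2..4} \<Longrightarrow> s \<ge> 0 \<Longrightarrow> z 1 j \<noteq> - complex_of_real s"
proof
  assume j: "j \<in> {2..4}" and s: "s \<ge> 0" and z: "z 1 j = - complex_of_real s"
  have "complex_of_real (- (s ^ 3) + of_int (2 * p) * s\<^sup>2 - of_int (p\<^sup>2 - 4 * r) * s - 1) = 0"
    using z_resolvent[OF j] unfolding z by (simp add: power2_eq_square power3_eq_cube)
  then have "- (s ^ 3) + of_int (2 * p) * s\<^sup>2 - of_int (p\<^sup>2 - 4 * r) * s - 1 = 0"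
    unfolding of_real_eq_0_iff .
  moreover have "of_int (2 * p) * s\<^sup>2 \<le> 0" using signs(1) by (simp add: mult_nonpos_nonneg)
  moreover have "of_int (p\<^sup>2 - 4 * r) * s \<ge> 0" using signs(2) s by (intro mult_nonneg_nonneg) (simp_all only: of_int_0_le_iff)
  moreover have "s ^ 3 \<ge> 0" using s by simp
  ultimately show False by linarith
qed

end

section \<open>The splitting field of the quartic, with i adjoined\<close>

context quartic
begin

definition L :: "complex set"
  where "L = CC.finite_extension (rat_subfield complex_field) [t 1, t 2, t 3, t 4, \<i>]"

abbreviation LR :: "complex ring" where "LR \<equiv> complex_field\<lparr>carrier := L\<rparr>"

lemma quartic_root: "j \<in> {1..4} \<Longrightarrow> t j ^ 4 + of_int p * (t j)\<^sup>2 - t j + of_int r = 0"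
  using root_iff[of "t j"] by blast

lemma L_algebraic:
  assumes "x \<in> set [t 1, t 2, t 3, t 4, \<i>]"
  shows "(CC.algebraic over rat_subfield complex_field) x"
proof (cases "x = \<i>")
  case True
  have "map_poly complex_of_int [:1, 0, 1:] = [:1, 0, 1:]" by (simp add: map_poly_pCons)
  then show ?thesis using algebraic_over_rat[of "[:1, 0, 1:]" x] True by simp
next
  case False
  then obtain j where j: "j \<in> {1..4}" "x = t j" using assms unfolding Bex_def in_1_4 by auto
  have "map_poly complex_of_int [:r, -1, p, 0, 1:] = [:of_int r, -1, of_int p, 0, 1:]" by (simp add: map_poly_pCons)
  moreover have "poly [:of_int r, -1, of_int p, 0, 1:] x = 0"
    using quartic_root[OF j(1)] unfolding j(2) by (simp add: power2_eq_square power4_eq_xxxx algebra_simps)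
  ultimately show ?thesis using algebraic_over_rat[of "[:r, -1, p, 0, 1:]" x] by simp
qed

lemma L_subfield: "subfield L complex_field"
  and L_finite_dimension: "CC.finite_dimension (rat_subfield complex_field) L"
proof -
  interpret C: field complex_field by (rule field_complex_field)
  have *: "\<And>x. x \<in> set [t 1, t 2, t 3, t 4, \<i>] \<Longrightarrow> (CC.algebraic over rat_subfield complex_field) x"
    "set [t 1, t 2, t 3, t 4, \<i>] \<subseteq> carrier complex_field"
    using L_algebraic by auto
  show "CC.finite_dimension (rat_subfield complex_field) L"
    unfolding L_def by (rule C.finite_extension_finite_dimension(1)[OF C.rat_subfield_subfield *(2,1)])
  show "subfield L complex_field"
    unfolding L_def by (rule C.finite_extension_is_subfield[OF C.rat_subfield_subfield *(2,1)])
qed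

lemma generators: "j \<in> {1..4} \<Longrightarrow> t j \<in> L" "\<i> \<in> L"
proof -
  interpret C: field complex_field by (rule field_complex_field)
  have "set [t 1, t 2, t 3, t 4, \<i>] \<subseteq> L"
    unfolding L_def
    by (rule C.finite_extension_mem) (auto intro: subfieldE C.rat_subfield_subfield)
  then show "j \<in> {1..4} \<Longrightarrow> t j \<in> L" "\<i> \<in> L" unfolding in_1_4 by auto
qed

text \<open>The way to verify a property on all of \<open>L\<close>: show that it defines a subfield
  containing the generators.\<close>

lemma L_subset:
  assumes E: "subfield E complex_field" and t: "\<And>j. j \<in> {1..4} \<Longrightarrow> t j \<in> E" and i: "\<i> \<in> E"
  shows "L \<subseteq> E"
proof -
  interpret C: field complex_field by (rule field_complex_field)
  show ?thesis
    unfolding L_def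
    by (rule CC.finite_extension_subring_incl)
      (use t[of 1] t[of 2] t[of 3] t[of 4] i C.rat_subfield_subset[OF E] subfieldE(1)[OF E] in auto)
qed

lemma L_number_field: "number_field LR"
  by (rule number_field_complex_subfield[OF L_subfield L_finite_dimension])

lemma L_closed:
  "x \<in> L \<Longrightarrow> y \<in> L \<Longrightarrow> x + y \<in> L" "x \<in> L \<Longrightarrow> y \<in> L \<Longrightarrow> x * y \<in> L" "x \<in> L \<Longrightarrow> - x \<in> L"
  "x \<in> L \<Longrightarrow> y \<in> L \<Longrightarrow> x - y \<in> L" "x \<in> L \<Longrightarrow> x ^ n \<in> L" "of_int k \<in> L" "0 \<in> L" "1 \<in> L"
proof -
  note L = subringE[OF subfieldE(1)[OF L_subfield]]
  show *: "x \<in> L \<Longrightarrow> y \<in> L \<Longrightarrow> x + y \<in> L" "x \<in> L \<Longrightarrow> y \<in> L \<Longrightarrow> x * y \<in> L" "x \<in> L \<Longrightarrow> - x \<in> L" "0 \<in> L" "1 \<in> L"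
    for x y using L(2,3,5,6,7) by auto
  show "x \<in> L \<Longrightarrow> y \<in> L \<Longrightarrow> x - y \<in> L" using *(1)[of x "- y"] *(3)[of y] by simp
  show "x \<in> L \<Longrightarrow> x ^ n \<in> L" using *(2,5) by (induction n) auto
  show "of_int k \<in> L" by (rule of_int_in_subfield[OF L_subfield])
qed

context
  fixes g assumes g: "g \<in> ring_hom LR complex_field"
begin

lemma hom_L:
  "x \<in> L \<Longrightarrow> y \<in> L \<Longrightarrow> g (x + y) = g x + g y" "x \<in> L \<Longrightarrow> y \<in> L \<Longrightarrow> g (x * y) = g x * g y"
  "g 1 = 1" "g 0 = 0" "x \<in> L \<Longrightarrow> g (- x) = - g x" "x \<in> L \<Longrightarrow> y \<in> L \<Longrightarrow> g (x - y) = g x - g y"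
  "x \<in> L \<Longrightarrow> g (x ^ n) = g x ^ n" "g (of_int k) = of_int k"
proof -
  show *: "x \<in> L \<Longrightarrow> y \<in> L \<Longrightarrow> g (x + y) = g x + g y" "x \<in> L \<Longrightarrow> y \<in> L \<Longrightarrow> g (x * y) = g x * g y" "g 1 = 1"
    for x y using ring_hom_memE[OF g] by auto
  show 0: "g 0 = 0" using *(1)[of 0 0] L_closed(7) by simp
  show neg: "x \<in> L \<Longrightarrow> g (- x) = - g x" for x
    using *(1)[of x "- x"] L_closed(3)[of x] 0 by (simp add: eq_neg_iff_add_eq_0 add.commute)
  show "x \<in> L \<Longrightarrow> y \<in> L \<Longrightarrow> g (x - y) = g x - g y"
    using *(1)[of x "- y"] neg[of y] L_closed(3)[of y] by simp
  show "x \<in> L \<Longrightarrow> g (x ^ n) = g x ^ n" using *(2,3) L_closed(5) by (induction n) auto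
  have nat: "g (of_nat m) = of_nat m" for m
    using *(1) 0 *(3) L_closed(6)[of "int _"] L_closed(8) by (induction m) auto
  show "g (of_int k) = of_int k"
    using nat[of "nat k"] nat[of "nat (- k)"] neg[of "of_int k"] L_closed(6)[of k]
    by (cases "k \<ge> 0") (auto simp: minus_equation_iff)
qed

lemma hom_root: "j \<in> {1..4} \<Longrightarrow> \<exists>k\<in>{1..4}. g (t j) = t k"
proof -
  assume j: "j \<in> {1..4}"
  have "g (t j ^ 4 + of_int p * (t j)\<^sup>2 - t j + of_int r) = 0" unfolding quartic_root[OF j] by (rule hom_L(4))
  then have "g (t j) ^ 4 + of_int p * (g (t j))\<^sup>2 - g (t j) + of_int r = 0"
    using generators(1)[OF j] by (simp add: hom_L L_closed)
  then show ?thesis using root_iff by blast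
qed

lemma hom_i: "g \<i> = \<i> \<or> g \<i> = - \<i>"
proof -
  have "g (\<i> * \<i>) = - 1" using hom_L(5)[OF L_closed(8)] hom_L(3) by simp
  then have "g \<i> * g \<i> = - 1" using generators(2) by (simp only: hom_L)
  then have "(g \<i> - \<i>) * (g \<i> + \<i>) = 0" by (simp add: algebra_simps)
  then show ?thesis by (simp add: eq_neg_iff_add_eq_0)
qed

text \<open>The elements of \<open>L\<close> with image in \<open>L\<close> form a subfield; it
  contains the generators, since roots go to roots and i goes to i or -i.\<close>

lemma hom_normal: "g ` L \<subseteq> L"
proof -
  interpret C: field complex_field by (rule field_complex_field)
  note L = subringE[OF subfieldE(1)[OF L_subfield]]
  have inv: "inverse x \<in> L" if "x \<in> L" for x
    using CC.subfield_m_inv(1)[OF L_subfield, of x] that L_closed(7) by (cases "x = 0") auto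
  have "subfield {x \<in> L. g x \<in> L} complex_field"
  proof (rule C.subfieldI'[OF CC.subringI])
    fix x assume x: "x \<in> {x \<in> L. g x \<in> L} - {\<zero>\<^bsub>complex_field\<^esub>}"
    then have "g (x * inverse x) = 1" using hom_L(3) by simp
    moreover have "g (x * inverse x) = g x * g (inverse x)" using x inv by (intro hom_L(2)) auto
    ultimately have "g x * g (inverse x) = 1" by (simp only:)
    then have "g (inverse x) = inverse (g x)" by (simp add: inverse_unique)
    then show "inv\<^bsub>complex_field\<^esub> x \<in> {x \<in> L. g x \<in> L}" using x inv by auto
  qed (auto simp: hom_L L_closed)
  then have "L \<subseteq> {x \<in> L. g x \<in> L}"
  proof (rule L_subset)
    show "t j \<in> {x \<in> L. g x \<in> L}" if "j \<in> {1..4}" for j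
      using hom_root[OF that] generators(1) that by auto
    show "\<i> \<in> {x \<in> L. g x \<in> L}" using hom_i generators(2) L_closed(3) by auto
  qed
  then show ?thesis by blast
qed

end

lemma L_Galois: "Galois_number_field LR"
  by (rule normal_imp_Galois[OF L_subfield L_number_field hom_normal])

end

section \<open>The Galois group acting on the roots and on i\<close>

context quartic
begin

lemma Gal_complex_hom: "\<rho> \<in> carrier (Gal LR) \<Longrightarrow> \<rho> \<in> ring_hom LR complex_field"
  using Gal_hom[of \<rho> LR] by (auto simp: ring_hom_def)

lemmas Gal_L = hom_L[OF Gal_complex_hom]

lemma id_hom: "id \<in> ring_hom LR complex_field"
  by (auto simp: ring_hom_def)

text \<open>Inside the complex numbers the inclusion serves as the chosen embedding, so complex
  conjugation is \<open>cnj\<close> itself.\<close>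

sublocale G: Galois_embedding LR id
  using L_Galois id_hom number_field_field[OF L_number_field]
  by (intro Galois_embedding.intro Galois_embedding_axioms.intro)

text \<open>The identity outside \<open>{1..4}\<close>, as \<open>permutes\<close> demands.\<close>

definition root_perm :: "(complex \<Rightarrow> complex) \<Rightarrow> nat \<Rightarrow> nat"
  where "root_perm \<rho> j = (if j \<in> {1..4} then inv_into {1..4} t (\<rho> (t j)) else j)"

definition \<Phi> :: "(complex \<Rightarrow> complex) \<Rightarrow> (nat \<Rightarrow> nat) \<times> int"
  where "\<Phi> \<rho> = (root_perm \<rho>, if \<rho> \<i> = \<i> then 0 else 1)"

lemma root_perm_apply:
  assumes "\<rho> \<in> carrier (Gal LR)" "j \<in> {1..4}"
  shows "root_perm \<rho> j \<in> {1..4}" "\<rho> (t j) = t (root_perm \<rho> j)"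
proof -
  have "\<rho> (t j) \<in> t ` {1..4}" using hom_root[OF Gal_complex_hom[OF assms(1)] assms(2)] by blast
  then have "inv_into {1..4} t (\<rho> (t j)) \<in> {1..4}" "t (inv_into {1..4} t (\<rho> (t j))) = \<rho> (t j)"
    by (rule inv_into_into, rule f_inv_into_f)
  then show "root_perm \<rho> j \<in> {1..4}" "\<rho> (t j) = t (root_perm \<rho> j)"
    using assms(2) unfolding root_perm_def by simp_all
qed

lemma root_perm_permutes:
  assumes \<rho>: "\<rho> \<in> carrier (Gal LR)" shows "root_perm \<rho> permutes {1..4}"
proof (rule bij_imp_permutes)
  have "inj_on (root_perm \<rho>) {1..4}"
  proof (rule inj_onI)
    fix j k assume jk: "j \<in> {1..4}" "k \<in> {1..4}" "root_perm \<rho> j = root_perm \<rho> k"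
    have "\<rho> (t j) = \<rho> (t k)" using root_perm_apply(2)[OF \<rho> jk(1)] root_perm_apply(2)[OF \<rho> jk(2)] jk(3) by simp
    moreover have "inj_on \<rho> L" using \<rho> by (auto simp: Gal_iff bij_betw_def)
    ultimately have "t j = t k" using generators(1)[OF jk(1)] generators(1)[OF jk(2)] by (auto dest: inj_onD)
    then show "j = k" using t_inj jk(1,2) by (auto dest: inj_onD)
  qed
  moreover have "root_perm \<rho> ` {1..4} \<subseteq> {1..4}" using root_perm_apply(1)[OF \<rho>] by blast
  ultimately show "bij_betw (root_perm \<rho>) {1..4} {1..4}"
    unfolding bij_betw_def using endo_inj_surj[OF finite_atLeastAtMost] by blast
qed (auto simp: root_perm_def)

lemma root_perm_unique:
  assumes \<rho>: "\<rho> \<in> carrier (Gal LR)" and q: "q permutes {1..4}" "\<And>j. j \<in> {1..4} \<Longrightarrow> \<rho> (t j) = t (q j)"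
  shows "root_perm \<rho> = q"
proof
  fix j
  show "root_perm \<rho> j = q j"
  proof (cases "j \<in> {1..4}")
    case True
    have "q j \<in> {1..4}" using permutes_in_image[OF q(1), of j] True by blast
    then show ?thesis
      using root_perm_apply[OF \<rho> True] q(2)[OF True] t_inj by (metis inj_onD)
  next
    case False
    then show ?thesis unfolding root_perm_def permutes_not_in[OF q(1) False] by (simp only: if_False)
  qed
qed

lemma Gal_i: "\<rho> \<in> carrier (Gal LR) \<Longrightarrow> \<rho> \<i> = (if snd (\<Phi> \<rho>) = 0 then \<i> else - \<i>)"
  using hom_i[OF Gal_complex_hom, of \<rho>] by (auto simp: \<Phi>_def)

lemma \<Phi>_closed: "\<rho> \<in> carrier (Gal LR) \<Longrightarrow> \<Phi> \<rho> \<in> carrier S4_C2"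
  unfolding \<Phi>_def S4_C2_carrier using root_perm_permutes by (simp add: sym_group_carrier)

lemma \<Phi>_mult:
  assumes \<rho>: "\<rho> \<in> carrier (Gal LR)" and \<tau>: "\<tau> \<in> carrier (Gal LR)"
  shows "\<Phi> (\<rho> \<otimes>\<^bsub>Gal LR\<^esub> \<tau>) = \<Phi> \<rho> \<otimes>\<^bsub>S4_C2\<^esub> \<Phi> \<tau>"
proof -
  have \<rho>\<tau>: "\<rho> \<otimes>\<^bsub>Gal LR\<^esub> \<tau> \<in> carrier (Gal LR)" using \<rho> \<tau> by (rule G.G.m_closed)
  have ap: "(\<rho> \<otimes>\<^bsub>Gal LR\<^esub> \<tau>) x = \<rho> (\<tau> x)" if "x \<in> L" for x using Gal_mult_apply[OF \<rho> \<tau>] that by simp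
  have "root_perm (\<rho> \<otimes>\<^bsub>Gal LR\<^esub> \<tau>) = root_perm \<rho> \<circ> root_perm \<tau>"
  proof (rule root_perm_unique[OF \<rho>\<tau> permutes_compose[OF root_perm_permutes[OF \<tau>] root_perm_permutes[OF \<rho>]]])
    fix j :: nat assume j: "j \<in> {1..4}"
    show "(\<rho> \<otimes>\<^bsub>Gal LR\<^esub> \<tau>) (t j) = t ((root_perm \<rho> \<circ> root_perm \<tau>) j)"
      unfolding ap[OF generators(1)[OF j]] root_perm_apply(2)[OF \<tau> j]
        root_perm_apply(2)[OF \<rho> root_perm_apply(1)[OF \<tau> j]] by simp
  qed
  moreover have "(\<rho> \<otimes>\<^bsub>Gal LR\<^esub> \<tau>) \<i> = (if \<tau> \<i> = \<i> then \<rho> \<i> else - \<rho> \<i>)"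
    using ap[OF generators(2)] hom_i[OF Gal_complex_hom[OF \<tau>]] Gal_L(5)[OF \<rho> generators(2)] by auto
  ultimately show ?thesis
    unfolding \<Phi>_def S4_C2_mult sym_group_mult using hom_i[OF Gal_complex_hom[OF \<rho>]] by auto
qed

lemma \<Phi>_group_hom: "group_hom (Gal LR) S4_C2 \<Phi>"
  using \<Phi>_closed \<Phi>_mult by (intro group_hom.intro group_hom_axioms.intro G.G.group_axioms S4_C2_group) (auto simp: hom_def)

lemma fixes_generators:
  assumes \<rho>: "\<rho> \<in> carrier (Gal LR)" and "\<And>j. j \<in> {1..4} \<Longrightarrow> \<rho> (t j) = t j" "\<rho> \<i> = \<i>"
  shows "\<rho> = \<one>\<^bsub>Gal LR\<^esub>"
proof (rule Gal_eqI[OF \<rho> G.G.one_closed])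
  interpret C: field complex_field by (rule field_complex_field)
  have "subfield {x \<in> carrier LR. \<forall>\<tau>\<in>{\<rho>}. \<tau> x = x} LR"
    by (rule G.fixed_points_subfield) (use Gal_hom[OF \<rho>] in auto)
  then have "subfield {x \<in> L. \<rho> x = x} complex_field" using C.subfield_sub_iff[OF L_subfield] by simp
  then have "L \<subseteq> {x \<in> L. \<rho> x = x}" by (rule L_subset) (use assms generators in auto)
  then show "\<rho> x = \<one>\<^bsub>Gal LR\<^esub> x" if "x \<in> carrier LR" for x using that by (auto simp: Gal_one)
qed

lemma \<Phi>_inj: "inj_on \<Phi> (carrier (Gal LR))"
proof -
  interpret \<Phi>: group_hom "Gal LR" S4_C2 \<Phi> by (rule \<Phi>_group_hom)
  show ?thesis
  proof (rule \<Phi>.trivial_ker_imp_inj)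
    have "\<rho> = \<one>\<^bsub>Gal LR\<^esub>" if \<rho>: "\<rho> \<in> carrier (Gal LR)" "\<Phi> \<rho> = \<one>\<^bsub>S4_C2\<^esub>" for \<rho>
    proof (rule fixes_generators[OF \<rho>(1)])
      have *: "root_perm \<rho> = id" "\<rho> \<i> = \<i>"
        using \<rho>(2) unfolding \<Phi>_def by (simp_all add: one_DirProd sym_group_one split: if_splits)
      show "\<rho> \<i> = \<i>" by (rule *(2))
      show "\<rho> (t j) = t j" if "j \<in> {1..4}" for j using root_perm_apply(2)[OF \<rho>(1) that] *(1) by simp
    qed
    then show "kernel (Gal LR) S4_C2 \<Phi> = {\<one>\<^bsub>Gal LR\<^esub>}" unfolding kernel_def using \<Phi>.hom_one by auto
  qed
qed

text \<open>An element fixed by the group is rational, and a rational number that is a root of a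
  monic integer polynomial is an integer. Therefore the assumptions of the locale speak of integers
  only.\<close>

lemma fixed_integral:
  assumes "x \<in> L" "\<And>\<rho>. \<rho> \<in> carrier (Gal LR) \<Longrightarrow> \<rho> x = x" "poly (map_poly of_int q) x = 0" "lead_coeff q = 1"
  obtains n where "x = of_int n"
proof -
  interpret C: field complex_field by (rule field_complex_field)
  have "x \<in> rat_subfield LR" using assms(1,2) unfolding G.fixed_by_G[symmetric] G.fixed_by_def by simp
  then have "x \<in> \<rat>" using rat_subfield_complex C.rat_subfield_sub[OF L_subfield] by auto
  moreover have "algebraic_int x" using assms(3,4) by (auto simp: algebraic_int_altdef_ipoly)
  ultimately have "x \<in> \<int>" by (rule rational_algebraic_int_is_int[rotated])
  then show thesis using that by (auto elim: Ints_cases)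
qed

lemma z_L: "a \<in> {1..4} \<Longrightarrow> b \<in> {1..4} \<Longrightarrow> z a b \<in> L"
  unfolding z_def using generators(1) by (intro L_closed)

lemma Gal_z:
  assumes \<rho>: "\<rho> \<in> carrier (Gal LR)" and "a \<in> {1..4}" "b \<in> {1..4}"
  shows "\<rho> (z a b) = z (root_perm \<rho> a) (root_perm \<rho> b)"
  using assms generators(1) root_perm_apply(2)[OF \<rho>]
  unfolding z_def by (simp add: Gal_L(1,7)[OF \<rho>] L_closed del: atLeastAtMost_iff)

lemma vandermonde_L: "vandermonde t \<in> L"
  unfolding vandermonde_def using generators(1)[unfolded in_1_4] by (intro L_closed) auto

lemma Gal_vandermonde:
  assumes \<rho>: "\<rho> \<in> carrier (Gal LR)"
  shows "\<rho> (vandermonde t) = of_int (sign (root_perm \<rho>)) * vandermonde t"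
proof -
  have "\<rho> (vandermonde t) = vandermonde (t \<circ> root_perm \<rho>)"
    using generators(1)[unfolded in_1_4] root_perm_apply(2)[OF \<rho>, unfolded in_1_4]
    unfolding vandermonde_def by (simp add: Gal_L(2,6)[OF \<rho>] L_closed)
  then show ?thesis using vandermonde_permute[OF root_perm_permutes[OF \<rho>], of t] by simp
qed

end

section \<open>Surjectivity onto S_4 x C_2\<close>

context quartic
begin

lemma not_all_fix_root:
  assumes "j \<in> {1..4}" shows "\<exists>\<rho>\<in>carrier (Gal LR). \<rho> (t j) \<noteq> t j"
proof (rule ccontr)
  assume no: "\<not> ?thesis"
  have *: "map_poly complex_of_int [:r, -1, p, 0, 1:] = [:of_int r, -1, of_int p, 0, 1:]" by (simp add: map_poly_pCons)
  obtain n where "t j = of_int n"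
  proof (rule fixed_integral[of "t j" "[:r, -1, p, 0, 1:]"])
    show "poly (map_poly complex_of_int [:r, -1, p, 0, 1:]) (t j) = 0"
      using quartic_root[OF assms] unfolding * by (simp add: power2_eq_square power4_eq_xxxx algebra_simps)
  qed (use no generators(1)[OF assms] in auto)
  then have "complex_of_int (n ^ 4 + p * n\<^sup>2 - n + r) = 0" using quartic_root[OF assms] by simp
  then show False using no_root unfolding of_int_eq_0_iff by blast
qed

lemma not_all_fix_z:
  assumes j: "j \<in> {2..4}" shows "\<exists>\<rho>\<in>carrier (Gal LR). \<rho> (z 1 j) \<noteq> z 1 j"
proof (rule ccontr)
  assume no: "\<not> ?thesis"
  let ?q = "[:-1, p\<^sup>2 - 4 * r, 2 * p, 1:]"
  have *: "map_poly complex_of_int ?q = [:-1, of_int (p\<^sup>2 - 4 * r), of_int (2 * p), 1:]"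
    by (simp add: map_poly_pCons)
  obtain n where "z 1 j = of_int n"
  proof (rule fixed_integral[of "z 1 j" ?q])
    show "poly (map_poly complex_of_int ?q) (z 1 j) = 0"
      using z_resolvent[OF j] unfolding * by (simp add: power2_eq_square power3_eq_cube algebra_simps)
    show "z 1 j \<in> L" using j by (intro z_L) auto
  qed (use no in auto)
  then have "complex_of_int (n ^ 3 + 2 * p * n\<^sup>2 + (p\<^sup>2 - 4 * r) * n - 1) = 0" using z_resolvent[OF j] by simp
  then show False using no_resolvent_root unfolding of_int_eq_0_iff by blast
qed

lemma not_all_fix_root_of_square:
  assumes x: "x \<in> L" "x\<^sup>2 = of_int d" and d: "\<And>n::int. d \<noteq> n\<^sup>2"
  shows "\<exists>\<rho>\<in>carrier (Gal LR). \<rho> x \<noteq> x"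
proof (rule ccontr)
  assume no: "\<not> ?thesis"
  have *: "map_poly complex_of_int [:- d, 0, 1:] = [:- of_int d, 0, 1:]" by (simp add: map_poly_pCons)
  obtain n where "x = of_int n"
  proof (rule fixed_integral[of x "[:- d, 0, 1:]"])
    show "poly (map_poly complex_of_int [:- d, 0, 1:]) x = 0"
      using x(2) unfolding * by (simp add: power2_eq_square algebra_simps)
  qed (use no x(1) in auto)
  then have "complex_of_int d = of_int (n\<^sup>2)" using x(2) by simp
  then show False using d unfolding of_int_eq_iff by blast
qed

text \<open>The hypotheses of \<open>S4_C2_subgroup_eq\<close> hold because certain numbers are not
  integers. The values of \<open>z\<close> provide a 3-cycle, the roots show that every letter is
  moved, and the three index 2 subgroups are excluded by the square roots
  \<open>vandermonde t\<close>, i and their product, with squares \<open>D\<close>, -1 and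
  \<open>- D\<close>.\<close>

lemma \<Phi>_surj: "\<Phi> ` carrier (Gal LR) = carrier S4_C2"
proof -
  interpret \<Phi>: group_hom "Gal LR" S4_C2 \<Phi> by (rule \<Phi>_group_hom)
  let ?U = "\<Phi> ` carrier (Gal LR)"
  have vn: "vandermonde t \<noteq> 0" using vandermonde_square D_nonzero(1) by auto
  have sgn: "\<rho> (vandermonde t) = (if evenperm (root_perm \<rho>) then vandermonde t else - vandermonde t)"
    if "\<rho> \<in> carrier (Gal LR)" for \<rho> using Gal_vandermonde[OF that] by (simp add: sign_def)
  have zs: "{z 1 2, z 1 3, z 1 4} = {z a b |a b. a \<in> {1..4} \<and> b \<in> {1..4} \<and> a \<noteq> b}"
  proof (intro equalityI subsetI)
    fix x assume "x \<in> {z 1 2, z 1 3, z 1 4}"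
    then consider "x = z 1 2" | "x = z 1 3" | "x = z 1 4" by blast
    then show "x \<in> {z a b |a b. a \<in> {1..4} \<and> b \<in> {1..4} \<and> a \<noteq> b}" by cases force+
  next
    fix x assume "x \<in> {z a b |a b. a \<in> {1..4} \<and> b \<in> {1..4} \<and> a \<noteq> b}"
    then obtain a b where ab: "x = z a b" "a \<in> {1..4}" "b \<in> {1..4}" "a \<noteq> b" by blast
    show "x \<in> {z 1 2, z 1 3, z 1 4}"
      using ab(4) ab(2,3)[unfolded in_1_4] z_pairs(1-3) z_pairs(4)[of a b] unfolding ab(1) by auto
  qed
  \<comment> \<open>No \<open>z 1 j\<close> is fixed by the whole group, so some element moves all
    three; on the roots it is a 3-cycle.\<close>
  obtain \<rho> where \<rho>: "\<rho> \<in> carrier (Gal LR)" "\<rho> (z 1 2) \<noteq> z 1 2" "\<rho> (z 1 3) \<noteq> z 1 3" "\<rho> (z 1 4) \<noteq> z 1 4"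
  proof (rule derangement_of_three[of "z 1 2" "z 1 3" "z 1 4" "carrier (Gal LR)"])
    show "distinct [z 1 2, z 1 3, z 1 4]" using z_distinct by simp
    have zL: "{z 1 2, z 1 3, z 1 4} \<subseteq> L" using z_L by auto
    show "f ` {z 1 2, z 1 3, z 1 4} \<subseteq> {z 1 2, z 1 3, z 1 4} \<and> inj_on f {z 1 2, z 1 3, z 1 4}"
      if f: "f \<in> carrier (Gal LR)" for f
    proof
      have "inj_on f L" using f by (auto simp: Gal_iff bij_betw_def)
      then show "inj_on f {z 1 2, z 1 3, z 1 4}" using zL by (rule inj_on_subset)
      have "inj (root_perm f)" by (rule permutes_inj[OF root_perm_permutes[OF f]])
      then have "root_perm f a \<noteq> root_perm f b" if "a \<noteq> b" for a b using that by (simp add: inj_eq)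
      then have "f (z a b) \<in> {z a b |a b. a \<in> {1..4} \<and> b \<in> {1..4} \<and> a \<noteq> b}"
        if "a \<in> {1..4}" "b \<in> {1..4}" "a \<noteq> b" for a b
        unfolding Gal_z[OF f that(1,2)] using root_perm_apply(1)[OF f that(1)] root_perm_apply(1)[OF f that(2)] that(3) by blast
      then show "f ` {z 1 2, z 1 3, z 1 4} \<subseteq> {z 1 2, z 1 3, z 1 4}" unfolding zs by blast
    qed
    show "\<exists>k\<in>carrier (Gal LR). \<forall>v\<in>{z 1 2, z 1 3, z 1 4}. k v = f (g v)"
      if "f \<in> carrier (Gal LR)" "g \<in> carrier (Gal LR)" for f g
      using Gal_mult_apply[OF that] G.G.m_closed[OF that] zL by (intro bexI[of _ "f \<otimes>\<^bsub>Gal LR\<^esub> g"]) auto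
    show "\<exists>f\<in>carrier (Gal LR). f v \<noteq> v" if "v \<in> {z 1 2, z 1 3, z 1 4}" for v
      using that not_all_fix_z[of 2] not_all_fix_z[of 3] not_all_fix_z[of 4] by auto
  qed
  let ?q = "root_perm \<rho>"
  have q3: "?q \<circ> ?q \<circ> ?q = id" "?q \<circ> ?q \<noteq> id"
    using pairing_derangement[of ?q z, OF root_perm_permutes[OF \<rho>(1)] z_pairs(4,1-3)]
      \<rho>(2-4) Gal_z[OF \<rho>(1)] by simp_all
  show ?thesis
  proof (rule S4_C2_subgroup_eq)
    show "subgroup ?U S4_C2" by (rule \<Phi>.img_is_subgroup)
    \<comment> \<open>Squaring makes the component in C_2 vanish, and the square of a 3-cycle is
      again a 3-cycle.\<close>
    have "\<Phi> (\<rho> \<otimes>\<^bsub>Gal LR\<^esub> \<rho>) = (?q \<circ> ?q, 0)"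
      unfolding \<Phi>_mult[OF \<rho>(1) \<rho>(1)] unfolding \<Phi>_def S4_C2_mult sym_group_mult by simp
    then show "(?q \<circ> ?q, 0) \<in> ?U" using G.G.m_closed[OF \<rho>(1) \<rho>(1)] by (metis image_eqI)
    have ppp: "?q (?q (?q a)) = a" for a using fun_cong[OF q3(1), of a] by simp
    show "?q \<circ> ?q \<circ> (?q \<circ> ?q) \<circ> (?q \<circ> ?q) = id" by (rule ext) (simp add: ppp)
    show "?q \<circ> ?q \<noteq> id" by (rule q3(2))
    have mem: "(root_perm \<tau>, if \<tau> \<i> = \<i> then 0 else 1) \<in> ?U" if "\<tau> \<in> carrier (Gal LR)" for \<tau>
      using that by (metis \<Phi>_def image_eqI)
    show "\<exists>(q, e)\<in>?U. q a \<noteq> a" if a: "a \<in> {1..4}" for a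
    proof -
      obtain \<tau> where \<tau>: "\<tau> \<in> carrier (Gal LR)" "\<tau> (t a) \<noteq> t a" using not_all_fix_root[OF a] by blast
      then have "root_perm \<tau> a \<noteq> a" using root_perm_apply(2)[OF \<tau>(1) a] by metis
      then show ?thesis using mem[OF \<tau>(1)] by blast
    qed
    obtain \<tau> where \<tau>: "\<tau> \<in> carrier (Gal LR)" "\<tau> (vandermonde t) \<noteq> vandermonde t"
      using not_all_fix_root_of_square[OF vandermonde_L vandermonde_square D_nonzero(2)] by blast
    then have "\<not> evenperm (root_perm \<tau>)" using sgn[OF \<tau>(1)] by auto
    then show "\<exists>(q, e)\<in>?U. \<not> evenperm q" using mem[OF \<tau>(1)] by blast
    have "(- 1::int) \<noteq> n\<^sup>2" for n using zero_le_power2[of n] by linarith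
    then obtain \<tau> where \<tau>: "\<tau> \<in> carrier (Gal LR)" "\<tau> \<i> \<noteq> \<i>"
      using not_all_fix_root_of_square[OF generators(2), of "- 1"] by auto
    show "\<exists>(q, e)\<in>?U. e = 1" using mem[OF \<tau>(1)] unfolding if_not_P[OF \<tau>(2)] by blast
    have "(\<i> * vandermonde t)\<^sup>2 = of_int (- D)" by (simp add: power_mult_distrib vandermonde_square)
    then obtain \<tau> where \<tau>: "\<tau> \<in> carrier (Gal LR)" "\<tau> (\<i> * vandermonde t) \<noteq> \<i> * vandermonde t"
      using not_all_fix_root_of_square[OF L_closed(2)[OF generators(2) vandermonde_L] _ D_nonzero(3)] by blast
    then have ne: "\<tau> \<i> * \<tau> (vandermonde t) \<noteq> \<i> * vandermonde t"
      using Gal_L(2)[OF \<tau>(1) generators(2) vandermonde_L] by simp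
    \<comment> \<open>The product of i and \<open>vandermonde t\<close> changes sign iff exactly one
      of the two factors does.\<close>
    have "evenperm (root_perm \<tau>) \<noteq> ((if \<tau> \<i> = \<i> then 0 else 1::int) = 0)"
      using ne sgn[OF \<tau>(1)] hom_i[OF Gal_complex_hom[OF \<tau>(1)]] by (auto split: if_splits)
    then show "\<exists>(q, e)\<in>?U. evenperm q \<noteq> (e = 0)" using mem[OF \<tau>(1)] by blast
  qed
qed

lemma \<Phi>_iso: "\<Phi> \<in> iso (Gal LR) S4_C2"
  using \<Phi>_closed \<Phi>_mult \<Phi>_inj \<Phi>_surj by (auto simp: iso_def hom_def bij_betw_def)

end

section \<open>The sextic field and its Galois closure\<close>

context quartic
begin

definition \<alpha> :: "nat \<Rightarrow> complex" where "\<alpha> j = \<i> * (t 1 + t j)"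

definition H where "H = G.stab {\<alpha> 2}"

text \<open>The field generated by \<open>\<alpha> 2\<close> over the rationals; as a fixed field it
  has the stabiliser \<open>H\<close> at once.\<close>

definition F :: "complex set" where "F = G.fixed_by H"

abbreviation FR :: "complex ring" where "FR \<equiv> complex_field\<lparr>carrier := F\<rparr>"

lemma \<alpha>_square: "(\<alpha> j)\<^sup>2 = - z 1 j"
  by (simp add: \<alpha>_def z_def power_mult_distrib)

lemma \<alpha>_L: "j \<in> {2..4} \<Longrightarrow> \<alpha> j \<in> L"
  unfolding \<alpha>_def using generators(1)[of 1] generators(1)[of j] generators(2) by (intro L_closed) auto

text \<open>The group permutes the three values of \<open>z\<close>, and the squares of the
  \<open>\<alpha> j\<close> are their negatives.\<close>

lemma Gal_\<alpha>:
  assumes \<rho>: "\<rho> \<in> carrier (Gal LR)" shows "\<exists>j\<in>{2..4}. \<rho> (\<alpha> 2) = \<alpha> j \<or> \<rho> (\<alpha> 2) = - \<alpha> j"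
proof -
  have "\<rho> (\<alpha> 2) ^ 2 = \<rho> ((\<alpha> 2)\<^sup>2)" using Gal_L(7)[OF \<rho> \<alpha>_L] by simp
  also have "\<dots> = - \<rho> (z 1 2)" unfolding \<alpha>_square using Gal_L(5)[OF \<rho> z_L] by simp
  also have "\<dots> = - z (root_perm \<rho> 1) (root_perm \<rho> 2)" using Gal_z[OF \<rho>, of 1 2] by simp
  finally have *: "\<rho> (\<alpha> 2) ^ 2 = - z (root_perm \<rho> 1) (root_perm \<rho> 2)" .
  have "root_perm \<rho> 1 \<noteq> root_perm \<rho> 2" using permutes_inj[OF root_perm_permutes[OF \<rho>]] by (simp add: inj_eq)
  moreover have "root_perm \<rho> 1 \<in> {1..4}" "root_perm \<rho> 2 \<in> {1..4}" using root_perm_apply(1)[OF \<rho>] by simp_all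
  ultimately have "z (root_perm \<rho> 1) (root_perm \<rho> 2) \<in> {z 1 2, z 1 3, z 1 4}"
    unfolding in_1_4 using z_pairs(1-3) z_pairs(4)[of "root_perm \<rho> 1" "root_perm \<rho> 2"] by auto
  then have "\<exists>j\<in>{2..4}. \<rho> (\<alpha> 2) ^ 2 = (\<alpha> j)\<^sup>2"
    unfolding * \<alpha>_square by (auto intro: bexI[of _ 2] bexI[of _ 3] bexI[of _ 4])
  then show ?thesis unfolding power2_eq_iff by blast
qed

lemma orbit_\<alpha>:
  assumes "j \<in> {2..4}"
  shows "\<exists>\<rho>\<in>carrier (Gal LR). \<rho> (\<alpha> 2) = \<alpha> j" "\<exists>\<rho>\<in>carrier (Gal LR). \<rho> (\<alpha> 2) = - \<alpha> j"
proof -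
  \<comment> \<open>The transposition of 2 and \<open>j\<close>, the identity for
    \<open>j = 2\<close>, fixes 1 and takes 2 to \<open>j\<close>; the component in C_2 is free and
    chooses the sign. Both choices exist by surjectivity of \<Phi>.\<close>
  have j: "j \<in> {1..4}" "j \<noteq> 1" "transpose 2 j 1 = 1" "transpose 2 j 2 = j" using assms by (auto simp: transpose_def)
  have q: "transpose 2 j permutes {1..4}" using assms by (intro permutes_swap_id) auto
  have "\<exists>\<rho>\<in>carrier (Gal LR). \<rho> (\<alpha> 2) = s * \<alpha> j" if e: "e = 0 \<and> s = 1 \<or> e = 1 \<and> s = - 1" for e :: int and s
  proof -
    have "(transpose 2 j, e) \<in> carrier S4_C2" unfolding S4_C2_carrier using q e by (auto simp: sym_group_carrier)
    then obtain \<rho> where \<rho>': "(transpose 2 j, e) = \<Phi> \<rho>" and \<rho>: "\<rho> \<in> carrier (Gal LR)"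
      unfolding \<Phi>_surj[symmetric] by (rule imageE)
    have r: "root_perm \<rho> = transpose 2 j" using \<rho>' unfolding \<Phi>_def by simp
    have i: "\<rho> \<i> = s * \<i>" using Gal_i[OF \<rho>] e unfolding \<rho>'[symmetric] by auto
    have tt: "\<rho> (t 1 + t 2) = t 1 + t j"
      using Gal_L(1)[OF \<rho> generators(1)[of 1] generators(1)[of 2]]
        root_perm_apply(2)[OF \<rho>, of 1] root_perm_apply(2)[OF \<rho>, of 2] j(3,4) unfolding r by simp
    have "\<rho> (\<alpha> 2) = \<rho> \<i> * \<rho> (t 1 + t 2)"
      unfolding \<alpha>_def using Gal_L(2)[OF \<rho> generators(2) L_closed(1)[OF generators(1)[of 1] generators(1)[of 2]]] by simp
    then show ?thesis using \<rho> unfolding i tt \<alpha>_def by (intro bexI[of _ \<rho>]) (auto simp: mult.assoc)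
  qed
  from this[of 0 1] this[of 1 "- 1"] show "\<exists>\<rho>\<in>carrier (Gal LR). \<rho> (\<alpha> 2) = \<alpha> j"
    "\<exists>\<rho>\<in>carrier (Gal LR). \<rho> (\<alpha> 2) = - \<alpha> j" by auto
qed

text \<open>Orbit-stabiliser theorem for \<open>\<alpha> 2\<close>, whose orbit consists of the six
  numbers \<open>\<alpha> j\<close> and \<open>- \<alpha> j\<close>.\<close>

lemma card_Gal: "card (carrier (Gal LR)) = 6 * card H"
proof -
  have "group_hom (Gal LR) (BijGroup (carrier LR)) (\<lambda>\<rho>. \<rho>)"
    by (intro group_hom.intro group_hom_axioms.intro G.G.group_axioms group_BijGroup)
      (auto simp: hom_def Gal_def BijGroup_def)
  then interpret A: group_action "Gal LR" "carrier LR" "\<lambda>\<rho>. \<rho>" by (rule group_action.intro)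
  have a2: "\<alpha> 2 \<in> carrier LR" using \<alpha>_L[of 2] by simp
  have "card (orbit (Gal LR) (\<lambda>\<rho>. \<rho>) (\<alpha> 2)) * card (stabilizer (Gal LR) (\<lambda>\<rho>. \<rho>) (\<alpha> 2)) = card (carrier (Gal LR))"
    using A.orbit_stabilizer_theorem[OF a2] by (simp add: Coset.order_def)
  moreover have "stabilizer (Gal LR) (\<lambda>\<rho>. \<rho>) (\<alpha> 2) = H"
    by (auto simp: stabilizer_def H_def G.stab_def)
  moreover have "orbit (Gal LR) (\<lambda>\<rho>. \<rho>) (\<alpha> 2) = {\<alpha> 2, \<alpha> 3, \<alpha> 4, - \<alpha> 2, - \<alpha> 3, - \<alpha> 4}" (is "_ = ?O")
  proof (intro equalityI subsetI)
    fix x assume "x \<in> orbit (Gal LR) (\<lambda>\<rho>. \<rho>) (\<alpha> 2)"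
    then obtain \<rho> where \<rho>: "\<rho> \<in> carrier (Gal LR)" "x = \<rho> (\<alpha> 2)" by (auto simp: orbit_def)
    obtain j where j: "j \<in> {2..4}" "x = \<alpha> j \<or> x = - \<alpha> j" using Gal_\<alpha>[OF \<rho>(1)] unfolding \<rho>(2) by blast
    then have "j = 2 \<or> j = 3 \<or> j = 4" by auto
    then show "x \<in> ?O" using j(2) by auto
  next
    fix x assume "x \<in> ?O"
    then have "\<exists>j\<in>{2..4}. x = \<alpha> j \<or> x = - \<alpha> j" by (auto intro: bexI[of _ 2] bexI[of _ 3] bexI[of _ 4])
    then obtain j where j: "j \<in> {2..4}" "x = \<alpha> j \<or> x = - \<alpha> j" by blast
    have "\<exists>\<rho>\<in>carrier (Gal LR). \<rho> (\<alpha> 2) = x"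
      using j(2) by (elim disjE) (use orbit_\<alpha>[OF j(1)] in simp_all)
    then show "x \<in> orbit (Gal LR) (\<lambda>\<rho>. \<rho>) (\<alpha> 2)" unfolding orbit_def by blast
  qed
  moreover have "card ?O = 6"
  proof -
    \<comment> \<open>Different squares separate the \<open>\<alpha> j\<close> up to sign, and a
      nonzero number differs from its negative.\<close>
    have *: "a \<noteq> b" "a \<noteq> - b" if "a\<^sup>2 \<noteq> b\<^sup>2" for a b :: complex using that by auto
    have sq: "(\<alpha> 2)\<^sup>2 \<noteq> (\<alpha> 3)\<^sup>2" "(\<alpha> 2)\<^sup>2 \<noteq> (\<alpha> 4)\<^sup>2" "(\<alpha> 3)\<^sup>2 \<noteq> (\<alpha> 4)\<^sup>2" unfolding \<alpha>_square using z_distinct by simp_all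
    have "\<alpha> 2 \<noteq> 0" "\<alpha> 3 \<noteq> 0" "\<alpha> 4 \<noteq> 0" using \<alpha>_square[of 2] \<alpha>_square[of 3] \<alpha>_square[of 4] z_distinct by auto
    then show ?thesis
      using *[OF sq(1)] *[OF sq(2)] *[OF sq(3)] by (auto simp: eq_neg_iff_add_eq_0 neg_equal_iff_equal add.commute)
  qed
  ultimately show ?thesis by simp
qed

lemma H_subgroup: "subgroup H (Gal LR)"
  unfolding H_def by (rule G.stab_subgroup) (use \<alpha>_L[of 2] in simp)

lemma F_subfield: "subfield F LR"
  unfolding F_def by (rule G.fixed_by_subfield[OF subgroup.subset[OF H_subgroup]])

lemma stab_F: "G.stab F = H"
  unfolding F_def by (rule G.stab_fixed_by[OF H_subgroup])

lemma \<alpha>_F: "\<alpha> 2 \<in> F"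
  unfolding F_def G.fixed_by_def H_def G.stab_def using \<alpha>_L[of 2] by auto

lemma F_number_field: "number_field FR"
  using G.number_field_sub[OF L_number_field F_subfield] by simp

lemma F_sextic: "sextic FR"
proof -
  have Q: "rat_subfield LR \<subseteq> F" by (rule G.rat_subfield_subset[OF F_subfield])
  have "G.dimension 6 (rat_subfield LR) F"
    unfolding G.dimension_iff_card_stab[OF G.rat_subfield_subfield F_subfield Q] G.card_stab_rat stab_F
    by (rule card_Gal)
  then have "ring.dimension (LR\<lparr>carrier := F\<rparr>) 6 (rat_subfield LR) F"
    using G.dimension_sub[OF F_subfield G.rat_subfield_subfield Q subset_refl] by blast
  then show ?thesis
    unfolding sextic_def using G.rat_subfield_sub[OF F_subfield] by simp
qed

lemma \<alpha>_not_real: "j \<in> {2..4} \<Longrightarrow> \<alpha> j \<notin> \<real>"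
proof
  assume j: "j \<in> {2..4}" and "\<alpha> j \<in> \<real>"
  then obtain s where "\<alpha> j = complex_of_real s" by (auto elim: Reals_cases)
  then have "z 1 j = - complex_of_real (s\<^sup>2)" using \<alpha>_square[of j] by simp
  then show False using not_nonpos_z[OF j, of "s\<^sup>2"] by simp
qed

lemma complex_conjugation: "\<exists>c\<in>carrier (Gal LR). \<forall>x\<in>L. c x = cnj x"
proof -
  have "cnj \<in> ring_hom LR complex_field" by (auto simp: ring_hom_def)
  then obtain c where "c \<in> carrier (Gal LR)" "\<And>x. x \<in> carrier LR \<Longrightarrow> cnj x = id (c x)"
    using G.hom_eq_h_comp by blast
  then show ?thesis by (intro bexI[of _ c]) auto
qed

text \<open>Every embedding sends \<open>\<alpha> 2\<close> to some \<open>\<alpha> j\<close> or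
  \<open>- \<alpha> j\<close>, none of which is real.\<close>

lemma F_totally_imaginary: "totally_imaginary FR"
proof -
  obtain c where c: "c \<in> carrier (Gal LR)" "\<And>x. x \<in> L \<Longrightarrow> c x = cnj x" using complex_conjugation by blast
  interpret C: Galois_conjugation LR id c by unfold_locales (use c in auto)
  have FL: "F \<subseteq> carrier LR" by (rule subfieldE(3)[OF F_subfield])
  have "inv\<^bsub>Gal LR\<^esub> \<rho> \<otimes>\<^bsub>Gal LR\<^esub> c \<otimes>\<^bsub>Gal LR\<^esub> \<rho> \<notin> G.stab F" if \<rho>: "\<rho> \<in> carrier (Gal LR)" for \<rho>
  proof -
    obtain j where "j \<in> {2..4}" "\<rho> (\<alpha> 2) = \<alpha> j \<or> \<rho> (\<alpha> 2) = - \<alpha> j" using Gal_\<alpha>[OF \<rho>] by blast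
    then have "\<rho> (\<alpha> 2) \<notin> \<real>" using \<alpha>_not_real by auto
    then show ?thesis using C.conj_in_stab_iff[OF FL \<rho>] \<alpha>_F by auto
  qed
  then show ?thesis using C.totally_imaginary_iff_stab[OF F_subfield] by simp
qed

text \<open>A Galois field containing \<open>F\<close> contains all conjugates
  \<open>\<alpha> j\<close>, their product -i, hence the quotients \<open>t 1 + t j\<close>. The sum
  of these for j = 2, 3, 4 is \<open>2 * t 1\<close> because the roots have sum 0; so all generators
  of \<open>L\<close> are reached.\<close>

lemma L_Galois_closure: "Galois_closure FR LR"
  unfolding Galois_closure_def
proof (intro conjI L_Galois bexI[of _ id] allI impI; (elim conjE)?)
  show "id \<in> ring_hom FR LR" using subfieldE(3)[OF F_subfield] by (auto simp: ring_hom_def)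
  interpret C: field complex_field by (rule field_complex_field)
  fix E assume E: "subfield E LR" "id ` carrier FR \<subseteq> E" "Galois_number_field (LR\<lparr>carrier := E\<rparr>)"
  let ?E = "complex_field\<lparr>carrier := E\<rparr>"
  have EC: "subfield E complex_field" "E \<subseteq> L" using E(1) C.subfield_sub_iff[OF L_subfield] by auto
  have FE: "F \<subseteq> E" using E(2) by auto
  note E' = subringE[OF subfieldE(1)[OF EC(1)]]
  have add: "x + y \<in> E" "x * y \<in> E" "- x \<in> E" if "x \<in> E" "y \<in> E" for x y
    using E'(5-7) that by auto
  have div: "x / y \<in> E" if "x \<in> E" "y \<in> E" for x y
    using CC.subfield_m_inv(1)[OF EC(1), of y] add(2)[of x "inverse y"] that E'(2)
    by (cases "y = 0") (auto simp: divide_inverse)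
  have "field ?E" "Galois_number_field ?E" "id \<in> ring_hom ?E complex_field"
    using CC.subfield_iff(2)[OF EC(1)] E(3) by (simp_all add: ring_hom_def)
  then interpret GE: Galois_embedding ?E id
    by (intro Galois_embedding.intro Galois_embedding_axioms.intro)
  \<comment> \<open>Restricted to \<open>E\<close>, \<rho> is an embedding of a Galois field, so it
    takes the same values there as some automorphism of \<open>E\<close>.\<close>
  have conj: "\<rho> x \<in> E" if \<rho>: "\<rho> \<in> carrier (Gal LR)" and x: "x \<in> E" for \<rho> x
  proof -
    have "\<rho> \<in> ring_hom ?E complex_field" using Gal_complex_hom[OF \<rho>] EC(2) by (auto simp: ring_hom_def subset_iff)
    then obtain \<tau> where "\<tau> \<in> carrier (Gal ?E)" "\<And>y. y \<in> carrier ?E \<Longrightarrow> \<rho> y = id (\<tau> y)" using GE.hom_eq_h_comp by blast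
    then show ?thesis using Gal_closed[of \<tau> ?E x] x by simp
  qed
  have \<alpha>E: "\<alpha> j \<in> E" if "j \<in> {2..4}" for j using orbit_\<alpha>(1)[OF that] conj \<alpha>_F FE by force
  have num: "of_int n \<in> E" for n by (rule of_int_in_subfield[OF EC(1)])
  have "\<alpha> 2 * \<alpha> 3 * \<alpha> 4 = - \<i> * ((t 1 + t 2) * (t 1 + t 3) * (t 1 + t 4))"
    unfolding \<alpha>_def by (simp add: algebra_simps)
  then have "\<alpha> 2 * \<alpha> 3 * \<alpha> 4 = - \<i>" unfolding sums_product by simp
  then have i: "\<i> \<in> E" using add(2)[OF add(2)[OF \<alpha>E \<alpha>E] \<alpha>E, of 2 3 4] add(3)[of "- \<i>" "- \<i>"] by simp
  have s: "t 1 + t j \<in> E" if "j \<in> {2..4}" for j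
    using div[OF \<alpha>E[OF that] i] unfolding \<alpha>_def by (simp add: add.commute)
  have half: "((t 1 + t 2) + (t 1 + t 3) + (t 1 + t 4)) / of_int 2 = t 1"
    using e1 by (simp add: add_eq_0_iff t4)
  have t1: "t 1 \<in> E" using div[OF add(1)[OF add(1)[OF s s] s] num[of 2], of 2 3 4] unfolding half by simp
  have "t j \<in> E" if j: "j \<in> {1..4}" for j
  proof (cases "j = 1")
    case False
    then have "j \<in> {2..4}" using j by auto
    then show ?thesis using add(1)[OF s[of j] add(3)[OF t1 t1]] by simp
  qed (use t1 in simp)
  then have "L \<subseteq> E" by (rule L_subset[OF EC(1) _ i])
  then show "E = carrier LR" using EC(2) by auto
qed

text \<open>Complex conjugation corresponds to the central element iff it fixes all \<open>t j\<close>.\<close>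

theorem quartic_example:
  "number_field FR" "sextic FR" "totally_imaginary FR" "Galois_closure FR LR" "Gal LR \<cong> S4_C2"
  "CM_type FR \<longleftrightarrow> (\<forall>j\<in>{1..4}. t j \<in> \<real>)"
proof -
  show *: "number_field FR" "sextic FR" "totally_imaginary FR" "Galois_closure FR LR"
    by (fact F_number_field F_sextic F_totally_imaginary L_Galois_closure)+
  show "Gal LR \<cong> S4_C2" using \<Phi>_iso by (auto simp: is_iso_def)
  obtain c where c: "c \<in> carrier (Gal LR)" "\<And>x. x \<in> L \<Longrightarrow> c x = cnj x" using complex_conjugation by blast
  have "represents_conjugation LR c"
    unfolding represents_conjugation_def using c id_hom by (intro conjI bexI[of _ id]) auto
  from CM_type_iff_central[OF * \<Phi>_iso this] have "CM_type FR \<longleftrightarrow> \<Phi> c = (id, 1)" .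
  also have "\<dots> \<longleftrightarrow> root_perm c = id" using c(2)[OF generators(2)] unfolding \<Phi>_def by simp
  also have "\<dots> \<longleftrightarrow> (\<forall>j\<in>{1..4}. c (t j) = t j)"
  proof
    assume "root_perm c = id"
    then show "\<forall>j\<in>{1..4}. c (t j) = t j" using root_perm_apply(2)[OF c(1)] by simp
  next
    assume "\<forall>j\<in>{1..4}. c (t j) = t j"
    then show "root_perm c = id" by (intro root_perm_unique[OF c(1) permutes_id]) auto
  qed
  also have "\<dots> \<longleftrightarrow> (\<forall>j\<in>{1..4}. t j \<in> \<real>)"
    using c(2)[OF generators(1)] by (simp add: Reals_cnj_iff)
  finally show "CM_type FR \<longleftrightarrow> (\<forall>j\<in>{1..4}. t j \<in> \<real>)" .
qed

end

section \<open>The two examples and the theorem\<close>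

lemma quartic_roots:
  obtains t :: "nat \<Rightarrow> complex" where "t 1 + t 2 + t 3 + t 4 = 0"
    "t 1 * t 2 + t 1 * t 3 + t 1 * t 4 + t 2 * t 3 + t 2 * t 4 + t 3 * t 4 = p"
    "t 1 * t 2 * t 3 + t 1 * t 2 * t 4 + t 1 * t 3 * t 4 + t 2 * t 3 * t 4 = 1"
    "t 1 * t 2 * t 3 * t 4 = r"
proof -
  let ?f = "[:r, - 1, p, 0, 1:]"
  obtain A where A: "size A = degree ?f" "?f = smult (lead_coeff ?f) (\<Prod>x\<in>#A. [:- x, 1:])"
    using alg_closed_imp_factorization[of ?f] by auto
  obtain xs where xs: "mset xs = A" using ex_mset by blast
  have "length xs = 4" using A(1) unfolding xs[symmetric] by simp
  then obtain a b c d where "xs = [a, b, c, d]" by (auto simp: numeral_eq_Suc length_Suc_conv)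
  then have "(\<Prod>x\<in>#A. [:- x, 1:]) = [:- a, 1:] * [:- b, 1:] * [:- c, 1:] * [:- d, 1:]"
    unfolding xs[symmetric] by (simp add: mult.assoc del: mult_pCons_left mult_pCons_right)
  moreover have "lead_coeff ?f = 1" by simp
  ultimately have "?f = [:- a, 1:] * [:- b, 1:] * [:- c, 1:] * [:- d, 1:]"
    using A(2) by (simp only: smult_1_left)
  also have "\<dots> = [:a * b * c * d, - (a * b * c + a * b * d + a * c * d + b * c * d),
      a * b + a * c + a * d + b * c + b * d + c * d, - (a + b + c + d), 1:]"
    by (simp add: algebra_simps)
  finally have *: "r = a * b * c * d" "- 1 = - (a * b * c + a * b * d + a * c * d + b * c * d)"
    "p = a * b + a * c + a * d + b * c + b * d + c * d" "0 = - (a + b + c + d)"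
    unfolding pCons_eq_iff by blast+
  define t where "t j = (if j = 1 then a else if j = 2 then b else if j = 3 then c else d)" for j :: nat
  have t: "t 1 = a" "t 2 = b" "t 3 = c" "t 4 = d" by (simp_all add: t_def)
  have "a + b + c + d = 0" "a * b + a * c + a * d + b * c + b * d + c * d = p"
    "a * b * c + a * b * d + a * c * d + b * c * d = 1" "a * b * c * d = r"
    using *(3) *(1)[symmetric] arg_cong[OF *(2), of uminus] arg_cong[OF *(4), of uminus] unfolding minus_minus by simp_all
  then show thesis using that[of t] unfolding t by blast
qed

lemma not_square_between:
  fixes k m n :: int
  assumes "0 \<le> k" "k\<^sup>2 < m" "m < (k + 1)\<^sup>2"
  shows "m \<noteq> n\<^sup>2"
proof
  assume "m = n\<^sup>2"
  then have "k\<^sup>2 < \<bar>n\<bar>\<^sup>2" "\<bar>n\<bar>\<^sup>2 < (k + 1)\<^sup>2" using assms by simp_all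
  then have "k < \<bar>n\<bar>" "\<bar>n\<bar> < k + 1" 
    using power_less_imp_less_base[of k 2 "\<bar>n\<bar>"] power_less_imp_less_base[of "\<bar>n\<bar>" 2 "k + 1"] assms(1) by simp_all
  then show False by simp
qed

lemma monic_cubic_root:
  fixes n a b :: int
  assumes "n ^ 3 + a * n\<^sup>2 + b * n - 1 = 0" shows "n = 1 \<or> n = - 1"
proof -
  have "n * (n\<^sup>2 + a * n + b) = 1" using assms by (simp add: power2_eq_square power3_eq_cube algebra_simps)
  then have "n dvd 1" by (metis dvdI)
  then show ?thesis by (simp add: zdvd1_eq abs_if split: if_splits)
qed

lemma TR_example:
  obtains F L :: "complex ring" where "number_field F" "sextic F" "totally_imaginary F" "Galois_closure F L"
    "Gal L \<cong> S4_C2" "TR_type F"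
proof -
  obtain t :: "nat \<Rightarrow> complex" where t: "t 1 + t 2 + t 3 + t 4 = 0"
    "t 1 * t 2 + t 1 * t 3 + t 1 * t 4 + t 2 * t 3 + t 2 * t 4 + t 3 * t 4 = of_int 0"
    "t 1 * t 2 * t 3 + t 1 * t 2 * t 4 + t 1 * t 3 * t 4 + t 2 * t 3 * t 4 = 1"
    "t 1 * t 2 * t 3 * t 4 = of_int (- 1)" by (rule quartic_roots)
  \<comment> \<open>The quartic x^4 - x - 1, with resolvent cubic x^3 + 4 x - 1 and discriminant
    -283.\<close>
  interpret quartic t 0 "- 1"
  proof (unfold_locales; (fact t)?)
    fix n :: int
    \<comment> \<open>n^4 and n have the same parity, so the value is odd and cannot vanish.\<close>
    have "odd (n ^ 4 + 0 * n\<^sup>2 - n + - 1)" by simp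
    then show "n ^ 4 + 0 * n\<^sup>2 - n + - 1 \<noteq> 0" by (metis even_zero)
    show "n ^ 3 + 2 * 0 * n\<^sup>2 + (0\<^sup>2 - 4 * - 1) * n - 1 \<noteq> 0"
      using monic_cubic_root[of n 0 4] by auto
    \<comment> \<open>16^2 = 256 < 283 < 289 = 17^2.\<close>
    show "\<bar>4 * 0\<^sup>2 * (0\<^sup>2 - 4 * - 1)\<^sup>2 - 4 * (0\<^sup>2 - 4 * - 1) ^ 3 + 32 * 0 ^ 3 - 36 * 0 * (0\<^sup>2 - 4 * - 1) - 27\<bar> \<noteq> n\<^sup>2"
      using not_square_between[of 16 283 n] by simp
  qed auto
  have "\<not> (\<forall>j\<in>{1..4}. t j \<in> \<real>)"
  proof
    assume "\<forall>j\<in>{1..4}. t j \<in> \<real>"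
    then obtain s where s: "\<And>j. j \<in> {1..4} \<Longrightarrow> t j = complex_of_real (s j)"
      unfolding Reals_def image_iff by metis
    have st: "t 1 = s 1" "t 2 = s 2" "t 3 = s 3" "t 4 = s 4" using s by simp_all
    \<comment> \<open>The squares of the roots sum to 0, so real roots would all be 0, whereas their
      product is -1.\<close>
    have "a\<^sup>2 + b\<^sup>2 + c\<^sup>2 + d\<^sup>2 = (a + b + c + d)\<^sup>2 - 2 * (a * b + a * c + a * d + b * c + b * d + c * d)"
      for a b c d :: complex by Groebner_Basis.algebra
    from this[of "t 1" "t 2" "t 3" "t 4"] have "(t 1)\<^sup>2 + (t 2)\<^sup>2 + (t 3)\<^sup>2 + (t 4)\<^sup>2 = 0"
      unfolding t(1,2) by simp
    then have "complex_of_real ((s 1)\<^sup>2 + (s 2)\<^sup>2 + (s 3)\<^sup>2 + (s 4)\<^sup>2) = 0" unfolding st by simp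
    then have "(s 1)\<^sup>2 + (s 2)\<^sup>2 + (s 3)\<^sup>2 + (s 4)\<^sup>2 = 0" unfolding of_real_eq_0_iff .
    then have "(s 1)\<^sup>2 = 0"
      using zero_le_power2[of "s 1"] zero_le_power2[of "s 2"] zero_le_power2[of "s 3"] zero_le_power2[of "s 4"] by linarith
    then show False using t(4) unfolding st by simp
  qed
  then show thesis using that[OF quartic_example(1-5)] quartic_example(3,6) by (simp add: TR_type_iff)
qed

lemma CM_example:
  obtains F L :: "complex ring" where "number_field F" "sextic F" "totally_imaginary F" "Galois_closure F L"
    "Gal L \<cong> S4_C2" "CM_type F"
proof -
  obtain t :: "nat \<Rightarrow> complex" where t: "t 1 + t 2 + t 3 + t 4 = 0"
    "t 1 * t 2 + t 1 * t 3 + t 1 * t 4 + t 2 * t 3 + t 2 * t 4 + t 3 * t 4 = of_int (- 4)"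
    "t 1 * t 2 * t 3 + t 1 * t 2 * t 4 + t 1 * t 3 * t 4 + t 2 * t 3 * t 4 = 1"
    "t 1 * t 2 * t 3 * t 4 = of_int 1" by (rule quartic_roots)
  \<comment> \<open>The quartic x^4 - 4 x^2 - x + 1, with resolvent cubic x^3 - 8 x^2 + 12 x - 1 and
    discriminant 1957.\<close>
  interpret quartic t "- 4" 1
  proof (unfold_locales; (fact t)?)
    fix n :: int
    have "odd (n ^ 4 + - 4 * n\<^sup>2 - n + 1)" by simp
    then show "n ^ 4 + - 4 * n\<^sup>2 - n + 1 \<noteq> 0" by (metis even_zero)
    show "n ^ 3 + 2 * - 4 * n\<^sup>2 + ((- 4)\<^sup>2 - 4 * 1) * n - 1 \<noteq> 0"
      using monic_cubic_root[of n "- 8" 12] by auto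
    \<comment> \<open>44^2 = 1936 < 1957 < 2025 = 45^2.\<close>
    show "\<bar>4 * (- 4)\<^sup>2 * ((- 4)\<^sup>2 - 4 * 1)\<^sup>2 - 4 * ((- 4)\<^sup>2 - 4 * 1) ^ 3 + 32 * (- 4) ^ 3
        - 36 * - 4 * ((- 4)\<^sup>2 - 4 * 1) - 27\<bar> \<noteq> n\<^sup>2"
      using not_square_between[of 44 1957 n] by simp
  qed auto
  define f where "f x = x ^ 4 - 4 * x\<^sup>2 - x + 1" for x :: real
  have cont: "continuous_on A f" "continuous_on A (\<lambda>x. - f x)" for A unfolding f_def by (intro continuous_intros)+
  \<comment> \<open>The sign changes locate a real root in each of [-2,-1], [-1,0], [0,1] and
    [2,3].\<close>
  have f: "f (- 2) = 3" "f (- 1) = - 1" "f 0 = 1" "f 1 = - 3" "f 2 = - 1" "f 3 = 43" by (simp_all add: f_def)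
  obtain a where a: "- 2 \<le> a" "a \<le> - 1" "f a = 0"
    using IVT'[of "\<lambda>x. - f x" "- 2" 0 "- 1"] cont(2) f by auto
  obtain b where b: "- 1 \<le> b" "b \<le> 0" "f b = 0" using IVT'[of f "- 1" 0 0] cont(1) f by auto
  obtain c where c: "0 \<le> c" "c \<le> 1" "f c = 0" using IVT'[of "\<lambda>x. - f x" 0 0 1] cont(2) f by auto
  obtain d where d: "2 \<le> d" "d \<le> 3" "f d = 0" using IVT'[of f 2 0 3] cont(1) f by auto
  \<comment> \<open>The first three intervals meet only in -1 and 0, where \<open>f\<close> does not
    vanish.\<close>
  have "a \<noteq> b" "b \<noteq> c" "a \<noteq> c" "a \<noteq> d" "b \<noteq> d" "c \<noteq> d" using a b c d f by auto
  then have card: "card (complex_of_real ` {a, b, c, d}) = 4" by (subst card_image) (auto simp: inj_on_def)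
  have "complex_of_real x \<in> t ` {1..4}" if "x \<in> {a, b, c, d}" for x
  proof -
    have "complex_of_real (f x) = 0" using that a(3) b(3) c(3) d(3) by auto
    then have "complex_of_real x ^ 4 + of_int (- 4) * (complex_of_real x)\<^sup>2 - complex_of_real x + of_int 1 = 0"
      unfolding f_def by simp
    then show ?thesis unfolding root_iff by blast
  qed
  then have sub: "complex_of_real ` {a, b, c, d} \<subseteq> t ` {1..4}" by blast
  have "card (t ` {1..4}) \<le> 4" using card_image_le[of "{1..4::nat}" t] by simp
  then have "complex_of_real ` {a, b, c, d} = t ` {1..4}"
    using card_seteq[OF _ sub] card by simp
  then have "\<forall>j\<in>{1..4}. t j \<in> \<real>" by (metis Reals_of_real image_eqI imageE)
  then show thesis using that[OF quartic_example(1-5)] quartic_example(6) by blast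
qed

theorem theorem4p1:
  shows
    "(\<forall>(F :: 'a ring) (L :: 'b ring).
        number_field F \<and> sextic F \<and> totally_imaginary F \<and> Galois_closure F L \<longrightarrow>
        (Gal L \<cong> sym_group 4 \<or> Gal L \<cong> sym_group 5 \<or> Gal L \<cong> sym_group 6 \<longrightarrow> TR_type F) \<and>
        (Gal L \<cong> integer_mod_group 6 \<or>
         Gal L \<cong> sym_group 3 \<or>
         Gal L \<cong> dihedral_group 6 \<or>
         Gal L \<cong> sym_group 3 \<times>\<times> integer_mod_group 3 \<or>
         Gal L \<cong> alt_group 4 \<times>\<times> integer_mod_group 2 \<or>
         Gal L \<cong> sym_group 3 \<times>\<times> sym_group 3 \<or>
         Gal L \<cong> C3_squared_D4 \<longrightarrow> CM_type F)) \<and>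
     (\<exists>(F :: complex ring) (L :: complex ring).
        number_field F \<and> sextic F \<and> totally_imaginary F \<and> Galois_closure F L \<and>
        Gal L \<cong> sym_group 4 \<times>\<times> integer_mod_group 2 \<and> CM_type F) \<and>
     (\<exists>(F :: complex ring) (L :: complex ring).
        number_field F \<and> sextic F \<and> totally_imaginary F \<and> Galois_closure F L \<and>
        Gal L \<cong> sym_group 4 \<times>\<times> integer_mod_group 2 \<and> TR_type F) \<and>
     (\<exists>S. S \<subseteq> {g \<in> carrier (sym_group 4 \<times>\<times> integer_mod_group 2).
              group.ord (sym_group 4 \<times>\<times> integer_mod_group 2) g = 2} \<and>
        (\<forall>(F :: 'a ring) (L :: 'b ring) \<theta> c.
          number_field F \<and> sextic F \<and> totally_imaginary F \<and> Galois_closure F L \<and>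
          \<theta> \<in> iso (Gal L) (sym_group 4 \<times>\<times> integer_mod_group 2) \<and>
          represents_conjugation L c \<longrightarrow>
          (CM_type F \<longleftrightarrow> \<theta> c \<in> S) \<and> (TR_type F \<longleftrightarrow> \<theta> c \<notin> S)))"
proof (intro conjI allI impI; (elim conjE)?)
  fix F :: "'a ring" and L :: "'b ring"
  assume F: "number_field F" "sextic F" "totally_imaginary F" "Galois_closure F L"
  assume "Gal L \<cong> sym_group 4 \<or> Gal L \<cong> sym_group 5 \<or> Gal L \<cong> sym_group 6"
  then show "TR_type F"
    using TR_type_of_group[OF F _ sym_group_is_group] not_CM_subgroups_S4
      not_CM_subgroups_sym_group[of 5] not_CM_subgroups_sym_group[of 6] by auto
next
  fix F :: "'a ring" and L :: "'b ring"
  assume F: "number_field F" "sextic F" "totally_imaginary F" "Galois_closure F L"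
  note CM = CM_type_of_group[OF F]
  assume "Gal L \<cong> integer_mod_group 6 \<or> Gal L \<cong> sym_group 3 \<or> Gal L \<cong> dihedral_group 6 \<or>
    Gal L \<cong> sym_group 3 \<times>\<times> integer_mod_group 3 \<or> Gal L \<cong> alt_group 4 \<times>\<times> integer_mod_group 2 \<or>
    Gal L \<cong> sym_group 3 \<times>\<times> sym_group 3 \<or> Gal L \<cong> C3_squared_D4"
  then show "CM_type F"
    using CM[OF _ group_integer_mod_group CM_subgroups_C6] CM[OF _ sym_group_is_group CM_subgroups_S3]
      CM[OF _ dihedral_group_group CM_subgroups_D6] CM[OF _ C3_squared_D4_group CM_subgroups_C3_squared_D4]
      CM[OF _ DirProd_group[OF sym_group_is_group group_integer_mod_group] CM_subgroups_S3_C3]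
      CM[OF _ DirProd_group[OF alt_group_is_group group_integer_mod_group] CM_subgroups_A4_C2]
      CM[OF _ DirProd_group[OF sym_group_is_group sym_group_is_group] CM_subgroups_S3_S3]
    by (elim disjE) simp_all
next
  obtain F L :: "complex ring" where "number_field F" "sextic F" "totally_imaginary F" "Galois_closure F L"
    "Gal L \<cong> S4_C2" "CM_type F" by (rule CM_example)
  then show "\<exists>(F :: complex ring) (L :: complex ring). number_field F \<and> sextic F \<and> totally_imaginary F \<and>
      Galois_closure F L \<and> Gal L \<cong> S4_C2 \<and> CM_type F" by blast
next
  obtain F L :: "complex ring" where "number_field F" "sextic F" "totally_imaginary F" "Galois_closure F L"
    "Gal L \<cong> S4_C2" "TR_type F" by (rule TR_example)
  then show "\<exists>(F :: complex ring) (L :: complex ring). number_field F \<and> sextic F \<and> totally_imaginary F \<and>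
      Galois_closure F L \<and> Gal L \<cong> S4_C2 \<and> TR_type F" by blast
next
  \<comment> \<open>The witness consists of the central involution alone. It is fixed by every
    automorphism of S_4 x C_2, so that one set serves all fields and all isomorphisms
    \<theta>.\<close>
  show "\<exists>S. S \<subseteq> {g \<in> carrier S4_C2. group.ord S4_C2 g = 2} \<and>
      (\<forall>(F :: 'a ring) (L :: 'b ring) \<theta> c.
        number_field F \<and> sextic F \<and> totally_imaginary F \<and> Galois_closure F L \<and> \<theta> \<in> iso (Gal L) S4_C2 \<and>
        represents_conjugation L c \<longrightarrow> (CM_type F \<longleftrightarrow> \<theta> c \<in> S) \<and> (TR_type F \<longleftrightarrow> \<theta> c \<notin> S))"
    using S4_C2_central_order CM_type_iff_central
    by (intro exI[of _ "{(id, 1)}"]) (auto simp: TR_type_iff)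
qed

end
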